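(* Let $M = D_X u$ be a left $D_X$-module generated by $u$ and let $f \in K[x]$ be a non-constant polynomial. Then the $b$-function $b_{u,f}(s)$ exists if and only if there exists a nonzero polynomial $b(s) \in K[s]$ such that $$b(-\partial_t t)(u\otimes\delta(t-f)) \in tD_X[t\partial_t](u\otimes\delta(t-f)) = D_X[t\partial_t]t(u\otimes\delta(t-f)) = D_X[t\partial_t]f(u\otimes\delta(t-f))$$ in $M\otimes_{K[x]}B_{Z|Y}$. If $M$ is $f$-saturated and such $b(s)$ exists, then $b_{u,f}(s)$ is the monic polynomial of the minimum degree among such $b(s)$.
   Context: $K$ is a field of characteristic zero, $K[x]=K[x_1,\dots,x_n]$, $X=K^n$, $D_X$ is the $n$-th Weyl algebra in $x$; $t$ is a new variable, $Y=K^{n+1}$ with coordinates $(x,t)$, $D_Y$ is the Weyl algebra in $(x,t)$, and $D_X[t\partial_t]\subset D_Y$ is the subring generated by $D_X$ and $t\partial_t$. Put $f_i=\partial f/\partial x_i$ and $Z=\{(x,t)\in Y\mid t=f(x)\}$. Let $B_{Z|Y}=K[x,t,(t-f)^{-1}]/K[x,t]$, a left $D_Y$-module, and let $\delta(t-f)\in B_{Z|Y}$ be the residue class of $1/(t-f)$. $M\otimes_{K[x]}B_{Z|Y}$ is a left $D_Y$-module: $t,\partial_t$ act on the second factor and $\partial_{x_i}$ by the Leibniz rule. Let $s$ be an indeterminate commuting with $D_X$, and let $\mathcal{L}=K[x,f^{-1},s]f^s$ be the free $K[x,f^{-1},s]$-module with free generator $f^s$, made into a left $D_X[s]$-module by $\partial_{x_i}(a(x,s)f^{-k}f^s)=\left(\frac{\partial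 a(x,s)}{\partial x_i}f^{-k}+(s-k)f_i a(x,s)f^{-k-1}\right)f^s$; $M\otimes_{K[x]}\mathcal{L}$ is a left $D_X[s]$-module via the Leibniz rule. For $k\in\mathbb{Z}$, $f^{s+k}$ denotes $f^kf^s$. The $b$-function $b_{u,f}(s)$ is the monic polynomial $b(s)\in K[s]$ of least degree such that $b(s)(u\otimes f^s)\in D_X[s](u\otimes f^{s+1})$ in $M\otimes_{K[x]}\mathcal{L}$; it is said to exist if there is a nonzero $b(s)\in K[s]$ with this property. $M$ is $f$-saturated ($f$-torsion free) if multiplication $f:M\to M$ is injective. *)

theory Defs
  imports
    "HOL-Algebra.Algebraic_Closure_Type"
    "HOL-Algebra.Generated_Rings"
    "HOL-Algebra.Free_Abelian_Groups"
begin

section \<open>Polynomials in several variables\<close>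

text \<open>
  The polynomial ring in variables indexed by \<open>'v\<close>: a polynomial is a finitely supported
  function on exponent vectors. For finite \<open>'v\<close> with \<open>n\<close> elements this is \<open>K[x\<^sub>1,\<dots>,x\<^sub>n]\<close>.
\<close>

type_synonym ('v, 'k) mpoly = "('v \<Rightarrow>\<^sub>0 nat) \<Rightarrow>\<^sub>0 'k"

definition mpoly_const :: "'k::zero \<Rightarrow> ('v, 'k) mpoly" where
  "mpoly_const c = Poly_Mapping.single 0 c"

definition mpoly_var :: "'v \<Rightarrow> ('v, 'k::zero_neq_one) mpoly" where
  "mpoly_var i = Poly_Mapping.single (Poly_Mapping.single i 1) 1"

definition mpoly_deriv :: "'v \<Rightarrow> ('v, 'k::comm_ring_1) mpoly \<Rightarrow> ('v, 'k) mpoly" where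
  "mpoly_deriv i p = (\<Sum>m\<in>Poly_Mapping.keys p.
     Poly_Mapping.single (m - Poly_Mapping.single i 1)
       (of_nat (Poly_Mapping.lookup m i) * Poly_Mapping.lookup p m))"


section \<open>Left modules over a (not necessarily commutative) ring\<close>

text \<open>
  The library's \<^locale>\<open>module\<close> demands a commutative ring of scalars. As there, only the additive
  part of the record \<open>M\<close> and its scalar multiplication are relevant.
\<close>

locale left_module = R?: ring R + M?: abelian_group M
  for R :: "('r, 'c) ring_scheme" (structure)
    and M :: "('r, 'm, 'd) module_scheme" (structure) +
  assumes smult_closed:
      "\<lbrakk>a \<in> carrier R; x \<in> carrier M\<rbrakk> \<Longrightarrow> a \<odot>\<^bsub>M\<^esub> x \<in> carrier M"
    and smult_l_distr:
      "\<lbrakk>a \<in> carrier R; b \<in> carrier R; x \<in> carrier M\<rbrakk> \<Longrightarrow>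
        (a \<oplus>\<^bsub>R\<^esub> b) \<odot>\<^bsub>M\<^esub> x = a \<odot>\<^bsub>M\<^esub> x \<oplus>\<^bsub>M\<^esub> b \<odot>\<^bsub>M\<^esub> x"
    and smult_r_distr:
      "\<lbrakk>a \<in> carrier R; x \<in> carrier M; y \<in> carrier M\<rbrakk> \<Longrightarrow>
        a \<odot>\<^bsub>M\<^esub> (x \<oplus>\<^bsub>M\<^esub> y) = a \<odot>\<^bsub>M\<^esub> x \<oplus>\<^bsub>M\<^esub> a \<odot>\<^bsub>M\<^esub> y"
    and smult_assoc1:
      "\<lbrakk>a \<in> carrier R; b \<in> carrier R; x \<in> carrier M\<rbrakk> \<Longrightarrow>
        (a \<otimes>\<^bsub>R\<^esub> b) \<odot>\<^bsub>M\<^esub> x = a \<odot>\<^bsub>M\<^esub> (b \<odot>\<^bsub>M\<^esub> x)"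
    and smult_one:
      "x \<in> carrier M \<Longrightarrow> \<one>\<^bsub>R\<^esub> \<odot>\<^bsub>M\<^esub> x = x"

definition restrict_scalars :: "('r \<Rightarrow> 's) \<Rightarrow> ('s, 'm) module \<Rightarrow> ('r, 'm) module" where
  "restrict_scalars h M =
     \<lparr>carrier = carrier M, monoid.mult = monoid.mult M, monoid.one = monoid.one M,
      ring.zero = ring.zero M, ring.add = ring.add M, module.smult = (\<lambda>a x. module.smult M (h a) x)\<rparr>"

definition quotient_module :: "('r, 'm) module \<Rightarrow> 'm set \<Rightarrow> ('r, 'm set) module" where
  "quotient_module M N =
     \<lparr>carrier = a_rcosets\<^bsub>M\<^esub> N, monoid.mult = undefined, monoid.one = undefined,
      ring.zero = N, ring.add = set_add M,
      module.smult = (\<lambda>r C. \<Union>x\<in>C. N +>\<^bsub>M\<^esub> (r \<odot>\<^bsub>M\<^esub> x))\<rparr>"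


section \<open>The tensor product of two modules over a commutative ring\<close>

text \<open>
  \<open>M \<otimes>\<^sub>R N\<close> as an abelian group: the free abelian group on \<open>carrier M \<times> carrier N\<close> modulo the
  subgroup generated by the bilinearity and balancing relations.
\<close>

definition tensor_free :: "('r, 'a) module \<Rightarrow> ('r, 'b) module \<Rightarrow> ('a \<times> 'b \<Rightarrow>\<^sub>0 int) monoid" where
  "tensor_free M N = free_Abelian_group (carrier M \<times> carrier N)"

definition tensor_relations ::
  "('r, 'c) ring_scheme \<Rightarrow> ('r, 'a) module \<Rightarrow> ('r, 'b) module \<Rightarrow> ('a \<times> 'b \<Rightarrow>\<^sub>0 int) set" where
  "tensor_relations R M N =
     {frag_of (x \<oplus>\<^bsub>M\<^esub> x', y) - frag_of (x, y) - frag_of (x', y) | x x' y.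
        x \<in> carrier M \<and> x' \<in> carrier M \<and> y \<in> carrier N} \<union>
     {frag_of (x, y \<oplus>\<^bsub>N\<^esub> y') - frag_of (x, y) - frag_of (x, y') | x y y'.
        x \<in> carrier M \<and> y \<in> carrier N \<and> y' \<in> carrier N} \<union>
     {frag_of (a \<odot>\<^bsub>M\<^esub> x, y) - frag_of (x, a \<odot>\<^bsub>N\<^esub> y) | a x y.
        a \<in> carrier R \<and> x \<in> carrier M \<and> y \<in> carrier N}"

definition tensor_null ::
  "('r, 'c) ring_scheme \<Rightarrow> ('r, 'a) module \<Rightarrow> ('r, 'b) module \<Rightarrow> ('a \<times> 'b \<Rightarrow>\<^sub>0 int) set" where
  "tensor_null R M N = generate (tensor_free M N) (tensor_relations R M N)"

definition tensor_product ::
  "('r, 'c) ring_scheme \<Rightarrow> ('r, 'a) module \<Rightarrow> ('r, 'b) module \<Rightarrow> ('a \<times> 'b \<Rightarrow>\<^sub>0 int) set ring" where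
  "tensor_product R M N = (let Q = tensor_free M N Mod tensor_null R M N in
     \<lparr>carrier = carrier Q, monoid.mult = undefined, monoid.one = undefined,
      ring.zero = monoid.one Q, ring.add = monoid.mult Q\<rparr>)"

definition tensor_class ::
  "('r, 'c) ring_scheme \<Rightarrow> ('r, 'a) module \<Rightarrow> ('r, 'b) module
     \<Rightarrow> ('a \<times> 'b \<Rightarrow>\<^sub>0 int) \<Rightarrow> ('a \<times> 'b \<Rightarrow>\<^sub>0 int) set" where
  "tensor_class R M N c = tensor_null R M N #>\<^bsub>tensor_free M N\<^esub> c"

definition tensor_elem ::
  "('r, 'c) ring_scheme \<Rightarrow> ('r, 'a) module \<Rightarrow> ('r, 'b) module
     \<Rightarrow> 'a \<Rightarrow> 'b \<Rightarrow> ('a \<times> 'b \<Rightarrow>\<^sub>0 int) set" where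
  "tensor_elem R M N x y = tensor_class R M N (frag_of (x, y))"

text \<open>
  The additive endomorphism of \<open>M \<otimes>\<^sub>R N\<close> which sends \<open>x \<otimes> y\<close> to the class of \<open>\<phi> (x, y)\<close>,
  for \<open>\<phi>\<close> compatible with the relations.
\<close>

definition tensor_map ::
  "('r, 'c) ring_scheme \<Rightarrow> ('r, 'a) module \<Rightarrow> ('r, 'b) module \<Rightarrow> ('a \<times> 'b \<Rightarrow> ('a \<times> 'b \<Rightarrow>\<^sub>0 int))
     \<Rightarrow> ('a \<times> 'b \<Rightarrow>\<^sub>0 int) set \<Rightarrow> ('a \<times> 'b \<Rightarrow>\<^sub>0 int) set" where
  "tensor_map R M N \<phi> C = (\<Union>c\<in>C. tensor_class R M N (frag_extend \<phi> c))"


section \<open>The Weyl algebra\<close>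

text \<open>With concatenation of words, \<open>'g list \<Rightarrow>\<^sub>0 'k\<close> is the free associative algebra on \<open>'g\<close>.\<close>

instantiation list :: (type) monoid_add
begin
definition zero_list :: "'a list" where "zero_list = []"
definition plus_list :: "'a list \<Rightarrow> 'a list \<Rightarrow> 'a list" where "plus_list = (@)"
instance by standard (simp_all add: zero_list_def plus_list_def)
end

text \<open>
  The action of a free algebra on an additive group \<open>G\<close> in which the scalars act through \<open>\<kappa>\<close> and
  the generators through \<open>ops\<close>.
\<close>

definition free_act ::
  "('m, 'z) ring_scheme \<Rightarrow> ('k::zero \<Rightarrow> 'm \<Rightarrow> 'm) \<Rightarrow> ('g \<Rightarrow> 'm \<Rightarrow> 'm)
     \<Rightarrow> ('g list \<Rightarrow>\<^sub>0 'k) \<Rightarrow> 'm \<Rightarrow> 'm" where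
  "free_act G \<kappa> ops p v =
     finsum G (\<lambda>w. \<kappa> (Poly_Mapping.lookup p w) (foldr ops w v)) (Poly_Mapping.keys p)"


lemma poly_mapping_add_induct [case_names zero single add]:
  assumes "P 0" "\<And>k c. P (Poly_Mapping.single k c)" "\<And>p q. P p \<Longrightarrow> P q \<Longrightarrow> P (p + q)"
  shows "P (p :: 'a \<Rightarrow>\<^sub>0 'b::monoid_add)"
proof (induction p rule: Poly_Mapping.update_induct)
  case const show ?case by (rule assms(1))
next
  case (update g a b)
  have "Poly_Mapping.update a b g = g + Poly_Mapping.single a b"
    using update(1)
    by (intro poly_mapping_eqI)
       (auto simp: lookup_add lookup_single lookup_update in_keys_iff when_def)
  then show ?case using assms update by simp
qed

locale free_action = G?: abelian_group G
  for G :: "('m, 'z) ring_scheme" (structure) +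
  fixes \<kappa> :: "'k::comm_ring_1 \<Rightarrow> 'm \<Rightarrow> 'm" and ops :: "'g \<Rightarrow> 'm \<Rightarrow> 'm"
  assumes scal_closed [simp]: "x \<in> carrier G \<Longrightarrow> \<kappa> c x \<in> carrier G"
    and scal_add: "x \<in> carrier G \<Longrightarrow> y \<in> carrier G \<Longrightarrow> \<kappa> c (x \<oplus> y) = \<kappa> c x \<oplus> \<kappa> c y"
    and scal_plus: "x \<in> carrier G \<Longrightarrow> \<kappa> (c + d) x = \<kappa> c x \<oplus> \<kappa> d x"
    and scal_times: "x \<in> carrier G \<Longrightarrow> \<kappa> (c * d) x = \<kappa> c (\<kappa> d x)"
    and scal_one: "x \<in> carrier G \<Longrightarrow> \<kappa> 1 x = x"
    and op_closed [simp]: "x \<in> carrier G \<Longrightarrow> ops g x \<in> carrier G"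
    and op_add: "x \<in> carrier G \<Longrightarrow> y \<in> carrier G \<Longrightarrow> ops g (x \<oplus> y) = ops g x \<oplus> ops g y"
    and op_scal: "x \<in> carrier G \<Longrightarrow> ops g (\<kappa> c x) = \<kappa> c (ops g x)"
begin

lemma scal_zero [simp]: "x \<in> carrier G \<Longrightarrow> \<kappa> 0 x = \<zero>"
  using scal_plus[of x 0 0] by (metis add_0 scal_closed G.add.l_cancel_one')

lemma word_closed [simp]: "x \<in> carrier G \<Longrightarrow> foldr ops w x \<in> carrier G"
  by (induction w) auto

lemma word_add:
  "x \<in> carrier G \<Longrightarrow> y \<in> carrier G \<Longrightarrow> foldr ops w (x \<oplus> y) = foldr ops w x \<oplus> foldr ops w y"
  by (induction w) (auto simp: op_add)

lemma word_scal: "x \<in> carrier G \<Longrightarrow> foldr ops w (\<kappa> c x) = \<kappa> c (foldr ops w x)"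
  by (induction w) (auto simp: op_scal)

lemma free_act_superset:
  assumes "finite A" "Poly_Mapping.keys p \<subseteq> A" "x \<in> carrier G"
  shows "free_act G \<kappa> ops p x = finsum G (\<lambda>w. \<kappa> (Poly_Mapping.lookup p w) (foldr ops w x)) A"
  unfolding free_act_def using assms
  by (intro add.finprod_mono_neutral_cong_left) (auto simp: in_keys_iff)

lemma free_act_closed [simp]: "x \<in> carrier G \<Longrightarrow> free_act G \<kappa> ops p x \<in> carrier G"
  unfolding free_act_def by (intro finsum_closed) auto

lemma free_act_zero [simp]: "free_act G \<kappa> ops 0 x = \<zero>"
  by (simp add: free_act_def)

lemma free_act_single:
  assumes "x \<in> carrier G"
  shows "free_act G \<kappa> ops (Poly_Mapping.single w c) x = \<kappa> c (foldr ops w x)"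
  by (subst free_act_superset[of "{w}"]) (use assms in \<open>auto simp: finsum_singleton\<close>)

lemma free_act_plus:
  assumes "x \<in> carrier G"
  shows "free_act G \<kappa> ops (p + q) x = free_act G \<kappa> ops p x \<oplus> free_act G \<kappa> ops q x"
proof -
  let ?A = "Poly_Mapping.keys p \<union> Poly_Mapping.keys q"
  have "Poly_Mapping.keys (p + q) \<subseteq> ?A" by (rule Poly_Mapping.keys_add)
  with assms show ?thesis
    by (simp add: free_act_superset[of ?A] lookup_add scal_plus Pi_def flip: finsum_addf)
qed

lemma free_act_add:
  assumes "x \<in> carrier G" "y \<in> carrier G"
  shows "free_act G \<kappa> ops p (x \<oplus> y) = free_act G \<kappa> ops p x \<oplus> free_act G \<kappa> ops p y"
  using assms unfolding free_act_def
  by (simp add: word_add scal_add Pi_def flip: finsum_addf)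

lemma free_act_times:
  assumes "x \<in> carrier G"
  shows "free_act G \<kappa> ops (p * q) x = free_act G \<kappa> ops p (free_act G \<kappa> ops q x)"
proof (induction p rule: poly_mapping_add_induct)
  case (single w c)
  show ?case
  proof (induction q rule: poly_mapping_add_induct)
    case zero
    have "free_act G \<kappa> ops p \<zero> = \<zero>" for p
      using free_act_add[of \<zero> \<zero> p] by (metis G.add.l_cancel_one' G.l_zero free_act_closed zero_closed)
    then show ?case by simp
  next
    case (single v d)
    with assms show ?case
      by (simp add: Poly_Mapping.mult_single free_act_single plus_list_def word_scal scal_times)
  qed (use assms in \<open>simp add: distrib_left free_act_plus free_act_add\<close>)
qed (use assms in \<open>simp_all add: distrib_right free_act_plus\<close>)

lemma free_act_one: "x \<in> carrier G \<Longrightarrow> free_act G \<kappa> ops 1 x = x"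
  by (simp add: free_act_single zero_list_def scal_one flip: Poly_Mapping.single_one)

end

datatype 'v weyl_gen = Gx 'v | Gd 'v

abbreviation free_gen :: "'g \<Rightarrow> ('g list \<Rightarrow>\<^sub>0 'k::zero_neq_one)" where
  "free_gen g \<equiv> Poly_Mapping.single [g] 1"

definition weyl_relations :: "('v weyl_gen list \<Rightarrow>\<^sub>0 'k::field) set" where
  "weyl_relations =
     {free_gen (Gx i) * free_gen (Gx j) - free_gen (Gx j) * free_gen (Gx i) | i j. True} \<union>
     {free_gen (Gd i) * free_gen (Gd j) - free_gen (Gd j) * free_gen (Gd i) | i j. True} \<union>
     {free_gen (Gd i) * free_gen (Gx j) - free_gen (Gx j) * free_gen (Gd i)
        - (if i = j then 1 else 0) | i j. True}"

inductive_set weyl_ideal :: "('v weyl_gen list \<Rightarrow>\<^sub>0 'k::field) set" where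
  zero: "0 \<in> weyl_ideal"
| rel: "r \<in> weyl_relations \<Longrightarrow> a * r * b \<in> weyl_ideal"
| add: "p \<in> weyl_ideal \<Longrightarrow> q \<in> weyl_ideal \<Longrightarrow> p + q \<in> weyl_ideal"

lemma weyl_ideal_minus: "p \<in> weyl_ideal \<Longrightarrow> - p \<in> weyl_ideal"
proof (induction rule: weyl_ideal.induct)
  case (rel r a b)
  show ?case using weyl_ideal.rel[OF rel, of "- a" b] by simp
next
  case (add p q)
  then show ?case using weyl_ideal.add by fastforce
qed (simp add: weyl_ideal.zero)

lemma weyl_ideal_mult: "p \<in> weyl_ideal \<Longrightarrow> a * p * b \<in> weyl_ideal"
proof (induction rule: weyl_ideal.induct)
  case (rel r c d)
  show ?case using weyl_ideal.rel[OF rel, of "a * c" "d * b"] by (simp add: mult.assoc)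
qed (auto intro: weyl_ideal.intros simp: algebra_simps)

lemma weyl_ideal_diff: "p \<in> weyl_ideal \<Longrightarrow> q \<in> weyl_ideal \<Longrightarrow> p - q \<in> weyl_ideal"
  using weyl_ideal.add[OF _ weyl_ideal_minus, of p q] by simp

quotient_type (overloaded) ('v, 'k) weyl = "'v weyl_gen list \<Rightarrow>\<^sub>0 'k::field" / "\<lambda>a b. a - b \<in> weyl_ideal"
proof (rule equivpI)
  show "reflp (\<lambda>a b. a - b \<in> weyl_ideal)" by (auto intro!: reflpI weyl_ideal.zero)
  show "symp (\<lambda>a b. a - b \<in> weyl_ideal)" by (auto intro!: sympI dest: weyl_ideal_minus)
  show "transp (\<lambda>a b. a - b \<in> weyl_ideal)"
    by (auto intro!: transpI dest: weyl_ideal.add)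
qed


instantiation weyl :: (type, field) ring
begin

lift_definition zero_weyl :: "('a, 'b) weyl" is 0 .
lift_definition plus_weyl :: "('a, 'b) weyl \<Rightarrow> ('a, 'b) weyl \<Rightarrow> ('a, 'b) weyl" is "(+)"
  by (simp only: add_diff_add weyl_ideal.add)
lift_definition uminus_weyl :: "('a, 'b) weyl \<Rightarrow> ('a, 'b) weyl" is uminus
  by (metis minus_diff_minus weyl_ideal_minus)
lift_definition minus_weyl :: "('a, 'b) weyl \<Rightarrow> ('a, 'b) weyl \<Rightarrow> ('a, 'b) weyl" is "(-)"
proof -
  fix p p' q q' :: "'a weyl_gen list \<Rightarrow>\<^sub>0 'b"
  assume "p - p' \<in> weyl_ideal" "q - q' \<in> weyl_ideal"
  then have "(p - p') - (q - q') \<in> weyl_ideal" by (rule weyl_ideal_diff)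
  then show "(p - q) - (p' - q') \<in> weyl_ideal" by (simp add: algebra_simps)
qed
lift_definition times_weyl :: "('a, 'b) weyl \<Rightarrow> ('a, 'b) weyl \<Rightarrow> ('a, 'b) weyl" is "(*)"
proof -
  fix p p' q q' :: "'a weyl_gen list \<Rightarrow>\<^sub>0 'b"
  assume "p - p' \<in> weyl_ideal" "q - q' \<in> weyl_ideal"
  then have "1 * (p - p') * q + p' * (q - q') * 1 \<in> weyl_ideal"
    by (intro weyl_ideal.add weyl_ideal_mult)
  then show "p * q - p' * q' \<in> weyl_ideal" by (simp add: algebra_simps)
qed

instance
proof
  fix a b c :: "('a, 'b) weyl"
  show "a + b + c = a + (b + c)" by transfer (simp add: add.assoc weyl_ideal.zero)
  show "a + b = b + a" by transfer (simp add: add.commute weyl_ideal.zero)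
  show "0 + a = a" by transfer (simp add: weyl_ideal.zero)
  show "- a + a = 0" by transfer (simp add: weyl_ideal.zero)
  show "a - b = a + - b" by transfer (simp add: weyl_ideal.zero)
  show "a * b * c = a * (b * c)" by transfer (simp add: mult.assoc weyl_ideal.zero)
  show "(a + b) * c = a * c + b * c" by transfer (simp add: distrib_right weyl_ideal.zero)
  show "a * (b + c) = a * b + a * c" by transfer (simp add: distrib_left weyl_ideal.zero)
qed

end


lemma mpoly_deriv_superset:
  assumes "finite A" "Poly_Mapping.keys p \<subseteq> A"
  shows "mpoly_deriv i p = (\<Sum>m\<in>A. Poly_Mapping.single (m - Poly_Mapping.single i 1)
       (of_nat (Poly_Mapping.lookup m i) * Poly_Mapping.lookup p m))"
  unfolding mpoly_deriv_def using assms
  by (intro sum.mono_neutral_left) (auto simp: in_keys_iff)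

lemma mpoly_deriv_single:
  "mpoly_deriv i (Poly_Mapping.single m c) =
     Poly_Mapping.single (m - Poly_Mapping.single i 1) (of_nat (Poly_Mapping.lookup m i) * c)"
  by (subst mpoly_deriv_superset[of "{m}"]) auto

lemma mpoly_deriv_add: "mpoly_deriv i (p + q) = mpoly_deriv i p + mpoly_deriv i q"
proof -
  let ?A = "Poly_Mapping.keys p \<union> Poly_Mapping.keys q"
  have "Poly_Mapping.keys (p + q) \<subseteq> ?A" by (rule Poly_Mapping.keys_add)
  then show ?thesis
    by (simp add: mpoly_deriv_superset[of ?A] lookup_add distrib_left single_add sum.distrib)
qed

lemma mpoly_deriv_mult:
  "mpoly_deriv i (p * q) = mpoly_deriv i p * q + p * mpoly_deriv i q"
proof (induction p rule: poly_mapping_add_induct)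
  case zero show ?case by (simp add: mpoly_deriv_def)
next
  case (single m c)
  show ?case
  proof (induction q rule: poly_mapping_add_induct)
    case zero show ?case by (simp add: mpoly_deriv_def)
  next
    case (single n d)
    let ?e = "Poly_Mapping.single i (1::nat)"
    have *: "Poly_Mapping.single (m + n - ?e) (of_nat (Poly_Mapping.lookup m i) * (c * d)) =
          Poly_Mapping.single (m - ?e + n) (of_nat (Poly_Mapping.lookup m i) * (c * d))"
      for m n :: "'a \<Rightarrow>\<^sub>0 nat"
    proof (cases "Poly_Mapping.lookup m i = 0")
      case False
      then have "m + n - ?e = m - ?e + n"
        by (intro poly_mapping_eqI) (auto simp: lookup_add lookup_minus lookup_single when_def)
      then show ?thesis by simp
    qed simp
    show ?case
      using *[of m n] *[of n m]
      by (simp add: mpoly_deriv_single Poly_Mapping.mult_single lookup_add distrib_right distrib_left single_add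
          add.commute mult_ac)
  qed (simp add: mpoly_deriv_add algebra_simps)
qed (simp add: mpoly_deriv_add algebra_simps)

lemma mpoly_deriv_commute: "mpoly_deriv i (mpoly_deriv j p) = mpoly_deriv j (mpoly_deriv i p)"
proof (induction p rule: poly_mapping_add_induct)
  case (single m c)
  show ?case
    by (cases "i = j") (simp_all add: mpoly_deriv_single lookup_minus lookup_single diff_diff_add add.commute mult_ac) 
qed (simp_all add: mpoly_deriv_add, simp add: mpoly_deriv_def)

lemma mpoly_deriv_const: "mpoly_deriv i (mpoly_const c) = 0"
  by (simp add: mpoly_const_def mpoly_deriv_single)

lemma mpoly_deriv_var: "mpoly_deriv i (mpoly_var j) = (if i = j then 1 else 0)"
  by (simp add: mpoly_var_def mpoly_deriv_single lookup_single)

locale weyl_action = free_action G \<kappa> ops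
  for G :: "('m, 'z) ring_scheme" (structure) and \<kappa> :: "'k::field \<Rightarrow> 'm \<Rightarrow> 'm"
    and ops :: "'v weyl_gen \<Rightarrow> 'm \<Rightarrow> 'm" +
  assumes op_xx: "x \<in> carrier G \<Longrightarrow> ops (Gx i) (ops (Gx j) x) = ops (Gx j) (ops (Gx i) x)"
    and op_dd: "x \<in> carrier G \<Longrightarrow> ops (Gd i) (ops (Gd j) x) = ops (Gd j) (ops (Gd i) x)"
    and op_dx: "x \<in> carrier G \<Longrightarrow>
      ops (Gd i) (ops (Gx j) x) = ops (Gx j) (ops (Gd i) x) \<oplus> (if i = j then x else \<zero>)"
begin

lemma free_act_weyl_relations:
  assumes r: "r \<in> weyl_relations" and x: "x \<in> carrier G"
  shows "free_act G \<kappa> ops r x = \<zero>"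
proof -
  let ?A = "\<lambda>p. free_act G \<kappa> ops p x"
  have gen: "?A (free_gen g) = ops g x" "?A (free_gen g * free_gen h) = ops g (ops h x)" for g h
    using x by (simp_all add: free_act_times free_act_single scal_one)
  have unit: "?A (if b then 1 else 0) = (if b then x else \<zero>)" for b
    using x by (simp add: free_act_one)
  have eqI: "?A (p - q) = \<zero>" if "?A p = ?A q" for p q
    using free_act_plus[of x "p - q" q] that x by (metis diff_add_cancel free_act_closed G.add.r_cancel_one)
  have diff: "?A (p - q - s) = \<zero>" if "?A p = ?A q \<oplus> ?A s" for p q s
    using eqI[of p "q + s"] that x by (simp add: free_act_plus diff_diff_eq)
  from r show ?thesis
    unfolding weyl_relations_def
    by (auto intro!: eqI diff simp: gen unit op_xx[OF x] op_dd[OF x] op_dx[OF x])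
qed

lemma free_act_r_zero [simp]: "free_act G \<kappa> ops p \<zero> = \<zero>"
  using free_act_add[of \<zero> \<zero> p] by (metis G.add.l_cancel_one' G.l_zero free_act_closed zero_closed)

lemma free_act_weyl_ideal:
  assumes "p \<in> weyl_ideal" "x \<in> carrier G"
  shows "free_act G \<kappa> ops p x = \<zero>"
  using assms
  by (induction arbitrary: x rule: weyl_ideal.induct)
     (simp_all add: free_act_times free_act_plus free_act_weyl_relations)

lemma free_act_weyl_cong:
  assumes "p - q \<in> weyl_ideal" "x \<in> carrier G"
  shows "free_act G \<kappa> ops p x = free_act G \<kappa> ops q x"
  using free_act_plus[of x "p - q" q] assms by (simp add: free_act_weyl_ideal)

end

fun mpoly_op :: "'v weyl_gen \<Rightarrow> ('v, 'k::field) mpoly \<Rightarrow> ('v, 'k) mpoly" where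
  "mpoly_op (Gx i) p = mpoly_var i * p"
| "mpoly_op (Gd i) p = mpoly_deriv i p"

lemma weyl_action_mpoly:
  "weyl_action (ring_of_type_algebra :: ('v, 'k::field) mpoly ring) (\<lambda>c. (*) (mpoly_const c)) mpoly_op"
proof -
  let ?G = "ring_of_type_algebra :: ('v, 'k) mpoly ring"
  let ?\<kappa> = "\<lambda>c. (*) (mpoly_const c :: ('v, 'k) mpoly)"
  have G [simp]: "carrier ?G = UNIV" "x \<oplus>\<^bsub>?G\<^esub> y = x + y" "\<zero>\<^bsub>?G\<^esub> = 0" for x y
    by (simp_all add: ring_of_type_algebra_def)
  interpret R: ring ?G by (rule ring_from_type_algebra)
  show ?thesis
  proof
    show "mpoly_op g (x \<oplus>\<^bsub>?G\<^esub> y) = mpoly_op g x \<oplus>\<^bsub>?G\<^esub> mpoly_op g y" for g x y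
      by (cases g) (simp_all add: mpoly_deriv_add distrib_left)
    show "mpoly_op g (?\<kappa> c x) = ?\<kappa> c (mpoly_op g x)" for g c x
      by (cases g) (simp_all add: mpoly_deriv_mult mpoly_deriv_const mult_ac)
    show "?\<kappa> 1 x = x" for x by (simp add: mpoly_const_def)
    show "?\<kappa> (c * d) x = ?\<kappa> c (?\<kappa> d x)" for c d x
      by (simp add: mpoly_const_def Poly_Mapping.mult_single flip: mult.assoc)
  qed (simp_all add: distrib_left distrib_right mpoly_const_def single_add
        mpoly_deriv_commute mpoly_deriv_mult mpoly_deriv_var mult.left_commute)
qed

lemma one_notin_weyl_ideal: "(1 :: 'v weyl_gen list \<Rightarrow>\<^sub>0 'k::field) \<notin> weyl_ideal"
proof
  interpret weyl_action "ring_of_type_algebra :: ('v, 'k) mpoly ring" "\<lambda>c. (*) (mpoly_const c)" mpoly_op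
    by (rule weyl_action_mpoly)
  assume "(1 :: 'v weyl_gen list \<Rightarrow>\<^sub>0 'k) \<in> weyl_ideal"
  from free_act_weyl_ideal[OF this, of 1] free_act_one[of 1]
  show False by (simp add: ring_of_type_algebra_def)
qed

instantiation weyl :: (type, field) ring_1
begin
lift_definition one_weyl :: "('a, 'b) weyl" is 1 .
instance
  by standard (transfer; use one_notin_weyl_ideal weyl_ideal_minus in \<open>fastforce simp: weyl_ideal.zero\<close>)+
end

definition weyl_const :: "'k::field \<Rightarrow> ('v, 'k) weyl" where
  "weyl_const c = abs_weyl (Poly_Mapping.single 0 c)"

definition weyl_elt :: "'v weyl_gen \<Rightarrow> ('v, 'k::field) weyl" where
  "weyl_elt g = abs_weyl (free_gen g)"

text \<open>
  The subring \<open>D\<^sub>X[t \<partial>\<^sub>t] \<subseteq> D\<^sub>Y\<close>: variables of \<open>D\<^sub>Y\<close> are indexed by \<open>'n option\<close>, where \<open>None\<close>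
  stands for \<open>t\<close> and \<open>Some i\<close> for \<open>x\<^sub>i\<close>.
\<close>

definition weyl_incl :: "('n, 'k::field) weyl \<Rightarrow> ('n option, 'k) weyl" where
  "weyl_incl P = (let p = rep_weyl P in \<Sum>w\<in>Poly_Mapping.keys p.
     weyl_const (Poly_Mapping.lookup p w) * prod_list (map (weyl_elt \<circ> map_weyl_gen Some) w))"

definition weyl_t :: "('n option, 'k::field) weyl" where
  "weyl_t = weyl_elt (Gx None)"

definition weyl_dt :: "('n option, 'k::field) weyl" where
  "weyl_dt = weyl_elt (Gd None)"

definition weyl_X_tdt :: "('n option, 'k::field) weyl set" where
  "weyl_X_tdt = generate_ring ring_of_type_algebra (range weyl_incl \<union> {weyl_t * weyl_dt})"

definition weyl_of_mpoly :: "('n::{finite,linorder}, 'k::field) mpoly \<Rightarrow> ('n, 'k) weyl" where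
  "weyl_of_mpoly p = (\<Sum>m\<in>Poly_Mapping.keys p. weyl_const (Poly_Mapping.lookup p m) *
     prod_list (map (\<lambda>i. weyl_elt (Gx i) ^ Poly_Mapping.lookup m i) (sorted_list_of_set UNIV)))"

definition weyl_poly_eval :: "'k::field poly \<Rightarrow> ('v, 'k) weyl \<Rightarrow> ('v, 'k) weyl" where
  "weyl_poly_eval b P = (\<Sum>k\<le>Polynomial.degree b. weyl_const (Polynomial.coeff b k) * P ^ k)"

text \<open>\<open>D[s] = nat \<Rightarrow>\<^sub>0 D\<close> with the convolution product, in which \<open>s\<close> is central; \<open>K[s] \<subseteq> D[s]\<close>.\<close>

definition weyl_s_of_poly :: "'k::field poly \<Rightarrow> (nat \<Rightarrow>\<^sub>0 ('v, 'k) weyl)" where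
  "weyl_s_of_poly b =
     (\<Sum>k\<le>Polynomial.degree b. Poly_Mapping.single k (weyl_const (Polynomial.coeff b k)))"

text \<open>
  The module over the Weyl algebra on which the scalars act through \<open>\<kappa>\<close> and the generators
  through \<open>ops\<close>; it does not depend on the choice of representatives if \<open>ops\<close> satisfies the
  defining relations (\<^locale>\<open>weyl_action\<close>).
\<close>

definition weyl_module ::
  "('m, 'z) ring_scheme \<Rightarrow> ('k::field \<Rightarrow> 'm \<Rightarrow> 'm) \<Rightarrow> ('v weyl_gen \<Rightarrow> 'm \<Rightarrow> 'm)
     \<Rightarrow> (('v, 'k) weyl, 'm) module" where
  "weyl_module G \<kappa> ops =
     \<lparr>carrier = carrier G, monoid.mult = monoid.mult G, monoid.one = monoid.one G,
      ring.zero = ring.zero G, ring.add = ring.add G,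
      module.smult = (\<lambda>P. free_act G \<kappa> ops (rep_weyl P))\<rparr>"

lemma weyl_exhaust: "\<exists>p. P = abs_weyl p"
  by (rule exI[of _ "rep_weyl P"]) (rule Quotient3_abs_rep[OF Quotient3_weyl, symmetric])

lemma abs_weyl_arith:
  "abs_weyl p + abs_weyl q = abs_weyl (p + q)"
  "abs_weyl p * abs_weyl q = abs_weyl (p * q)"
  "(1 :: ('v, 'k::field) weyl) = abs_weyl 1"
  "abs_weyl p - abs_weyl q = abs_weyl (p - q)"
  by (rule plus_weyl.abs_eq times_weyl.abs_eq one_weyl.abs_eq one_weyl_def minus_weyl.abs_eq)+

lemma rep_abs_weyl: "rep_weyl (abs_weyl p) - p \<in> weyl_ideal"
  using Quotient3_rel[OF Quotient3_weyl, of "rep_weyl (abs_weyl p)" p]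
    Quotient3_abs_rep[OF Quotient3_weyl, of "abs_weyl p"] weyl_ideal.zero
  by (metis diff_self)

lemma ring_of_type_ring: "ring (ring_of_type_algebra :: 'a::ring_1 ring)"
proof -
  have "\<exists>y. x + y = 0" for x :: 'a
    using add.right_inverse by blast
  thus ?thesis
    unfolding ring_of_type_algebra_def using add.right_inverse
    by unfold_locales (auto simp:algebra_simps Units_def)
qed

lemma ring_of_type_simps [simp]:
  "carrier (ring_of_type_algebra :: 'a::ring_1 ring) = UNIV"
  "x \<oplus>\<^bsub>ring_of_type_algebra\<^esub> y = x + (y::'a)"
  "x \<otimes>\<^bsub>ring_of_type_algebra\<^esub> y = x * (y::'a)"
  "\<zero>\<^bsub>ring_of_type_algebra\<^esub> = (0::'a)"
  "\<one>\<^bsub>ring_of_type_algebra\<^esub> = (1::'a)"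
  by (simp_all add: ring_of_type_algebra_def)

lemma abelian_group_transfer:
  fixes G :: "('m, 'z) ring_scheme" and H :: "('m, 'y) ring_scheme"
  assumes "abelian_group G" "carrier H = carrier G" "ring.zero H = ring.zero G" "ring.add H = ring.add G"
  shows "abelian_group H"
proof -
  interpret G: abelian_group G by fact
  show ?thesis
    by (rule abelian_groupI)
       (auto simp: assms G.a_ac intro!: bexI[of _ "\<ominus>\<^bsub>G\<^esub> _"] G.l_neg)
qed

context weyl_action
begin

lemma weyl_module_simps [simp]:
  "carrier (weyl_module G \<kappa> ops) = carrier G"
  "ring.add (weyl_module G \<kappa> ops) = ring.add G"
  "ring.zero (weyl_module G \<kappa> ops) = ring.zero G"
  by (simp_all add: weyl_module_def)

lemma smult_abs: "x \<in> carrier G \<Longrightarrow> abs_weyl p \<odot>\<^bsub>weyl_module G \<kappa> ops\<^esub> x = free_act G \<kappa> ops p x"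
  by (simp add: weyl_module_def free_act_weyl_cong[OF rep_abs_weyl])

lemma smult_const: "x \<in> carrier G \<Longrightarrow> weyl_const c \<odot>\<^bsub>weyl_module G \<kappa> ops\<^esub> x = \<kappa> c x"
  by (simp add: weyl_const_def smult_abs free_act_single zero_list_def)

lemma smult_elt: "x \<in> carrier G \<Longrightarrow> weyl_elt g \<odot>\<^bsub>weyl_module G \<kappa> ops\<^esub> x = ops g x"
  by (simp add: weyl_elt_def smult_abs free_act_single scal_one)

lemma left_module_weyl_module: "left_module ring_of_type_algebra (weyl_module G \<kappa> ops)"
proof -
  interpret R: ring "ring_of_type_algebra :: ('v, 'k) weyl ring" by (rule ring_of_type_ring)
  interpret M: abelian_group "weyl_module G \<kappa> ops"
    by (rule abelian_group_transfer[OF G.abelian_group_axioms]) simp_all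
  show ?thesis
  proof
    fix a b :: "('v, 'k) weyl" and x y :: 'm
    obtain p q where pq: "a = abs_weyl p" "b = abs_weyl q" using weyl_exhaust[of a] weyl_exhaust[of b] by blast
    assume "x \<in> carrier (weyl_module G \<kappa> ops)"
    then have x: "x \<in> carrier G" by simp
    show "a \<odot>\<^bsub>weyl_module G \<kappa> ops\<^esub> x \<in> carrier (weyl_module G \<kappa> ops)"
      using x by (simp add: pq smult_abs)
    show "(a \<oplus>\<^bsub>ring_of_type_algebra\<^esub> b) \<odot>\<^bsub>weyl_module G \<kappa> ops\<^esub> x =
       a \<odot>\<^bsub>weyl_module G \<kappa> ops\<^esub> x \<oplus>\<^bsub>weyl_module G \<kappa> ops\<^esub> b \<odot>\<^bsub>weyl_module G \<kappa> ops\<^esub> x"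
      using x by (simp add: pq abs_weyl_arith smult_abs free_act_plus)
    show "(a \<otimes>\<^bsub>ring_of_type_algebra\<^esub> b) \<odot>\<^bsub>weyl_module G \<kappa> ops\<^esub> x =
       a \<odot>\<^bsub>weyl_module G \<kappa> ops\<^esub> (b \<odot>\<^bsub>weyl_module G \<kappa> ops\<^esub> x)"
      using x by (simp add: pq abs_weyl_arith smult_abs free_act_times)
    show "\<one>\<^bsub>ring_of_type_algebra\<^esub> \<odot>\<^bsub>weyl_module G \<kappa> ops\<^esub> x = x"
      using x by (simp add: abs_weyl_arith smult_abs free_act_one)
    assume "y \<in> carrier (weyl_module G \<kappa> ops)"
    then show "a \<odot>\<^bsub>weyl_module G \<kappa> ops\<^esub> (x \<oplus>\<^bsub>weyl_module G \<kappa> ops\<^esub> y) =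
       a \<odot>\<^bsub>weyl_module G \<kappa> ops\<^esub> x \<oplus>\<^bsub>weyl_module G \<kappa> ops\<^esub> a \<odot>\<^bsub>weyl_module G \<kappa> ops\<^esub> y"
      using x by (simp add: pq smult_abs free_act_add)
  qed
qed
end

text \<open>Likewise over \<open>D[s]\<close>, with \<open>s\<close> acting through \<open>\<sigma>\<close>.\<close>

definition weyl_s_module ::
  "('m, 'z) ring_scheme \<Rightarrow> ('k::field \<Rightarrow> 'm \<Rightarrow> 'm) \<Rightarrow> ('v weyl_gen \<Rightarrow> 'm \<Rightarrow> 'm) \<Rightarrow> ('m \<Rightarrow> 'm)
     \<Rightarrow> (nat \<Rightarrow>\<^sub>0 ('v, 'k) weyl, 'm) module" where
  "weyl_s_module G \<kappa> ops \<sigma> =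
     \<lparr>carrier = carrier G, monoid.mult = monoid.mult G, monoid.one = monoid.one G,
      ring.zero = ring.zero G, ring.add = ring.add G,
      module.smult = (\<lambda>P x. finsum G (\<lambda>k. (\<sigma> ^^ k)
        (free_act G \<kappa> ops (rep_weyl (Poly_Mapping.lookup P k)) x)) (Poly_Mapping.keys P))\<rparr>"


section \<open>Localizations\<close>

text \<open>The localization \<open>R[g\<^sup>-\<^sup>1]\<close> of a domain, as an additive group inside the field of fractions.\<close>

definition localization :: "'a::idom \<Rightarrow> 'a fract set" where
  "localization g = {Fract a (g ^ k) | a k. True}"

definition additive_group :: "'a::ring_1 set \<Rightarrow> 'a ring" where
  "additive_group S = ring_of_type_algebra\<lparr>carrier := S\<rparr>"

text \<open>The extension of a derivation to the field of fractions by the quotient rule.\<close>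

definition fract_deriv :: "('a::idom \<Rightarrow> 'a) \<Rightarrow> 'a fract \<Rightarrow> 'a fract" where
  "fract_deriv d q =
     (THE r. \<forall>a b. b \<noteq> 0 \<and> q = Fract a b \<longrightarrow> r = Fract (d a * b - a * d b) (b ^ 2))"


lemma fract_deriv_Fract:
  fixes d :: "'a::idom \<Rightarrow> 'a"
  assumes d: "\<And>a b. d (a * b) = d a * b + a * d b" and b: "b \<noteq> 0"
  shows "fract_deriv d (Fract a b) = Fract (d a * b - a * d b) (b ^ 2)"
  unfolding fract_deriv_def
proof (rule the_equality)
  show "\<forall>a' b'. b' \<noteq> 0 \<and> Fract a b = Fract a' b' \<longrightarrow>
     Fract (d a * b - a * d b) (b ^ 2) = Fract (d a' * b' - a' * d b') (b' ^ 2)"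
  proof (intro allI impI)
    fix a' b' assume *: "b' \<noteq> 0 \<and> Fract a b = Fract a' b'"
    then have e: "a * b' = a' * b" using b eq_fract(1)[of b b' a a'] by simp
    then have de: "d a * b' + a * d b' = d a' * b + a' * d b" by (metis d)
    have "(d a * b - a * d b) * b'^2 = (d a' * b' - a' * d b') * b^2"
      
    proof -
      have "(d a * b - a * d b) * b'^2 = (d a * b') * (b * b') - (a * b') * (d b * b')"
        by (simp add: power2_eq_square algebra_simps)
      also have "d a * b' = d a' * b + a' * d b - a * d b'" using de by (simp add: algebra_simps)
      also have "(d a' * b + a' * d b - a * d b') * (b * b') - (a * b') * (d b * b') =
          d a' * b' * b^2 + (a' * b) * (d b * b') - (a * b') * (b * d b') - (a * b') * (d b * b')"
        by (simp add: power2_eq_square algebra_simps)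
      also have "\<dots> = (d a' * b' - a' * d b') * b^2"
        unfolding e by (simp add: power2_eq_square algebra_simps)
      finally show ?thesis .
    qed
    then show "Fract (d a * b - a * d b) (b ^ 2) = Fract (d a' * b' - a' * d b') (b' ^ 2)"
      using b * by (simp add: eq_fract)
  qed
qed (use b in auto)


section \<open>The module \<open>B\<^bsub>Z|Y\<^esub>\<close>\<close>

text \<open>\<open>K[x,t]\<close> is represented as \<open>K[x][t]\<close>.\<close>

type_synonym ('n, 'k) mpoly_t = "('n, 'k) mpoly poly"

definition t_minus :: "('n, 'k::field) mpoly \<Rightarrow> ('n, 'k) mpoly_t" where
  "t_minus f = [:- f, 1:]"

fun BZY_op :: "'n::linorder option weyl_gen \<Rightarrow> ('n, 'k::field) mpoly_t fract \<Rightarrow> ('n, 'k) mpoly_t fract" where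
  "BZY_op (Gx None) q = Fract [:0, 1:] 1 * q"
| "BZY_op (Gx (Some i)) q = Fract [:mpoly_var i:] 1 * q"
| "BZY_op (Gd None) q = fract_deriv pderiv q"
| "BZY_op (Gd (Some i)) q = fract_deriv (map_poly (mpoly_deriv i)) q"

definition loc_Y ::
  "('n::linorder, 'k::field) mpoly \<Rightarrow> (('n option, 'k) weyl, ('n, 'k) mpoly_t fract) module" where
  "loc_Y f = weyl_module (additive_group (localization (t_minus f)))
     (\<lambda>c q. Fract [:mpoly_const c:] 1 * q) BZY_op"

definition poly_Y :: "('n::linorder, 'k::field) mpoly_t fract set" where
  "poly_Y = range (\<lambda>a. Fract a 1)"

definition BZY ::
  "('n::linorder, 'k::field) mpoly \<Rightarrow> (('n option, 'k) weyl, ('n, 'k) mpoly_t fract set) module" where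
  "BZY f = quotient_module (loc_Y f) poly_Y"

definition delta :: "('n::linorder, 'k::field) mpoly \<Rightarrow> ('n, 'k) mpoly_t fract set" where
  "delta f = poly_Y +>\<^bsub>loc_Y f\<^esub> Fract 1 (t_minus f)"


section \<open>The module \<open>K[x,f\<^sup>-\<^sup>1,s] f\<^sup>s\<close>\<close>

text \<open>
  The element \<open>g f\<^sup>s\<close> with \<open>g \<in> K[x,f\<^sup>-\<^sup>1][s]\<close> is represented by \<open>g\<close>. By the quotient rule for
  \<open>\<partial>\<^sub>i (a f\<^sup>-\<^sup>k)\<close>, the rule
  \<open>\<partial>\<^sub>i (a f\<^sup>-\<^sup>k f\<^sup>s) = ((\<partial>\<^sub>i a) f\<^sup>-\<^sup>k + (s - k) f\<^sub>i a f\<^sup>-\<^sup>k\<^sup>-\<^sup>1) f\<^sup>s\<close> says that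
  \<open>\<partial>\<^sub>i (g f\<^sup>s) = (\<partial>\<^sub>i g + s f\<^sub>i f\<^sup>-\<^sup>1 g) f\<^sup>s\<close>.
\<close>

fun fs_op ::
  "('n::linorder, 'k::field) mpoly \<Rightarrow> 'n weyl_gen \<Rightarrow> ('n, 'k) mpoly fract poly \<Rightarrow> ('n, 'k) mpoly fract poly" where
  "fs_op f (Gx i) g = Polynomial.smult (Fract (mpoly_var i) 1) g"
| "fs_op f (Gd i) g =
     map_poly (fract_deriv (mpoly_deriv i)) g + [:0, Fract (mpoly_deriv i f) f:] * g"

text \<open>The defining rule, for \<open>a \<in> K[x][s]\<close>.\<close>

lemma mpoly_deriv_power:
  fixes f :: "('v, 'k::comm_ring_1) mpoly"
  shows "mpoly_deriv i (f ^ k) * f = of_nat k * mpoly_deriv i f * f ^ k"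
proof (induction k)
  case 0
  have "mpoly_deriv i (1 :: ('v, 'k) mpoly) = 0" using mpoly_deriv_const[of i 1] by (simp add: mpoly_const_def)
  then show ?case by simp
next
  case (Suc k)
  have "mpoly_deriv i (f ^ Suc k) * f = mpoly_deriv i f * f ^ Suc k + f * (mpoly_deriv i (f ^ k) * f)"
    by (simp add: mpoly_deriv_mult algebra_simps)
  then show ?case unfolding Suc by (simp add: algebra_simps)
qed

lemma fs_op_formula:
  fixes a :: "('n::linorder, 'k::field) mpoly poly"
  assumes f: "f \<noteq> 0"
  shows "fs_op f (Gd i) (map_poly (\<lambda>c. Fract c (f ^ k)) a) =
    map_poly (\<lambda>c. Fract (mpoly_deriv i c) (f ^ k)) a +
    [:- of_nat k, 1:] * map_poly (\<lambda>c. Fract (mpoly_deriv i f * c) (f ^ (k + 1))) a"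
proof (rule poly_eqI)
  fix n
  have z: "mpoly_deriv i (0 :: ('n, 'k) mpoly) = 0" for i :: 'n by (simp add: mpoly_deriv_def)
  have zf: "Fract 0 b = 0" if "b \<noteq> 0" for b :: "('n, 'k) mpoly"
    using that by (simp add: Zero_fract_def eq_fract)
  have D: "fract_deriv (mpoly_deriv i) (Fract c (f ^ k)) =
      Fract (mpoly_deriv i c) (f ^ k) - of_nat k * Fract (mpoly_deriv i f * c) (f ^ (k + 1))" for c
  proof -
    define A F B K where "A = mpoly_deriv i c" and "F = f ^ k" and "B = mpoly_deriv i (f ^ k)"
      and "K = of_nat k * mpoly_deriv i f"
    have BK: "B * f = K * F" unfolding B_def K_def F_def by (rule mpoly_deriv_power)
    have F: "F \<noteq> 0" using f by (simp add: F_def)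
    have "(A * F - c * B) * (F * (F * f)) = (A * (F * f) * (F * F)) - c * (B * f) * (F * F)"
      by (simp add: algebra_simps)
    also have "\<dots> = (A * (F * f) - K * c * F) * F ^ 2"
      unfolding BK by (simp add: algebra_simps power2_eq_square)
    finally have "Fract (A * F - c * B) (F ^ 2) = Fract A F - Fract (K * c) (F * f)"
      using F f by (simp add: eq_fract)
    moreover have "of_nat k * Fract (mpoly_deriv i f * c) (f ^ (k + 1)) = Fract (K * c) (F * f)"
      by (simp add: of_nat_fract K_def F_def mult.assoc mult.commute[of f])
    moreover have "fract_deriv (mpoly_deriv i) (Fract c F) = Fract (A * F - c * B) (F ^ 2)"
      unfolding A_def B_def F_def[symmetric] by (rule fract_deriv_Fract) (simp_all add: mpoly_deriv_mult F)
    ultimately show ?thesis by (simp add: A_def F_def)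
  qed
  have fk: "Fract 0 (f ^ k) = 0" "Fract 0 (f ^ (k + 1)) = 0" using f zf by auto
  have d0: "fract_deriv (mpoly_deriv i) (0 :: ('n, 'k) mpoly fract) = 0" using D[of 0] fk z by simp
  show "Polynomial.coeff (fs_op f (Gd i) (map_poly (\<lambda>c. Fract c (f ^ k)) a)) n =
    Polynomial.coeff (map_poly (\<lambda>c. Fract (mpoly_deriv i c) (f ^ k)) a +
    [:- of_nat k, 1:] * map_poly (\<lambda>c. Fract (mpoly_deriv i f * c) (f ^ (k + 1))) a) n"
    using f fk d0 D by (cases n) (simp_all add: coeff_map_poly coeff_pCons z)
qed

definition fs_module ::
  "('n::linorder, 'k::field) mpoly \<Rightarrow> (nat \<Rightarrow>\<^sub>0 ('n, 'k) weyl, ('n, 'k) mpoly fract poly) module" where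
  "fs_module f = weyl_s_module
     (additive_group {g. \<forall>k. Polynomial.coeff g k \<in> localization f})
     (\<lambda>c g. Polynomial.smult (Fract (mpoly_const c) 1) g) (fs_op f) (\<lambda>g. [:0, 1:] * g)"

text \<open>\<open>fs_power f k\<close> is \<open>f\<^sup>s\<^sup>+\<^sup>k = f\<^sup>k f\<^sup>s\<close>.\<close>

definition fs_power :: "('n::linorder, 'k::field) mpoly \<Rightarrow> int \<Rightarrow> ('n, 'k) mpoly fract poly" where
  "fs_power f k = [:Fract f 1 powi k:]"


section \<open>The modules \<open>M \<otimes> B\<^bsub>Z|Y\<^esub>\<close> and \<open>M \<otimes> K[x,f\<^sup>-\<^sup>1,s] f\<^sup>s\<close>\<close>

abbreviation mpoly_ring :: "('n::{finite,linorder}, 'k::field) mpoly ring" where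
  "mpoly_ring \<equiv> ring_of_type_algebra"

abbreviation mpoly_M ::
  "(('n::{finite,linorder}, 'k::field) weyl, 'm) module \<Rightarrow> (('n, 'k) mpoly, 'm) module" where
  "mpoly_M M \<equiv> restrict_scalars weyl_of_mpoly M"

abbreviation mpoly_BZY ::
  "('n::{finite,linorder}, 'k::field) mpoly \<Rightarrow> (('n, 'k) mpoly, ('n, 'k) mpoly_t fract set) module" where
  "mpoly_BZY f \<equiv> restrict_scalars (\<lambda>a. weyl_incl (weyl_of_mpoly a)) (BZY f)"

abbreviation mpoly_fs ::
  "('n::{finite,linorder}, 'k::field) mpoly \<Rightarrow> (('n, 'k) mpoly, ('n, 'k) mpoly fract poly) module" where
  "mpoly_fs f \<equiv> restrict_scalars (\<lambda>a. Poly_Mapping.single 0 (weyl_of_mpoly a)) (fs_module f)"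

fun MB_gen ::
  "(('n::{finite,linorder}, 'k::field) weyl, 'm) module \<Rightarrow> ('n, 'k) mpoly \<Rightarrow> 'n option weyl_gen
     \<Rightarrow> 'm \<times> ('n, 'k) mpoly_t fract set \<Rightarrow> ('m \<times> ('n, 'k) mpoly_t fract set \<Rightarrow>\<^sub>0 int)" where
  "MB_gen M f (Gx None) (m, b) = frag_of (m, weyl_t \<odot>\<^bsub>BZY f\<^esub> b)"
| "MB_gen M f (Gd None) (m, b) = frag_of (m, weyl_dt \<odot>\<^bsub>BZY f\<^esub> b)"
| "MB_gen M f (Gx (Some i)) (m, b) = frag_of (weyl_elt (Gx i) \<odot>\<^bsub>M\<^esub> m, b)"
| "MB_gen M f (Gd (Some i)) (m, b) =
     frag_of (weyl_elt (Gd i) \<odot>\<^bsub>M\<^esub> m, b) + frag_of (m, weyl_elt (Gd (Some i)) \<odot>\<^bsub>BZY f\<^esub> b)"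

definition MB ::
  "(('n::{finite,linorder}, 'k::field) weyl, 'm) module \<Rightarrow> ('n, 'k) mpoly
     \<Rightarrow> (('n option, 'k) weyl, ('m \<times> ('n, 'k) mpoly_t fract set \<Rightarrow>\<^sub>0 int) set) module" where
  "MB M f = weyl_module (tensor_product mpoly_ring (mpoly_M M) (mpoly_BZY f))
     (\<lambda>c. tensor_map mpoly_ring (mpoly_M M) (mpoly_BZY f)
        (\<lambda>(m, b). frag_of (weyl_const c \<odot>\<^bsub>M\<^esub> m, b)))
     (\<lambda>g. tensor_map mpoly_ring (mpoly_M M) (mpoly_BZY f) (MB_gen M f g))"

definition MB_elem ::
  "(('n::{finite,linorder}, 'k::field) weyl, 'm) module \<Rightarrow> ('n, 'k) mpoly
     \<Rightarrow> 'm \<Rightarrow> ('n, 'k) mpoly_t fract set \<Rightarrow> ('m \<times> ('n, 'k) mpoly_t fract set \<Rightarrow>\<^sub>0 int) set" where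
  "MB_elem M f m b = tensor_elem mpoly_ring (mpoly_M M) (mpoly_BZY f) m b"

fun MFs_gen ::
  "(('n::{finite,linorder}, 'k::field) weyl, 'm) module \<Rightarrow> ('n, 'k) mpoly \<Rightarrow> 'n weyl_gen
     \<Rightarrow> 'm \<times> ('n, 'k) mpoly fract poly \<Rightarrow> ('m \<times> ('n, 'k) mpoly fract poly \<Rightarrow>\<^sub>0 int)" where
  "MFs_gen M f (Gx i) (m, g) = frag_of (weyl_elt (Gx i) \<odot>\<^bsub>M\<^esub> m, g)"
| "MFs_gen M f (Gd i) (m, g) =
     frag_of (weyl_elt (Gd i) \<odot>\<^bsub>M\<^esub> m, g)
     + frag_of (m, Poly_Mapping.single 0 (weyl_elt (Gd i)) \<odot>\<^bsub>fs_module f\<^esub> g)"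

definition MFs ::
  "(('n::{finite,linorder}, 'k::field) weyl, 'm) module \<Rightarrow> ('n, 'k) mpoly
     \<Rightarrow> (nat \<Rightarrow>\<^sub>0 ('n, 'k) weyl, ('m \<times> ('n, 'k) mpoly fract poly \<Rightarrow>\<^sub>0 int) set) module" where
  "MFs M f = weyl_s_module (tensor_product mpoly_ring (mpoly_M M) (mpoly_fs f))
     (\<lambda>c. tensor_map mpoly_ring (mpoly_M M) (mpoly_fs f)
        (\<lambda>(m, g). frag_of (weyl_const c \<odot>\<^bsub>M\<^esub> m, g)))
     (\<lambda>h. tensor_map mpoly_ring (mpoly_M M) (mpoly_fs f) (MFs_gen M f h))
     (tensor_map mpoly_ring (mpoly_M M) (mpoly_fs f)
        (\<lambda>(m, g). frag_of (m, Poly_Mapping.single 1 1 \<odot>\<^bsub>fs_module f\<^esub> g)))"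

definition MFs_elem ::
  "(('n::{finite,linorder}, 'k::field) weyl, 'm) module \<Rightarrow> ('n, 'k) mpoly
     \<Rightarrow> 'm \<Rightarrow> ('n, 'k) mpoly fract poly \<Rightarrow> ('m \<times> ('n, 'k) mpoly fract poly \<Rightarrow>\<^sub>0 int) set" where
  "MFs_elem M f m g = tensor_elem mpoly_ring (mpoly_M M) (mpoly_fs f) m g"


section \<open>The \<open>b\<close>-function\<close>

definition f_saturated ::
  "(('n::{finite,linorder}, 'k::field) weyl, 'm) module \<Rightarrow> ('n, 'k) mpoly \<Rightarrow> bool" where
  "f_saturated M f \<longleftrightarrow> inj_on (\<lambda>m. weyl_of_mpoly f \<odot>\<^bsub>M\<^esub> m) (carrier M)"

definition bernstein_polys ::
  "(('n::{finite,linorder}, 'k::field) weyl, 'm) module \<Rightarrow> 'm \<Rightarrow> ('n, 'k) mpoly \<Rightarrow> 'k poly set" where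
  "bernstein_polys M u f =
     {b. weyl_s_of_poly b \<odot>\<^bsub>MFs M f\<^esub> MFs_elem M f u (fs_power f 0)
           \<in> {P \<odot>\<^bsub>MFs M f\<^esub> MFs_elem M f u (fs_power f 1) | P. True}}"

definition is_least_monic :: "'k::field poly set \<Rightarrow> 'k poly \<Rightarrow> bool" where
  "is_least_monic S b \<longleftrightarrow> b \<in> S \<and> Polynomial.lead_coeff b = 1 \<and>
     (\<forall>c\<in>S. c \<noteq> 0 \<longrightarrow> Polynomial.degree b \<le> Polynomial.degree c)"

definition b_function_exists ::
  "(('n::{finite,linorder}, 'k::field) weyl, 'm) module \<Rightarrow> 'm \<Rightarrow> ('n, 'k) mpoly \<Rightarrow> bool" where
  "b_function_exists M u f \<longleftrightarrow> (\<exists>b\<in>bernstein_polys M u f. b \<noteq> 0)"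

text \<open>Only meaningful if \<^const>\<open>b_function_exists\<close> holds.\<close>

definition b_function ::
  "(('n::{finite,linorder}, 'k::field) weyl, 'm) module \<Rightarrow> 'm \<Rightarrow> ('n, 'k) mpoly \<Rightarrow> 'k poly" where
  "b_function M u f = (THE b. is_least_monic (bernstein_polys M u f) b)"

end

theory Submission
  imports Defs
begin

text \<open>
  The classes \<open>e\<^sub>k\<close> of \<open>(t - f)\<^sup>-\<^sup>1\<^sup>-\<^sup>k\<close> span \<open>B\<^bsub>Z|Y\<^esub>\<close> over \<open>K[x]\<close>, and \<open>\<delta>(t - f) = e\<^sub>0\<close>. Taking the residue of
  \<open>g t\<^sup>s\<close> along \<open>t = f\<close>, where \<open>t\<^sup>s = \<Sum>\<^sub>k binom(s,k) f\<^sup>s\<^sup>-\<^sup>k (t - f)\<^sup>k\<close>, sends \<open>e\<^sub>k\<close> to \<open>binom(s,k) f\<^sup>s\<^sup>-\<^sup>k\<close>. This map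
  (\<open>mellin\<close>) from \<open>B\<^bsub>Z|Y\<^esub>\<close> to \<open>K[x,f\<^sup>-\<^sup>1,s] f\<^sup>s\<close> is \<open>D\<^sub>X\<close>-linear and turns \<open>-\<partial>\<^sub>t t\<close> into multiplication by \<open>s\<close>.
  Tensored with the identity of \<open>M\<close> it becomes the comparison map \<open>phi\<close>, which takes \<open>v = u \<otimes> \<delta>\<close> to \<open>u \<otimes> f\<^sup>s\<close>
  and \<open>t v = f v\<close> to \<open>u \<otimes> f\<^sup>s\<^sup>+\<^sup>1\<close>. Since \<open>D\<^sub>X[t \<partial>\<^sub>t]\<close> is the subring generated by \<open>D\<^sub>X\<close> and \<open>-\<partial>\<^sub>t t\<close>, it acts on one
  side as \<open>D\<^sub>X[s]\<close> does on the other, so that every functional equation for \<open>v\<close> is carried to one for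
  \<open>u \<otimes> f\<^sup>s\<close> with the same polynomial (\<open>delta_polys_subset\<close>).

  Conversely, a functional equation for \<open>u \<otimes> f\<^sup>s\<close> lifts to an equation for \<open>v\<close> up to an element \<open>w\<close> of the kernel
  of \<open>phi\<close>. As \<open>binom(s,k)\<close> has degree exactly \<open>k\<close> in \<open>s\<close>, comparing coefficients of the powers of \<open>s\<close> from the
  top in \<open>w = \<Sum>\<^sub>k m\<^sub>k \<otimes> e\<^sub>k\<close> shows that \<open>w\<close> is killed by a power of \<open>f\<close> (\<open>phi_kernel\<close>). If \<open>M\<close> is
  \<open>f\<close>-saturated, then even \<open>w = 0\<close> and the two sets of polynomials agree. In general \<open>t - f\<close> lowers the pole order, so it
  is nilpotent on \<open>w\<close>, and \<open>t\<^sup>N w = 0\<close> for some \<open>N\<close> (\<open>t_power_torsion\<close>). Now \<open>\<partial>\<^sub>t\<^sup>N t\<^sup>N\<close> is a nonzero polynomial in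
  \<open>-\<partial>\<^sub>t t\<close> that kills \<open>w\<close>; multiplying the lifted equation by it gives a functional equation for \<open>v\<close>
  (\<open>bernstein_multiple\<close>).

  The equality of the three submodules comes from \<open>t (t \<partial>\<^sub>t) = (t \<partial>\<^sub>t - 1) t\<close> and \<open>t \<delta> = f \<delta>\<close>. Much of the text
  below establishes that the modules are modules: that the operators on tensor products are well defined and satisfy
  the relations of the Weyl algebra.
\<close>


section \<open>Additive maps\<close>

definition additive_map :: "('a, 'c) ring_scheme \<Rightarrow> ('b, 'd) ring_scheme \<Rightarrow> ('a \<Rightarrow> 'b) \<Rightarrow> bool" where
  "additive_map G H h \<longleftrightarrow> (\<forall>x\<in>carrier G. h x \<in> carrier H) \<and>
     (\<forall>x\<in>carrier G. \<forall>y\<in>carrier G. h (x \<oplus>\<^bsub>G\<^esub> y) = h x \<oplus>\<^bsub>H\<^esub> h y)"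

lemma additive_mapI:
  assumes "\<And>x. x \<in> carrier G \<Longrightarrow> h x \<in> carrier H"
    and "\<And>x y. x \<in> carrier G \<Longrightarrow> y \<in> carrier G \<Longrightarrow> h (x \<oplus>\<^bsub>G\<^esub> y) = h x \<oplus>\<^bsub>H\<^esub> h y"
  shows "additive_map G H h"
  using assms by (simp add: additive_map_def)

lemma additive_map_closed: "additive_map G H h \<Longrightarrow> x \<in> carrier G \<Longrightarrow> h x \<in> carrier H"
  by (simp add: additive_map_def)

lemma additive_map_plus:
  "additive_map G H h \<Longrightarrow> x \<in> carrier G \<Longrightarrow> y \<in> carrier G \<Longrightarrow> h (x \<oplus>\<^bsub>G\<^esub> y) = h x \<oplus>\<^bsub>H\<^esub> h y"
  by (simp add: additive_map_def)

lemma additive_map_zero: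
  assumes "abelian_group G" "abelian_group H" "additive_map G H h"
  shows "h \<zero>\<^bsub>G\<^esub> = \<zero>\<^bsub>H\<^esub>"
proof -
  interpret G: abelian_group G by fact
  interpret H: abelian_group H by fact
  have "h \<zero>\<^bsub>G\<^esub> \<oplus>\<^bsub>H\<^esub> h \<zero>\<^bsub>G\<^esub> = h \<zero>\<^bsub>G\<^esub>"
    using additive_map_plus[OF assms(3), of "\<zero>\<^bsub>G\<^esub>" "\<zero>\<^bsub>G\<^esub>"] by simp
  then show ?thesis
    using additive_map_closed[OF assms(3), of "\<zero>\<^bsub>G\<^esub>"] by (metis H.add.l_cancel_one G.zero_closed)
qed

lemma additive_map_minus:
  assumes "abelian_group G" "abelian_group H" "additive_map G H h" "x \<in> carrier G"
  shows "h (\<ominus>\<^bsub>G\<^esub> x) = \<ominus>\<^bsub>H\<^esub> h x"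
proof -
  interpret G: abelian_group G by fact
  interpret H: abelian_group H by fact
  have "h (\<ominus>\<^bsub>G\<^esub> x) \<oplus>\<^bsub>H\<^esub> h x = \<zero>\<^bsub>H\<^esub>"
    using additive_map_plus[OF assms(3), of "\<ominus>\<^bsub>G\<^esub> x" x] additive_map_zero[OF assms(1-3)] assms(4)
    by (simp add: G.l_neg)
  then show ?thesis
    using H.minus_equality additive_map_closed[OF assms(3)] assms(4) by (metis G.a_inv_closed)
qed

lemma additive_map_comp:
  "additive_map G H h \<Longrightarrow> additive_map H L g \<Longrightarrow> additive_map G L (\<lambda>x. g (h x))"
  by (simp add: additive_map_def)

lemma additive_map_id: "additive_map G G (\<lambda>x. x)"
  by (simp add: additive_map_def)

lemma additive_map_add:
  assumes "abelian_group H" "additive_map G H h" "additive_map G H g"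
  shows "additive_map G H (\<lambda>x. h x \<oplus>\<^bsub>H\<^esub> g x)"
proof -
  interpret H: abelian_group H by fact
  show ?thesis using assms(2,3) by (simp add: additive_map_def H.a_ac)
qed


section \<open>Tensor products\<close>

definition balanced_map ::
  "('r, 'c) ring_scheme \<Rightarrow> ('r, 'a) module \<Rightarrow> ('r, 'b) module \<Rightarrow> ('g, 'd) ring_scheme
     \<Rightarrow> ('a \<times> 'b \<Rightarrow> 'g) \<Rightarrow> bool" where
  "balanced_map R M N G \<beta> \<longleftrightarrow>
     (\<forall>x\<in>carrier M. \<forall>y\<in>carrier N. \<beta> (x, y) \<in> carrier G) \<and>
     (\<forall>x\<in>carrier M. \<forall>x'\<in>carrier M. \<forall>y\<in>carrier N. \<beta> (x \<oplus>\<^bsub>M\<^esub> x', y) = \<beta> (x, y) \<oplus>\<^bsub>G\<^esub> \<beta> (x', y)) \<and>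
     (\<forall>x\<in>carrier M. \<forall>y\<in>carrier N. \<forall>y'\<in>carrier N. \<beta> (x, y \<oplus>\<^bsub>N\<^esub> y') = \<beta> (x, y) \<oplus>\<^bsub>G\<^esub> \<beta> (x, y')) \<and>
     (\<forall>a\<in>carrier R. \<forall>x\<in>carrier M. \<forall>y\<in>carrier N. \<beta> (a \<odot>\<^bsub>M\<^esub> x, y) = \<beta> (x, a \<odot>\<^bsub>N\<^esub> y))"

lemma balanced_mapI:
  assumes "\<And>x y. x \<in> carrier M \<Longrightarrow> y \<in> carrier N \<Longrightarrow> \<beta> (x, y) \<in> carrier G"
    "\<And>x x' y. x \<in> carrier M \<Longrightarrow> x' \<in> carrier M \<Longrightarrow> y \<in> carrier N \<Longrightarrow>
       \<beta> (x \<oplus>\<^bsub>M\<^esub> x', y) = \<beta> (x, y) \<oplus>\<^bsub>G\<^esub> \<beta> (x', y)"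
    "\<And>x y y'. x \<in> carrier M \<Longrightarrow> y \<in> carrier N \<Longrightarrow> y' \<in> carrier N \<Longrightarrow>
       \<beta> (x, y \<oplus>\<^bsub>N\<^esub> y') = \<beta> (x, y) \<oplus>\<^bsub>G\<^esub> \<beta> (x, y')"
    "\<And>a x y. a \<in> carrier R \<Longrightarrow> x \<in> carrier M \<Longrightarrow> y \<in> carrier N \<Longrightarrow>
       \<beta> (a \<odot>\<^bsub>M\<^esub> x, y) = \<beta> (x, a \<odot>\<^bsub>N\<^esub> y)"
  shows "balanced_map R M N G \<beta>"
  using assms by (simp add: balanced_map_def)

locale tensor_pair =
  fixes R :: "('r, 'c) ring_scheme" and M :: "('r, 'a) module" and N :: "('r, 'b) module"
  assumes group_left: "abelian_group M" and group_right: "abelian_group N"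
    and smult_left: "\<And>a x. a \<in> carrier R \<Longrightarrow> x \<in> carrier M \<Longrightarrow> a \<odot>\<^bsub>M\<^esub> x \<in> carrier M"
    and smult_right: "\<And>a y. a \<in> carrier R \<Longrightarrow> y \<in> carrier N \<Longrightarrow> a \<odot>\<^bsub>N\<^esub> y \<in> carrier N"
begin

abbreviation T where "T \<equiv> tensor_product R M N"
abbreviation cl where "cl \<equiv> tensor_class R M N"
abbreviation el where "el \<equiv> tensor_elem R M N"
abbreviation chains where "chains \<equiv> carrier (tensor_free M N)"

lemma chains_iff: "c \<in> chains \<longleftrightarrow> Poly_Mapping.keys c \<subseteq> carrier M \<times> carrier N"
  by (simp add: tensor_free_def)

lemma group_free: "group (tensor_free M N)" and comm_group_free: "comm_group (tensor_free M N)"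
  by (simp_all add: tensor_free_def abelian_free_Abelian_group)

lemma free_simps [simp]:
  "c \<otimes>\<^bsub>tensor_free M N\<^esub> d = c + d" "\<one>\<^bsub>tensor_free M N\<^esub> = 0"
  by (simp_all add: tensor_free_def)

lemma chains_zero [simp]: "0 \<in> chains" by (simp add: chains_iff)

lemma chains_add [simp]: "c \<in> chains \<Longrightarrow> d \<in> chains \<Longrightarrow> c + d \<in> chains"
  using Poly_Mapping.keys_add[of c d] by (auto simp: chains_iff)

lemma chains_minus [simp]: "c \<in> chains \<Longrightarrow> - c \<in> chains"
  by (simp add: chains_iff)

lemma chains_diff [simp]: "c \<in> chains \<Longrightarrow> d \<in> chains \<Longrightarrow> c - d \<in> chains"
  using keys_diff[of c d] by (auto simp: chains_iff)

lemma chains_frag_of [simp]: "frag_of (x, y) \<in> chains \<longleftrightarrow> x \<in> carrier M \<and> y \<in> carrier N"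
  by (simp add: chains_iff)

lemma inv_free [simp]: "c \<in> chains \<Longrightarrow> inv\<^bsub>tensor_free M N\<^esub> c = - c"
  by (simp add: tensor_free_def)

lemma chains_induct [consumes 1, case_names zero diff frag_of]:
  assumes "c \<in> chains" "P 0"
    "\<And>c d. c \<in> chains \<Longrightarrow> d \<in> chains \<Longrightarrow> P c \<Longrightarrow> P d \<Longrightarrow> P (c - d)"
    "\<And>x y. x \<in> carrier M \<Longrightarrow> y \<in> carrier N \<Longrightarrow> P (frag_of (x, y))"
  shows "P c"
proof (rule free_Abelian_group_induct[of c "carrier M \<times> carrier N" P])
qed (use assms in \<open>auto simp: chains_iff\<close>)

lemma relations_subset: "tensor_relations R M N \<subseteq> chains"
proof -
  interpret M: abelian_group M by (rule group_left)
  interpret N: abelian_group N by (rule group_right)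
  show ?thesis
    unfolding tensor_relations_def by (auto intro!: chains_diff simp: smult_left smult_right)
qed

lemma null_subgroup: "subgroup (tensor_null R M N) (tensor_free M N)"
  unfolding tensor_null_def by (rule group.generate_is_subgroup[OF group_free relations_subset])

lemma null_normal: "tensor_null R M N \<lhd> tensor_free M N"
  by (rule comm_group.subgroup_imp_normal[OF comm_group_free null_subgroup])

lemma null_subset: "c \<in> tensor_null R M N \<Longrightarrow> c \<in> chains"
  using subgroup.subset[OF null_subgroup] by blast

lemma cl_eq_iff:
  assumes "c \<in> chains" "d \<in> chains"
  shows "cl c = cl d \<longleftrightarrow> c - d \<in> tensor_null R M N"
proof
  interpret F: group "tensor_free M N" by (rule group_free)
  {
    assume "cl c = cl d"
    then have "c \<in> cl d"
      using F.rcos_self[OF assms(1) null_subgroup] by (simp add: tensor_class_def)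
    then show "c - d \<in> tensor_null R M N"
      by (auto simp: tensor_class_def r_coset_def)
  next
    assume "c - d \<in> tensor_null R M N"
    then have "c \<in> cl d"
      by (auto simp: tensor_class_def r_coset_def intro!: bexI[of _ "c - d"])
    then show "cl c = cl d"
      using F.repr_independence[OF _ assms(2) null_subgroup] by (simp add: tensor_class_def)
  }
qed

lemma mem_clD:
  assumes "d \<in> cl c" "c \<in> chains" shows "d \<in> chains" "cl d = cl c"
proof -
  obtain z where z: "z \<in> tensor_null R M N" "d = z + c"
    using assms(1) by (auto simp: tensor_class_def r_coset_def)
  show "d \<in> chains" using z assms(2) null_subset by simp
  then show "cl d = cl c" using z assms(2) by (simp add: cl_eq_iff)
qed

lemma mem_cl: "c \<in> chains \<Longrightarrow> c \<in> cl c"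
  using group.rcos_self[OF group_free _ null_subgroup] by (simp add: tensor_class_def)

lemma carrier_T: "carrier T = cl ` chains"
  by (auto simp: tensor_product_def Let_def FactGroup_def RCOSETS_def tensor_class_def)

lemma cl_closed [simp]: "c \<in> chains \<Longrightarrow> cl c \<in> carrier T"
  by (simp add: carrier_T)

lemma add_T: "c \<in> chains \<Longrightarrow> d \<in> chains \<Longrightarrow> cl c \<oplus>\<^bsub>T\<^esub> cl d = cl (c + d)"
  using normal.rcos_sum[OF null_normal, of c d]
  by (simp add: tensor_product_def Let_def FactGroup_def tensor_class_def)

lemma zero_T: "\<zero>\<^bsub>T\<^esub> = cl 0"
proof -
  interpret F: group "tensor_free M N" by (rule group_free)
  have "cl 0 = tensor_null R M N"
    using F.coset_mult_one[of "tensor_null R M N"] subgroup.subset[OF null_subgroup]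
    by (simp add: tensor_class_def)
  then show ?thesis by (simp add: tensor_product_def Let_def FactGroup_def)
qed

lemma abelian_group_T: "abelian_group T"
proof (rule abelian_groupI)
  fix x assume "x \<in> carrier T"
  then obtain c where c: "c \<in> chains" "x = cl c" by (auto simp: carrier_T)
  then show "\<exists>y\<in>carrier T. y \<oplus>\<^bsub>T\<^esub> x = \<zero>\<^bsub>T\<^esub>"
    by (intro bexI[of _ "cl (- c)"]) (simp_all add: add_T zero_T)
qed (auto simp: carrier_T add_T zero_T ac_simps)

sublocale T: abelian_group T by (rule abelian_group_T)

lemma cl_frag_of: "cl (frag_of (x, y)) = el x y"
  by (simp add: tensor_elem_def)

lemma cl_add: "c \<in> chains \<Longrightarrow> d \<in> chains \<Longrightarrow> cl (c + d) = cl c \<oplus>\<^bsub>T\<^esub> cl d"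
  by (simp add: add_T)

lemma el_closed [simp]: "x \<in> carrier M \<Longrightarrow> y \<in> carrier N \<Longrightarrow> el x y \<in> carrier T"
  by (simp add: tensor_elem_def)

lemma cl_diff_eq_zero:
  "c - d \<in> tensor_relations R M N \<Longrightarrow> c \<in> chains \<Longrightarrow> d \<in> chains \<Longrightarrow> cl c = cl d"
  by (simp add: cl_eq_iff tensor_null_def generate.incl)

lemma el_balanced: "balanced_map R M N T (\<lambda>(x, y). el x y)"
proof -
  interpret M: abelian_group M by (rule group_left)
  interpret N: abelian_group N by (rule group_right)
  show ?thesis
  proof (rule balanced_mapI; simp only: split_conv)
    fix x x' y assume *: "x \<in> carrier M" "x' \<in> carrier M" "y \<in> carrier N"
    have "frag_of (x \<oplus>\<^bsub>M\<^esub> x', y) - (frag_of (x, y) + frag_of (x', y)) \<in> tensor_relations R M N"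
      using * unfolding tensor_relations_def by (simp add: diff_diff_eq) blast
    from cl_diff_eq_zero[OF this] * show "el (x \<oplus>\<^bsub>M\<^esub> x') y = el x y \<oplus>\<^bsub>T\<^esub> el x' y"
      by (simp add: tensor_elem_def add_T)
  next
    fix x y y' assume *: "x \<in> carrier M" "y \<in> carrier N" "y' \<in> carrier N"
    have "frag_of (x, y \<oplus>\<^bsub>N\<^esub> y') - (frag_of (x, y) + frag_of (x, y')) \<in> tensor_relations R M N"
      using * unfolding tensor_relations_def by (simp add: diff_diff_eq) blast
    from cl_diff_eq_zero[OF this] * show "el x (y \<oplus>\<^bsub>N\<^esub> y') = el x y \<oplus>\<^bsub>T\<^esub> el x y'"
      by (simp add: tensor_elem_def add_T)
  next
    fix a x y assume *: "a \<in> carrier R" "x \<in> carrier M" "y \<in> carrier N"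
    have "frag_of (a \<odot>\<^bsub>M\<^esub> x, y) - frag_of (x, a \<odot>\<^bsub>N\<^esub> y) \<in> tensor_relations R M N"
      using * unfolding tensor_relations_def by blast
    from cl_diff_eq_zero[OF this] * show "el (a \<odot>\<^bsub>M\<^esub> x) y = el x (a \<odot>\<^bsub>N\<^esub> y)"
      by (simp add: tensor_elem_def smult_left smult_right)
  qed simp
qed

lemma el_add_left: "\<lbrakk>x \<in> carrier M; x' \<in> carrier M; y \<in> carrier N\<rbrakk> \<Longrightarrow> el (x \<oplus>\<^bsub>M\<^esub> x') y = el x y \<oplus>\<^bsub>T\<^esub> el x' y"
  and el_add_right: "\<lbrakk>x \<in> carrier M; y \<in> carrier N; y' \<in> carrier N\<rbrakk> \<Longrightarrow> el x (y \<oplus>\<^bsub>N\<^esub> y') = el x y \<oplus>\<^bsub>T\<^esub> el x y'"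
  and el_smult: "\<lbrakk>a \<in> carrier R; x \<in> carrier M; y \<in> carrier N\<rbrakk> \<Longrightarrow> el (a \<odot>\<^bsub>M\<^esub> x) y = el x (a \<odot>\<^bsub>N\<^esub> y)"
  using el_balanced by (simp_all add: balanced_map_def)

lemma el_additive_left: "y \<in> carrier N \<Longrightarrow> additive_map M T (\<lambda>x. el x y)"
  and el_additive_right: "x \<in> carrier M \<Longrightarrow> additive_map N T (\<lambda>y. el x y)"
  by (simp_all add: additive_map_def el_add_left el_add_right)

lemma el_zero_left: "y \<in> carrier N \<Longrightarrow> el \<zero>\<^bsub>M\<^esub> y = \<zero>\<^bsub>T\<^esub>"
  using additive_map_zero[OF group_left abelian_group_T el_additive_left] .

lemma el_zero_right: "x \<in> carrier M \<Longrightarrow> el x \<zero>\<^bsub>N\<^esub> = \<zero>\<^bsub>T\<^esub>"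
  using additive_map_zero[OF group_right abelian_group_T el_additive_right] .

text \<open>
  Sums of pure tensors exhaust the tensor product: negatives come for free, because \<open>-(x \<otimes> y) = (-x) \<otimes> y\<close>.
\<close>

lemma tensor_induct [consumes 1, case_names zero add el]:
  assumes "z \<in> carrier T" and "P \<zero>\<^bsub>T\<^esub>"
    and add: "\<And>z w. z \<in> carrier T \<Longrightarrow> w \<in> carrier T \<Longrightarrow> P z \<Longrightarrow> P w \<Longrightarrow> P (z \<oplus>\<^bsub>T\<^esub> w)"
    and el: "\<And>x y. x \<in> carrier M \<Longrightarrow> y \<in> carrier N \<Longrightarrow> P (el x y)"
  shows "P z"
proof -
  interpret M: abelian_group M by (rule group_left)
  have *: "P (cl c) \<and> P (cl (- c))" if "c \<in> chains" for c
    using that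
  proof (induction rule: chains_induct)
    case zero then show ?case using assms(2) by (simp add: zero_T)
  next
    case (diff c d)
    have "cl (c - d) = cl c \<oplus>\<^bsub>T\<^esub> cl (- d)" "cl (- (c - d)) = cl (- c) \<oplus>\<^bsub>T\<^esub> cl d"
      using diff by (simp_all add: add_T)
    then show ?case using diff add by simp
  next
    case (frag_of x y)
    have "cl (- frag_of (x, y)) \<oplus>\<^bsub>T\<^esub> el x y = \<zero>\<^bsub>T\<^esub>"
      using frag_of by (simp add: tensor_elem_def add_T zero_T)
    moreover have "el (\<ominus>\<^bsub>M\<^esub> x) y \<oplus>\<^bsub>T\<^esub> el x y = \<zero>\<^bsub>T\<^esub>"
      using frag_of el_add_left[of "\<ominus>\<^bsub>M\<^esub> x" x y] by (simp add: M.l_neg el_zero_left)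
    ultimately have "cl (- frag_of (x, y)) = el (\<ominus>\<^bsub>M\<^esub> x) y"
      using frag_of by (metis T.add.inv_equality el_closed cl_closed chains_minus chains_frag_of M.a_inv_closed)
    then show ?case using frag_of el by (simp add: cl_frag_of)
  qed
  then show ?thesis using assms(1) by (auto simp: carrier_T)
qed

lemma additive_map_eqI:
  assumes "z \<in> carrier T" "additive_map T H g" "additive_map T H h"
    and H: "abelian_group H"
    and "\<And>x y. x \<in> carrier M \<Longrightarrow> y \<in> carrier N \<Longrightarrow> g (el x y) = h (el x y)"
  shows "g z = h z"
  using assms(1)
proof (induction rule: tensor_induct)
  case zero
  show ?case by (simp add: additive_map_zero[OF abelian_group_T H] assms)
next
  case (add z w)
  then show ?case using assms(2,3) by (simp add: additive_map_plus)
qed (use assms in simp)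

end

text \<open>
  The formula of \<^const>\<open>tensor_map\<close> with values in the tensor product of a possibly different pair of modules, so that
  it yields the comparison map between two tensor products as well as the operators on a single one.
\<close>

locale tensor_pairs = A: tensor_pair R M N + B: tensor_pair R' M' N'
  for R :: "('r, 'c) ring_scheme" and M :: "('r, 'a) module" and N :: "('r, 'b) module"
    and R' :: "('s, 'd) ring_scheme" and M' :: "('s, 'a1) module" and N' :: "('s, 'b1) module"
begin

definition lift :: "('a \<times> 'b \<Rightarrow> ('a1 \<times> 'b1 \<Rightarrow>\<^sub>0 int)) \<Rightarrow> ('a \<times> 'b \<Rightarrow>\<^sub>0 int) set \<Rightarrow> ('a1 \<times> 'b1 \<Rightarrow>\<^sub>0 int) set" where
  "lift \<phi> C = (\<Union>c\<in>C. B.cl (frag_extend \<phi> c))"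

context
  fixes \<phi> :: "'a \<times> 'b \<Rightarrow> ('a1 \<times> 'b1 \<Rightarrow>\<^sub>0 int)"
  assumes chain: "\<And>x y. x \<in> carrier M \<Longrightarrow> y \<in> carrier N \<Longrightarrow> \<phi> (x, y) \<in> B.chains"
    and bal: "balanced_map R M N B.T (\<lambda>p. B.cl (\<phi> p))"
begin

lemma frag_extend_chain: "c \<in> A.chains \<Longrightarrow> frag_extend \<phi> c \<in> B.chains"
proof (induction rule: A.chains_induct)
  case (diff c d) then show ?case by (simp add: frag_extend_diff)
qed (use chain in auto)

lemma frag_extend_cl_add:
  "c \<in> A.chains \<Longrightarrow> d \<in> A.chains \<Longrightarrow>
    B.cl (frag_extend \<phi> (c + d)) = B.cl (frag_extend \<phi> c) \<oplus>\<^bsub>B.T\<^esub> B.cl (frag_extend \<phi> d)"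
  by (simp add: frag_extend_add B.add_T frag_extend_chain)

lemma frag_extend_cl_diff:
  assumes "c \<in> A.chains" "d \<in> A.chains"
    and "B.cl (frag_extend \<phi> c) = B.cl (frag_extend \<phi> d)"
  shows "B.cl (frag_extend \<phi> (c - d)) = \<zero>\<^bsub>B.T\<^esub>"
  using frag_extend_cl_add[of "c - d" d] assms
  by (metis A.chains_diff B.T.add.r_cancel_one' B.cl_closed diff_add_cancel frag_extend_chain)

lemma frag_extend_relation:
  assumes incl: "h \<in> tensor_relations R M N"
  shows "B.cl (frag_extend \<phi> h) = \<zero>\<^bsub>B.T\<^esub>"
proof -
  interpret M: abelian_group M by (rule A.group_left)
  interpret N: abelian_group N by (rule A.group_right)
  note b = bal[unfolded balanced_map_def]
  have *: "B.cl (frag_extend \<phi> (c - d - e)) = \<zero>\<^bsub>B.T\<^esub>"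
    if "c \<in> A.chains" "d \<in> A.chains" "e \<in> A.chains"
      "B.cl (frag_extend \<phi> c) = B.cl (frag_extend \<phi> d) \<oplus>\<^bsub>B.T\<^esub> B.cl (frag_extend \<phi> e)" for c d e
    using frag_extend_cl_diff[of c "d + e"] that by (simp add: frag_extend_cl_add diff_diff_eq)
  consider (l) x x' y where "h = frag_of (x \<oplus>\<^bsub>M\<^esub> x', y) - frag_of (x, y) - frag_of (x', y)"
      "x \<in> carrier M" "x' \<in> carrier M" "y \<in> carrier N"
    | (r) x y y' where "h = frag_of (x, y \<oplus>\<^bsub>N\<^esub> y') - frag_of (x, y) - frag_of (x, y')"
      "x \<in> carrier M" "y \<in> carrier N" "y' \<in> carrier N"
    | (s) a x y where "h = frag_of (a \<odot>\<^bsub>M\<^esub> x, y) - frag_of (x, a \<odot>\<^bsub>N\<^esub> y)"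
      "a \<in> carrier R" "x \<in> carrier M" "y \<in> carrier N"
    using incl unfolding tensor_relations_def by blast
  then show ?thesis
  proof cases
    case l
    with b show ?thesis unfolding l(1) by (intro *) auto
  next
    case r
    with b show ?thesis unfolding r(1) by (intro *) auto
  next
    case s
    with b show ?thesis
      unfolding s(1) by (intro frag_extend_cl_diff) (auto simp: A.smult_left A.smult_right)
  qed
qed

lemma frag_extend_null: "c \<in> tensor_null R M N \<Longrightarrow> B.cl (frag_extend \<phi> c) = \<zero>\<^bsub>B.T\<^esub>"
  unfolding tensor_null_def
proof (induction rule: generate.induct)
  case one
  then show ?case by (simp add: B.zero_T)
next
  case (incl h)
  from incl show ?case by (rule frag_extend_relation)
next
  case (inv h)
  then have h: "h \<in> A.chains" using A.relations_subset by auto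
  have zero: "B.cl (frag_extend \<phi> h) = \<zero>\<^bsub>B.T\<^esub>" by (rule frag_extend_relation[OF inv])
  have "B.cl (frag_extend \<phi> (0 - h)) = \<zero>\<^bsub>B.T\<^esub>"
    by (rule frag_extend_cl_diff) (use h zero in \<open>simp_all add: B.zero_T\<close>)
  then show ?case using h by simp
next
  case (eng h1 h2)
  then have "h1 \<in> A.chains" "h2 \<in> A.chains"
    using A.null_subset by (simp_all add: tensor_null_def)
  with eng show ?case by (simp add: frag_extend_cl_add)
qed

text \<open>
  A balanced formula kills the relations, so all representatives of a class contribute the same coset to the union
  that defines \<open>lift\<close>.
\<close>

lemma lift_cl:
  assumes c: "c \<in> A.chains"
  shows "lift \<phi> (A.cl c) = B.cl (frag_extend \<phi> c)"
proof -
  have "B.cl (frag_extend \<phi> d) = B.cl (frag_extend \<phi> c)" if "d \<in> A.cl c" for d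
  proof -
    have d: "d \<in> A.chains" "d - c \<in> tensor_null R M N"
      using A.mem_clD[OF that c] c A.cl_eq_iff by auto
    have "B.cl (frag_extend \<phi> ((d - c) + c)) = B.cl (frag_extend \<phi> (d - c)) \<oplus>\<^bsub>B.T\<^esub> B.cl (frag_extend \<phi> c)"
      using d c by (intro frag_extend_cl_add) auto
    then show ?thesis using d c by (simp add: frag_extend_null frag_extend_chain)
  qed
  then show ?thesis using A.mem_cl[OF c] unfolding lift_def by blast
qed

lemma lift_additive: "additive_map A.T B.T (lift \<phi>)"
  by (rule additive_mapI)
     (auto simp: A.carrier_T A.add_T lift_cl frag_extend_chain frag_extend_cl_add)

lemma lift_el: "x \<in> carrier M \<Longrightarrow> y \<in> carrier N \<Longrightarrow> lift \<phi> (A.el x y) = B.cl (\<phi> (x, y))"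
  by (simp add: tensor_elem_def lift_cl)

end

end

sublocale tensor_pair \<subseteq> self: tensor_pairs R M N R M N ..

context tensor_pair
begin

lemma tensor_map_lift: "tensor_map R M N \<phi> C = self.lift \<phi> C"
  by (simp add: tensor_map_def self.lift_def)

lemma tensor_map_additive:
  assumes "\<And>x y. x \<in> carrier M \<Longrightarrow> y \<in> carrier N \<Longrightarrow> \<phi> (x, y) \<in> chains"
    and "balanced_map R M N T (\<lambda>p. cl (\<phi> p))"
  shows "additive_map T T (tensor_map R M N \<phi>)"
  using self.lift_additive[of \<phi>, OF assms] unfolding tensor_map_lift[abs_def] by simp

lemma tensor_map_el:
  assumes "\<And>x y. x \<in> carrier M \<Longrightarrow> y \<in> carrier N \<Longrightarrow> \<phi> (x, y) \<in> chains"
    and "balanced_map R M N T (\<lambda>p. cl (\<phi> p))" "x \<in> carrier M" "y \<in> carrier N"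
  shows "tensor_map R M N \<phi> (el x y) = cl (\<phi> (x, y))"
  using self.lift_el[of \<phi>, OF assms] unfolding tensor_map_lift by simp

end

section \<open>Computing in the Weyl algebra\<close>

lemma abs_weyl_eqI: "p - q \<in> weyl_ideal \<Longrightarrow> abs_weyl p = abs_weyl q"
  by (simp add: weyl.abs_eq_iff)

lemma weyl_const_zero [simp]: "weyl_const 0 = 0"
  by (simp add: weyl_const_def zero_weyl_def)

lemma weyl_const_one [simp]: "weyl_const 1 = 1"
  by (simp add: weyl_const_def abs_weyl_arith flip: Poly_Mapping.single_one)

lemma weyl_const_add: "weyl_const (c + d) = weyl_const c + weyl_const d"
  by (simp add: weyl_const_def abs_weyl_arith single_add)

lemma weyl_const_mult: "weyl_const (c * d) = weyl_const c * weyl_const d"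
  by (simp add: weyl_const_def abs_weyl_arith Poly_Mapping.mult_single)

lemma weyl_const_minus: "weyl_const (- c) = - weyl_const c"
  using weyl_const_add[of c "- c"] by (simp add: eq_neg_iff_add_eq_0 add.commute)

lemma weyl_const_of_nat: "weyl_const (of_nat n) = of_nat n"
  by (induction n) (simp_all add: weyl_const_add)

lemma weyl_const_central: "weyl_const c * P = P * weyl_const c"
proof -
  obtain p where P: "P = abs_weyl p" using weyl_exhaust by blast
  have "Poly_Mapping.single 0 c * p = p * Poly_Mapping.single 0 c"
    by (induction p rule: poly_mapping_add_induct)
       (simp_all add: Poly_Mapping.mult_single distrib_left distrib_right mult.commute)
  then show ?thesis by (simp add: P weyl_const_def abs_weyl_arith)
qed

lemma abs_weyl_relation: "r \<in> weyl_relations \<Longrightarrow> abs_weyl r = 0"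
  using weyl_ideal.rel[of r 1 1] by (simp add: zero_weyl_def abs_weyl_eqI)

lemma weyl_elt_xx: "weyl_elt (Gx i) * weyl_elt (Gx j) = weyl_elt (Gx j) * weyl_elt (Gx i)"
proof -
  have "free_gen (Gx i) * free_gen (Gx j) - free_gen (Gx j) * free_gen (Gx i) \<in> weyl_relations"
    unfolding weyl_relations_def by blast
  from abs_weyl_relation[OF this] show ?thesis
    by (simp add: weyl_elt_def abs_weyl_arith flip: abs_weyl_arith(4))
qed

lemma weyl_elt_dd: "weyl_elt (Gd i) * weyl_elt (Gd j) = weyl_elt (Gd j) * weyl_elt (Gd i)"
proof -
  have "free_gen (Gd i) * free_gen (Gd j) - free_gen (Gd j) * free_gen (Gd i) \<in> weyl_relations"
    unfolding weyl_relations_def by blast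
  from abs_weyl_relation[OF this] show ?thesis
    by (simp add: weyl_elt_def abs_weyl_arith flip: abs_weyl_arith(4))
qed

lemma abs_weyl_if: "abs_weyl (if b then 1 else 0) = (if b then 1 else 0)"
  by (simp add: abs_weyl_arith zero_weyl_def)

lemma weyl_elt_dx:
  "weyl_elt (Gd i) * weyl_elt (Gx j) = weyl_elt (Gx j) * weyl_elt (Gd i) + (if i = j then 1 else 0)"
proof -
  have "free_gen (Gd i) * free_gen (Gx j) - free_gen (Gx j) * free_gen (Gd i)
      - (if i = j then 1 else 0) \<in> weyl_relations"
    unfolding weyl_relations_def by blast
  from abs_weyl_relation[OF this]
  have "weyl_elt (Gd i) * weyl_elt (Gx j) - weyl_elt (Gx j) * weyl_elt (Gd i)
      - abs_weyl (if i = j then 1 else 0) = 0"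
    by (simp add: abs_weyl_arith weyl_elt_def)
  then show ?thesis by (simp only: abs_weyl_if diff_diff_eq right_minus_eq)
qed

text \<open>
  Identities that are compatible with sums and products of operators need only be checked on constants and generators.
\<close>

lemma weyl_induct [case_names const elt add mult]:
  assumes const: "\<And>c. P (weyl_const c)" and elt: "\<And>g. P (weyl_elt g)"
    and add: "\<And>A B. P A \<Longrightarrow> P B \<Longrightarrow> P (A + B)" and mult: "\<And>A B. P A \<Longrightarrow> P B \<Longrightarrow> P (A * B)"
  shows "P A"
proof -
  obtain p where A: "A = abs_weyl p" using weyl_exhaust by blast
  have "P (abs_weyl p)"
  proof (induction p rule: poly_mapping_add_induct)
    case zero
    then show ?case using const[of 0] by (simp add: zero_weyl_def)
  next
    case (single w c)
    show ?case
    proof (induction w)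
      case Nil
      then show ?case using const[of c] by (simp add: weyl_const_def zero_list_def)
    next
      case (Cons g w)
      have "Poly_Mapping.single (g # w) c = free_gen g * Poly_Mapping.single w c"
        by (simp add: Poly_Mapping.mult_single plus_list_def)
      then show ?case using mult[OF elt[of g] Cons.IH] by (simp add: weyl_elt_def abs_weyl_arith)
    qed
  next
    case (add p q)
    then show ?case using assms(3) by (metis abs_weyl_arith(1))
  qed
  then show ?thesis by (simp add: A)
qed

text \<open>
  \<^const>\<open>weyl_incl\<close> is a ring homomorphism because it is \<open>P \<mapsto> P 1\<close> for the action of \<open>D\<^sub>X\<close> on \<open>D\<^sub>Y\<close> by
  left multiplication, whose well-definedness is that of every action of a Weyl algebra.
\<close>

context
begin

private abbreviation "DY \<equiv> (ring_of_type_algebra :: ('n option, 'k::field) weyl ring)"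
private abbreviation (input) "left_mult \<equiv> (\<lambda>g::'n weyl_gen. (*) (weyl_elt (map_weyl_gen Some g) :: ('n option, 'k::field) weyl))"
private abbreviation (input) "left_scal \<equiv> (\<lambda>c::'k::field. (*) (weyl_const c :: ('n option, 'k) weyl))"

lemma weyl_action_left_mult:
  "weyl_action (ring_of_type_algebra :: ('n option, 'k::field) weyl ring) (\<lambda>c. (*) (weyl_const c))
     (\<lambda>g. (*) (weyl_elt (map_weyl_gen Some g)))"
proof -
  interpret R: ring "DY" by (rule ring_of_type_ring)
  show ?thesis
  proof
    show "weyl_elt (map_weyl_gen Some g) * (weyl_const c * x) = weyl_const c * (weyl_elt (map_weyl_gen Some g) * x)"
      for g :: "'n weyl_gen" and c and x :: "('n option, 'k) weyl"
      by (metis mult.assoc weyl_const_central)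
    show "weyl_elt (map_weyl_gen Some (Gx i)) * (weyl_elt (map_weyl_gen Some (Gx j)) * x) =
        weyl_elt (map_weyl_gen Some (Gx j)) * (weyl_elt (map_weyl_gen Some (Gx i)) * x)"
      for i j :: 'n and x :: "('n option, 'k) weyl"
      by (simp add: weyl_elt_xx flip: mult.assoc)
    show "weyl_elt (map_weyl_gen Some (Gd i)) * (weyl_elt (map_weyl_gen Some (Gd j)) * x) =
        weyl_elt (map_weyl_gen Some (Gd j)) * (weyl_elt (map_weyl_gen Some (Gd i)) * x)"
      for i j :: 'n and x :: "('n option, 'k) weyl"
      by (simp add: weyl_elt_dd flip: mult.assoc)
    show "weyl_elt (map_weyl_gen Some (Gd i)) * (weyl_elt (map_weyl_gen Some (Gx j)) * x) =
        weyl_elt (map_weyl_gen Some (Gx j)) * (weyl_elt (map_weyl_gen Some (Gd i)) * x)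
        \<oplus>\<^bsub>DY\<^esub> (if i = j then x else \<zero>\<^bsub>DY\<^esub>)"
      for i j :: 'n and x :: "('n option, 'k) weyl"
      by (simp add: weyl_elt_dx distrib_right flip: mult.assoc)
  qed (simp_all add: weyl_const_add weyl_const_mult distrib_left distrib_right mult.assoc)
qed

private lemma incl_eq:
  "(weyl_incl P :: ('n option, 'k::field) weyl) = P \<odot>\<^bsub>weyl_module DY left_scal left_mult\<^esub> 1"
proof -
  interpret W: weyl_action DY left_scal left_mult by (rule weyl_action_left_mult)
  have w: "foldr left_mult w 1 = prod_list (map (weyl_elt \<circ> map_weyl_gen Some) w)" for w :: "'n weyl_gen list"
    by (induction w) simp_all
  have "finsum DY g A = sum g A" if "finite A" for g :: "'n weyl_gen list \<Rightarrow> ('n option, 'k) weyl" and A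
    using that by (induction A rule: finite_induct) (simp_all add: W.G.finsum_insert)
  then show ?thesis by (simp add: weyl_module_def weyl_incl_def Let_def free_act_def w)
qed

private lemma smult_eq:
  "P \<odot>\<^bsub>weyl_module DY left_scal left_mult\<^esub> (x :: ('n option, 'k::field) weyl) = weyl_incl P * x"
proof -
  interpret W: weyl_action DY left_scal left_mult by (rule weyl_action_left_mult)
  interpret L: left_module ring_of_type_algebra "weyl_module DY left_scal left_mult"
    by (rule W.left_module_weyl_module)
  have "P \<odot>\<^bsub>weyl_module DY left_scal left_mult\<^esub> (y * x) = (P \<odot>\<^bsub>weyl_module DY left_scal left_mult\<^esub> y) * x" for y
  proof (induction P arbitrary: y rule: weyl_induct)
    case (const c) then show ?case by (simp add: W.smult_const mult.assoc)
  next
    case (elt g) then show ?case by (simp add: W.smult_elt mult.assoc)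
  next
    case (add A B)
    then show ?case using L.smult_l_distr[of A B] by (simp add: distrib_right)
  next
    case (mult A B)
    then show ?case using L.smult_assoc1[of A B] by simp
  qed
  from this[of 1] show ?thesis by (simp add: incl_eq)
qed

lemma weyl_incl_const: "weyl_incl (weyl_const c) = weyl_const c"
  and weyl_incl_elt: "weyl_incl (weyl_elt g) = weyl_elt (map_weyl_gen Some g)"
  and weyl_incl_add: "weyl_incl (A + B) = weyl_incl A + weyl_incl B"
  and weyl_incl_mult: "weyl_incl (A * B) = weyl_incl A * weyl_incl B"
proof -
  interpret W: weyl_action DY left_scal left_mult by (rule weyl_action_left_mult)
  interpret L: left_module ring_of_type_algebra "weyl_module DY left_scal left_mult"
    by (rule W.left_module_weyl_module)
  show "weyl_incl (weyl_const c) = weyl_const c" by (simp add: incl_eq W.smult_const)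
  show "weyl_incl (weyl_elt g) = weyl_elt (map_weyl_gen Some g)" by (simp add: incl_eq W.smult_elt)
  show "weyl_incl (A + B) = weyl_incl A + weyl_incl B"
    using L.smult_l_distr[of A B 1] by (simp add: incl_eq)
  show "weyl_incl (A * B) = weyl_incl A * weyl_incl B"
    using L.smult_assoc1[of A B 1] by (simp add: smult_eq)
qed

end

lemma weyl_incl_one: "weyl_incl 1 = 1"
  using weyl_incl_const[of 1] by simp

lemma weyl_incl_zero: "weyl_incl 0 = 0"
  using weyl_incl_const[of 0] by simp


lemma weyl_t_commute: "weyl_t * weyl_elt (map_weyl_gen Some g) = weyl_elt (map_weyl_gen Some g) * weyl_t"
  by (cases g) (simp_all add: weyl_t_def weyl_elt_xx[of None] weyl_elt_dx)

lemma weyl_dt_commute: "weyl_dt * weyl_elt (map_weyl_gen Some g) = weyl_elt (map_weyl_gen Some g) * weyl_dt"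
  by (cases g) (simp_all add: weyl_dt_def weyl_elt_dd[of None] weyl_elt_dx)

lemma weyl_dt_t: "weyl_dt * weyl_t = weyl_t * weyl_dt + 1"
  by (simp add: weyl_dt_def weyl_t_def weyl_elt_dx)

lemma weyl_incl_commute:
  assumes "\<And>g. Q * weyl_elt (map_weyl_gen Some g) = weyl_elt (map_weyl_gen Some g) * Q"
  shows "Q * weyl_incl P = weyl_incl P * Q"
proof (induction P rule: weyl_induct)
  case (const c) show ?case by (simp add: weyl_incl_const weyl_const_central)
next
  case (elt g) show ?case by (simp add: weyl_incl_elt assms)
next
  case (add A B) then show ?case by (simp add: weyl_incl_add distrib_left distrib_right)
next
  case (mult A B)
  have "Q * (weyl_incl A * weyl_incl B) = weyl_incl A * (Q * weyl_incl B)"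
    by (simp only: mult(1) flip: mult.assoc)
  also have "\<dots> = weyl_incl A * weyl_incl B * Q" by (simp only: mult(2) mult.assoc)
  finally show ?case by (simp only: weyl_incl_mult)
qed

lemma weyl_t_incl: "weyl_t * weyl_incl P = weyl_incl P * weyl_t"
  by (rule weyl_incl_commute[OF weyl_t_commute])

lemma weyl_dt_incl: "weyl_dt * weyl_incl P = weyl_incl P * weyl_dt"
  by (rule weyl_incl_commute[OF weyl_dt_commute])

lemma weyl_dt_t_incl: "- (weyl_dt * weyl_t) * weyl_incl P = weyl_incl P * - (weyl_dt * weyl_t)"
proof -
  have "weyl_dt * weyl_t * weyl_incl P = (weyl_dt * weyl_incl P) * weyl_t"
    by (simp only: mult.assoc weyl_t_incl)
  also have "\<dots> = weyl_incl P * (weyl_dt * weyl_t)" by (simp only: weyl_dt_incl mult.assoc)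
  finally show ?thesis by (simp only: mult_minus_left mult_minus_right)
qed


section \<open>Polynomials inside the Weyl algebra\<close>

lemma mpoly_const_mult: "mpoly_const (c * d) = mpoly_const c * mpoly_const d"
  by (simp add: mpoly_const_def Poly_Mapping.mult_single)

text \<open>
  The action of a polynomial on a module reduces in this way to that of constants and variables.
\<close>

lemma mpoly_induct [case_names const var add mult]:
  fixes p :: "('v, 'k::comm_ring_1) mpoly"
  assumes const: "\<And>c. P (mpoly_const c)" and var: "\<And>i. P (mpoly_var i)"
    and add: "\<And>p q. P p \<Longrightarrow> P q \<Longrightarrow> P (p + q)" and mult: "\<And>p q. P p \<Longrightarrow> P q \<Longrightarrow> P (p * q)"
  shows "P p"
proof (induction p rule: poly_mapping_add_induct)
  case zero
  then show ?case using const[of 0] by (simp add: mpoly_const_def)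
next
  case (single m c)
  have "P (Poly_Mapping.single m 1)"
  proof (induction m rule: poly_mapping_add_induct)
    case zero
    then show ?case using const[of 1] by (simp add: mpoly_const_def)
  next
    case (single i k)
    show ?case
    proof (induction k)
      case 0
      then show ?case using const[of 1] by (simp add: mpoly_const_def)
    next
      case (Suc k)
      have "Poly_Mapping.single (Poly_Mapping.single i (Suc k)) 1 =
          mpoly_var i * Poly_Mapping.single (Poly_Mapping.single i k) (1 :: 'k)"
        by (simp add: mpoly_var_def Poly_Mapping.mult_single flip: single_add)
      then show ?case using mult[OF var Suc.IH] by simp
    qed
  next
    case (add m n)
    then show ?case using mult[of "Poly_Mapping.single m 1" "Poly_Mapping.single n 1"]
      by (simp add: Poly_Mapping.mult_single)
  qed
  from mult[OF const[of c] this] show ?case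
    by (simp add: mpoly_const_def Poly_Mapping.mult_single)
qed (use add in blast)

lemma prod_list_map_mult_commute:
  fixes a b :: "'i \<Rightarrow> 'a::monoid_mult"
  assumes "\<And>i j. a i * b j = b j * a i"
  shows "prod_list (map (\<lambda>i. a i * b i) L) = prod_list (map a L) * prod_list (map b L)"
proof (induction L)
  case (Cons i L)
  have c: "prod_list (map a L) * b i = b i * prod_list (map a L)"
  proof (induction L)
    case (Cons j L)
    have "a j * prod_list (map a L) * b i = a j * b i * prod_list (map a L)"
      by (simp only: mult.assoc Cons)
    then show ?case by (simp only: assms list.map prod_list.Cons mult.assoc)
  qed simp
  have "a i * b i * prod_list (map (\<lambda>i. a i * b i) L) = a i * (b i * prod_list (map a L)) * prod_list (map b L)"
    unfolding Cons by (simp only: mult.assoc)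
  then show ?case unfolding c[symmetric] by (simp only: list.map prod_list.Cons mult.assoc)
qed simp

lemma prod_list_map_single:
  fixes x :: "'a::monoid_mult"
  assumes "distinct L" "j \<in> set L"
  shows "prod_list (map (\<lambda>i. if i = j then x else 1) L) = x"
  using assms
proof (induction L)
  case (Cons i L)
  have "prod_list (map (\<lambda>i. if i = j then x else 1) L) = 1" if "j \<notin> set L"
    using that by (induction L) auto
  with Cons show ?case by auto
qed simp

lemma power_commute_power:
  fixes x y :: "'a::monoid_mult"
  assumes "x * y = y * x" shows "x ^ m * y ^ n = y ^ n * x ^ m"
proof -
  have *: "y * x ^ m = x ^ m * y"
    by (rule power_commuting_commutes[symmetric]) (rule assms)
  show ?thesis by (rule power_commuting_commutes[of y, symmetric]) (rule *)
qed

context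
begin

private definition mono :: "('n::{finite,linorder} \<Rightarrow>\<^sub>0 nat) \<Rightarrow> ('n, 'k::field) weyl" where
  "mono m = prod_list (map (\<lambda>i. weyl_elt (Gx i) ^ Poly_Mapping.lookup m i) (sorted_list_of_set UNIV))"

private lemma mono_zero: "mono (0 :: 'a::{finite,linorder} \<Rightarrow>\<^sub>0 nat) = (1 :: ('a, 'b::field) weyl)"
proof -
  have "prod_list (map (\<lambda>i. 1) L) = (1::('a,'b) weyl)" for L :: "'a list" by (induction L) auto
  then show ?thesis by (simp add: mono_def)
qed

private lemma mono_add: "mono (m + n) = mono m * mono n"
  unfolding mono_def lookup_add power_add
  by (rule prod_list_map_mult_commute) (rule power_commute_power, rule weyl_elt_xx)

private lemma mono_single: "mono (Poly_Mapping.single j 1) = weyl_elt (Gx j)"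
proof -
  have "mono (Poly_Mapping.single j 1) =
      prod_list (map (\<lambda>i. if i = j then weyl_elt (Gx j) else 1) (sorted_list_of_set UNIV))"
    unfolding mono_def by (rule arg_cong[where f = prod_list], rule map_cong) (simp_all add: lookup_single)
  also have "\<dots> = weyl_elt (Gx j)" by (rule prod_list_map_single) simp_all
  finally show ?thesis .
qed

private lemma weyl_of_mpoly_superset:
  assumes "finite A" "Poly_Mapping.keys p \<subseteq> A"
  shows "weyl_of_mpoly p = (\<Sum>m\<in>A. weyl_const (Poly_Mapping.lookup p m) * mono m)"
  unfolding weyl_of_mpoly_def mono_def using assms
  by (intro sum.mono_neutral_left) (auto simp: in_keys_iff)

private lemma weyl_of_mpoly_single: "weyl_of_mpoly (Poly_Mapping.single m c) = weyl_const c * mono m"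
  by (subst weyl_of_mpoly_superset[of "{m}"]) auto

lemma weyl_of_mpoly_add: "weyl_of_mpoly (p + q) = weyl_of_mpoly p + weyl_of_mpoly q"
proof -
  let ?A = "Poly_Mapping.keys p \<union> Poly_Mapping.keys q"
  have "Poly_Mapping.keys (p + q) \<subseteq> ?A" by (rule Poly_Mapping.keys_add)
  then show ?thesis
    by (simp add: weyl_of_mpoly_superset[of ?A] lookup_add distrib_right weyl_const_add sum.distrib)
qed

lemma weyl_of_mpoly_const: "weyl_of_mpoly (mpoly_const c) = weyl_const c"
  by (simp add: mpoly_const_def weyl_of_mpoly_single mono_zero)

lemma weyl_of_mpoly_var: "weyl_of_mpoly (mpoly_var i) = weyl_elt (Gx i)"
  unfolding mpoly_var_def by (simp only: weyl_of_mpoly_single mono_single) simp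

lemma weyl_of_mpoly_zero [simp]: "weyl_of_mpoly 0 = 0"
  by (simp add: weyl_of_mpoly_def)

lemma weyl_of_mpoly_mult: "weyl_of_mpoly (p * q) = weyl_of_mpoly p * weyl_of_mpoly q"
proof (induction p rule: poly_mapping_add_induct)
  case (single m c)
  show ?case
  proof (induction q rule: poly_mapping_add_induct)
    case (single n d)
    have "weyl_const c * weyl_const d * (mono m * mono n) =
        (weyl_const c * mono m) * (weyl_const d * mono n :: ('a, 'b) weyl)"
      by (metis mult.assoc weyl_const_central)
    then show ?case
      by (simp add: Poly_Mapping.mult_single weyl_of_mpoly_single weyl_const_mult mono_add)
  qed (simp_all add: distrib_left weyl_of_mpoly_add)
qed (simp_all add: distrib_right weyl_of_mpoly_add)

end

lemma weyl_of_mpoly_one [simp]: "weyl_of_mpoly 1 = 1"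
  using weyl_of_mpoly_const[of 1] by (simp add: mpoly_const_def)

lemma weyl_of_mpoly_commute: "weyl_of_mpoly p * weyl_of_mpoly q = weyl_of_mpoly q * weyl_of_mpoly p"
  by (metis weyl_of_mpoly_mult mult.commute)

text \<open>
  The commutator with \<open>\<partial>\<^sub>i\<close> obeys the product rule, as \<open>\<partial>\<^sub>i\<close> itself does on polynomials.
\<close>

lemma weyl_deriv_mpoly:
  "weyl_elt (Gd i) * weyl_of_mpoly p = weyl_of_mpoly p * weyl_elt (Gd i) + weyl_of_mpoly (mpoly_deriv i p)"
proof (induction p rule: mpoly_induct)
  case (const c)
  then show ?case by (simp add: weyl_of_mpoly_const mpoly_deriv_const weyl_const_central)
next
  case (var j)
  then show ?case by (simp add: weyl_of_mpoly_var mpoly_deriv_var weyl_elt_dx)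
next
  case (add p q)
  then show ?case by (simp add: weyl_of_mpoly_add mpoly_deriv_add distrib_left distrib_right)
next
  case (mult p q)
  have "weyl_elt (Gd i) * weyl_of_mpoly (p * q) = (weyl_elt (Gd i) * weyl_of_mpoly p) * weyl_of_mpoly q"
    by (simp add: weyl_of_mpoly_mult mult.assoc)
  also have "\<dots> = weyl_of_mpoly p * (weyl_elt (Gd i) * weyl_of_mpoly q)
      + weyl_of_mpoly (mpoly_deriv i p) * weyl_of_mpoly q"
    by (simp add: mult distrib_right mult.assoc)
  finally show ?case
    by (simp add: mult weyl_of_mpoly_mult mpoly_deriv_mult weyl_of_mpoly_add distrib_left mult.assoc add_ac)
qed


section \<open>Evaluating a polynomial at an element of the Weyl algebra\<close>

lemma weyl_poly_eval_superset:
  assumes "Polynomial.degree b \<le> n"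
  shows "weyl_poly_eval b P = (\<Sum>k\<le>n. weyl_const (Polynomial.coeff b k) * P ^ k)"
  unfolding weyl_poly_eval_def using assms
  by (intro sum.mono_neutral_left) (auto simp: Polynomial.coeff_eq_0)

lemma weyl_poly_eval_add: "weyl_poly_eval (b + c) P = weyl_poly_eval b P + weyl_poly_eval c P"
proof -
  let ?n = "max (Polynomial.degree b) (Polynomial.degree c)"
  have "Polynomial.degree (b + c) \<le> ?n" by (rule Polynomial.degree_add_le) auto
  then show ?thesis
    by (simp add: weyl_poly_eval_superset[of _ ?n] weyl_const_add distrib_right sum.distrib)
qed

lemma weyl_poly_eval_smult: "weyl_poly_eval (Polynomial.smult a b) P = weyl_const a * weyl_poly_eval b P"
  by (simp add: weyl_poly_eval_superset[of _ "Polynomial.degree b"] weyl_const_mult mult.assoc sum_distrib_left)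

lemma weyl_poly_eval_zero [simp]: "weyl_poly_eval 0 P = 0"
  by (simp add: weyl_poly_eval_def)

lemma weyl_poly_eval_pCons: "weyl_poly_eval (pCons a b) P = weyl_const a + P * weyl_poly_eval b P"
proof -
  have "weyl_poly_eval (pCons a b) P = (\<Sum>k\<le>Suc (Polynomial.degree b). weyl_const (Polynomial.coeff (pCons a b) k) * P ^ k)"
    by (rule weyl_poly_eval_superset) (simp add: Polynomial.degree_pCons_le)
  also have "\<dots> = weyl_const a + (\<Sum>k\<le>Polynomial.degree b. weyl_const (Polynomial.coeff b k) * P ^ Suc k)"
    by (simp add: sum.atMost_Suc_shift del: power_Suc sum.atMost_Suc)
  also have "\<dots> = weyl_const a + P * weyl_poly_eval b P"
    by (simp add: weyl_poly_eval_def sum_distrib_left weyl_const_central[of _ P] mult.assoc[symmetric])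
  finally show ?thesis .
qed

lemma weyl_poly_eval_mult: "weyl_poly_eval (b * c) P = weyl_poly_eval b P * weyl_poly_eval c P"
  by (induction b rule: pCons_induct)
     (simp_all add: weyl_poly_eval_add weyl_poly_eval_smult weyl_poly_eval_pCons distrib_right mult.assoc)

section \<open>Modules over the ring formed by a type\<close>

text \<open>
  Here every element of the type is a scalar, which removes the carrier conditions on scalars from the module laws.
\<close>

locale type_module = left_module ring_of_type_algebra M
  for M :: "('r::ring_1, 'm) module"
begin

lemma sm_closed [simp]: "x \<in> carrier M \<Longrightarrow> a \<odot>\<^bsub>M\<^esub> x \<in> carrier M"
  by (simp add: smult_closed)

lemma sm_add_left: "x \<in> carrier M \<Longrightarrow> (a + b) \<odot>\<^bsub>M\<^esub> x = a \<odot>\<^bsub>M\<^esub> x \<oplus>\<^bsub>M\<^esub> b \<odot>\<^bsub>M\<^esub> x"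
  using smult_l_distr[of a b x] by simp

lemma sm_add_right: "x \<in> carrier M \<Longrightarrow> y \<in> carrier M \<Longrightarrow> a \<odot>\<^bsub>M\<^esub> (x \<oplus>\<^bsub>M\<^esub> y) = a \<odot>\<^bsub>M\<^esub> x \<oplus>\<^bsub>M\<^esub> a \<odot>\<^bsub>M\<^esub> y"
  using smult_r_distr[of a x y] by simp

lemma sm_mult: "x \<in> carrier M \<Longrightarrow> (a * b) \<odot>\<^bsub>M\<^esub> x = a \<odot>\<^bsub>M\<^esub> (b \<odot>\<^bsub>M\<^esub> x)"
  using smult_assoc1[of a b x] by simp

lemma sm_one [simp]: "x \<in> carrier M \<Longrightarrow> 1 \<odot>\<^bsub>M\<^esub> x = x"
  using smult_one[of x] by simp

lemma additive_sm: "additive_map M M (\<lambda>x. a \<odot>\<^bsub>M\<^esub> x)"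
  by (rule additive_mapI) (simp_all add: sm_add_right)

lemma sm_zero_right [simp]: "a \<odot>\<^bsub>M\<^esub> \<zero>\<^bsub>M\<^esub> = \<zero>\<^bsub>M\<^esub>"
  by (rule additive_map_zero[OF M.abelian_group_axioms M.abelian_group_axioms additive_sm])

lemma sm_zero_left [simp]: "x \<in> carrier M \<Longrightarrow> 0 \<odot>\<^bsub>M\<^esub> x = \<zero>\<^bsub>M\<^esub>"
  using sm_add_left[of x 0 0] by (metis add_0 sm_closed M.add.l_cancel_one')

lemma sm_minus_left: "x \<in> carrier M \<Longrightarrow> (- a) \<odot>\<^bsub>M\<^esub> x = \<ominus>\<^bsub>M\<^esub> (a \<odot>\<^bsub>M\<^esub> x)"
  using sm_add_left[of x "- a" a] by (metis sm_closed sm_zero_left left_minus M.minus_equality)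

lemma sm_commute:
  "x \<in> carrier M \<Longrightarrow> a * b = b * a \<Longrightarrow> a \<odot>\<^bsub>M\<^esub> (b \<odot>\<^bsub>M\<^esub> x) = b \<odot>\<^bsub>M\<^esub> (a \<odot>\<^bsub>M\<^esub> x)"
  by (metis sm_mult)

end

lemma type_moduleI:
  fixes M :: "('r::ring_1, 'm) module"
  assumes "abelian_group M"
    and "\<And>a x. x \<in> carrier M \<Longrightarrow> a \<odot>\<^bsub>M\<^esub> x \<in> carrier M"
    and "\<And>a b x. x \<in> carrier M \<Longrightarrow> (a + b) \<odot>\<^bsub>M\<^esub> x = a \<odot>\<^bsub>M\<^esub> x \<oplus>\<^bsub>M\<^esub> b \<odot>\<^bsub>M\<^esub> x"
    and "\<And>a x y. x \<in> carrier M \<Longrightarrow> y \<in> carrier M \<Longrightarrow>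
      a \<odot>\<^bsub>M\<^esub> (x \<oplus>\<^bsub>M\<^esub> y) = a \<odot>\<^bsub>M\<^esub> x \<oplus>\<^bsub>M\<^esub> a \<odot>\<^bsub>M\<^esub> y"
    and "\<And>a b x. x \<in> carrier M \<Longrightarrow> (a * b) \<odot>\<^bsub>M\<^esub> x = a \<odot>\<^bsub>M\<^esub> (b \<odot>\<^bsub>M\<^esub> x)"
    and "\<And>x. x \<in> carrier M \<Longrightarrow> 1 \<odot>\<^bsub>M\<^esub> x = x"
  shows "type_module M"
  unfolding type_module_def left_module_def left_module_axioms_def
  using assms by (simp add: ring_of_type_ring)

lemma restrict_scalars_simps [simp]:
  "carrier (restrict_scalars h M) = carrier M"
  "ring.add (restrict_scalars h M) = ring.add M"
  "ring.zero (restrict_scalars h M) = ring.zero M"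
  "a \<odot>\<^bsub>restrict_scalars h M\<^esub> x = h a \<odot>\<^bsub>M\<^esub> x"
  by (simp_all add: restrict_scalars_def)

lemma abelian_group_restrict_scalars: "abelian_group M \<Longrightarrow> abelian_group (restrict_scalars h M)"
  by (rule abelian_group_transfer[of M]) simp_all

lemma type_module_restrict_scalars:
  fixes h :: "'r::ring_1 \<Rightarrow> 's::ring_1"
  assumes "type_module M" and "\<And>a b. h (a + b) = h a + h b" "\<And>a b. h (a * b) = h a * h b" "h 1 = 1"
  shows "type_module (restrict_scalars h M)"
proof -
  interpret type_module M by fact
  show ?thesis
    by (rule type_moduleI)
      (simp_all add: assms sm_add_left sm_add_right sm_mult abelian_group_restrict_scalars M.abelian_group_axioms)
qed

lemma (in weyl_action) type_module_weyl_module: "type_module (weyl_module G \<kappa> ops)"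
  using left_module_weyl_module by (simp add: type_module_def)


section \<open>Modules over \<open>D[s]\<close>\<close>

locale weyl_s_action = weyl_action G \<kappa> ops
  for G :: "('m, 'z) ring_scheme" (structure) and \<kappa> :: "'k::field \<Rightarrow> 'm \<Rightarrow> 'm"
    and ops :: "'v weyl_gen \<Rightarrow> 'm \<Rightarrow> 'm" +
  fixes \<sigma> :: "'m \<Rightarrow> 'm"
  assumes s_closed [simp]: "x \<in> carrier G \<Longrightarrow> \<sigma> x \<in> carrier G"
    and s_add: "x \<in> carrier G \<Longrightarrow> y \<in> carrier G \<Longrightarrow> \<sigma> (x \<oplus> y) = \<sigma> x \<oplus> \<sigma> y"
    and s_scal: "x \<in> carrier G \<Longrightarrow> \<sigma> (\<kappa> c x) = \<kappa> c (\<sigma> x)"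
    and s_op: "x \<in> carrier G \<Longrightarrow> \<sigma> (ops g x) = ops g (\<sigma> x)"
begin

abbreviation "W \<equiv> weyl_module G \<kappa> ops"
abbreviation "S \<equiv> weyl_s_module G \<kappa> ops \<sigma>"

sublocale W: type_module W by (rule type_module_weyl_module)

lemma s_smult: "x \<in> carrier G \<Longrightarrow> \<sigma> (A \<odot>\<^bsub>W\<^esub> x) = A \<odot>\<^bsub>W\<^esub> \<sigma> x"
proof (induction A arbitrary: x rule: weyl_induct)
  case (add A B)
  have c: "A \<odot>\<^bsub>W\<^esub> x \<in> carrier G" "B \<odot>\<^bsub>W\<^esub> x \<in> carrier G"
    using W.sm_closed[of x] add.prems by simp_all
  then show ?case using add W.sm_add_left[of x A B] W.sm_add_left[of "\<sigma> x" A B] by (simp add: s_add)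
next
  case (mult A B)
  have "B \<odot>\<^bsub>W\<^esub> x \<in> carrier G"
    using W.sm_closed[of x] mult.prems by simp
  then show ?case using mult W.sm_mult[of x A B] W.sm_mult[of "\<sigma> x" A B] by simp
qed (simp_all add: smult_const smult_elt s_scal s_op)

lemma s_pow_closed [simp]: "x \<in> carrier G \<Longrightarrow> (\<sigma> ^^ k) x \<in> carrier G"
  by (induction k) simp_all

lemma s_pow_add: "x \<in> carrier G \<Longrightarrow> y \<in> carrier G \<Longrightarrow> (\<sigma> ^^ k) (x \<oplus> y) = (\<sigma> ^^ k) x \<oplus> (\<sigma> ^^ k) y"
  by (induction k) (simp_all add: s_add)

lemma s_pow_smult: "x \<in> carrier G \<Longrightarrow> (\<sigma> ^^ k) (A \<odot>\<^bsub>W\<^esub> x) = A \<odot>\<^bsub>W\<^esub> (\<sigma> ^^ k) x"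
  by (induction k) (simp_all add: s_smult)

lemma s_pow_zero [simp]: "(\<sigma> ^^ k) \<zero> = \<zero>"
  using s_pow_add[of \<zero> \<zero> k] by (metis G.add.l_cancel_one' G.l_zero s_pow_closed zero_closed)

lemma W_closed [simp]: "x \<in> carrier G \<Longrightarrow> A \<odot>\<^bsub>W\<^esub> x \<in> carrier G"
  using W.sm_closed[of x] by simp

lemma W_zero [simp]: "x \<in> carrier G \<Longrightarrow> 0 \<odot>\<^bsub>W\<^esub> x = \<zero>"
  using W.sm_zero_left[of x] by simp

lemma S_simps [simp]:
  "carrier S = carrier G" "ring.add S = ring.add G" "ring.zero S = ring.zero G"
  by (simp_all add: weyl_s_module_def)

lemma S_smult:
  "P \<odot>\<^bsub>S\<^esub> x = finsum G (\<lambda>k. (\<sigma> ^^ k) (Poly_Mapping.lookup P k \<odot>\<^bsub>W\<^esub> x)) (Poly_Mapping.keys P)"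
  by (simp add: weyl_s_module_def weyl_module_def)

lemma S_smult_superset:
  assumes "finite A" "Poly_Mapping.keys P \<subseteq> A" "x \<in> carrier G"
  shows "P \<odot>\<^bsub>S\<^esub> x = finsum G (\<lambda>k. (\<sigma> ^^ k) (Poly_Mapping.lookup P k \<odot>\<^bsub>W\<^esub> x)) A"
  unfolding S_smult using assms
  by (intro add.finprod_mono_neutral_cong_left) (auto simp: in_keys_iff)

lemma S_smult_zero [simp]: "0 \<odot>\<^bsub>S\<^esub> x = \<zero>"
  by (simp add: S_smult)

lemma S_smult_single:
  assumes "x \<in> carrier G"
  shows "Poly_Mapping.single k A \<odot>\<^bsub>S\<^esub> x = (\<sigma> ^^ k) (A \<odot>\<^bsub>W\<^esub> x)"
  by (subst S_smult_superset[of "{k}"]) (use assms in \<open>auto simp: finsum_singleton\<close>)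

lemma S_closed [simp]: "x \<in> carrier G \<Longrightarrow> P \<odot>\<^bsub>S\<^esub> x \<in> carrier G"
  unfolding S_smult by (intro finsum_closed) auto

lemma S_smult_plus:
  assumes "x \<in> carrier G" shows "(P + Q) \<odot>\<^bsub>S\<^esub> x = P \<odot>\<^bsub>S\<^esub> x \<oplus> Q \<odot>\<^bsub>S\<^esub> x"
proof -
  let ?A = "Poly_Mapping.keys P \<union> Poly_Mapping.keys Q"
  have *: "(A + B) \<odot>\<^bsub>W\<^esub> x = A \<odot>\<^bsub>W\<^esub> x \<oplus> B \<odot>\<^bsub>W\<^esub> x" for A B
    using W.sm_add_left[of x A B] assms by simp
  have "Poly_Mapping.keys (P + Q) \<subseteq> ?A" by (rule Poly_Mapping.keys_add)
  with assms show ?thesis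
    by (simp add: S_smult_superset[of ?A] lookup_add * s_pow_add Pi_def flip: finsum_addf)
qed

lemma S_smult_add:
  assumes "x \<in> carrier G" "y \<in> carrier G" shows "P \<odot>\<^bsub>S\<^esub> (x \<oplus> y) = P \<odot>\<^bsub>S\<^esub> x \<oplus> P \<odot>\<^bsub>S\<^esub> y"
proof -
  have *: "A \<odot>\<^bsub>W\<^esub> (x \<oplus> y) = A \<odot>\<^bsub>W\<^esub> x \<oplus> A \<odot>\<^bsub>W\<^esub> y" for A
    using W.sm_add_right[of x y A] assms by simp
  show ?thesis
    unfolding S_smult using assms by (simp add: * s_pow_add Pi_def flip: finsum_addf)
qed

lemma S_smult_r_zero [simp]: "P \<odot>\<^bsub>S\<^esub> \<zero> = \<zero>"
  using S_smult_add[of \<zero> \<zero> P] by (metis G.add.l_cancel_one' G.l_zero S_closed zero_closed)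

lemma S_smult_mult:
  assumes "x \<in> carrier G" shows "(P * Q) \<odot>\<^bsub>S\<^esub> x = P \<odot>\<^bsub>S\<^esub> (Q \<odot>\<^bsub>S\<^esub> x)"
proof (induction P rule: poly_mapping_add_induct)
  case (single j A)
  show ?case
  proof (induction Q rule: poly_mapping_add_induct)
    case (single k B)
    have "(\<sigma> ^^ (j + k)) (A \<odot>\<^bsub>W\<^esub> (B \<odot>\<^bsub>W\<^esub> x)) = (\<sigma> ^^ j) (A \<odot>\<^bsub>W\<^esub> (\<sigma> ^^ k) (B \<odot>\<^bsub>W\<^esub> x))"
      using assms by (simp add: funpow_add s_pow_smult)
    with assms show ?case
      using W.sm_mult[of x A B] by (simp add: Poly_Mapping.mult_single S_smult_single)
  qed (use assms in \<open>simp_all add: distrib_left S_smult_plus S_smult_add\<close>)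
qed (use assms in \<open>simp_all add: distrib_right S_smult_plus\<close>)

lemma type_module_S: "type_module S"
proof -
  have grp: "abelian_group S"
    by (rule abelian_group_transfer[OF G.abelian_group_axioms]) simp_all
  have one: "1 \<odot>\<^bsub>S\<^esub> x = x" if "x \<in> carrier G" for x
    using that W.sm_one[of x] by (simp add: S_smult_single flip: Poly_Mapping.single_one)
  show ?thesis
    by (rule type_moduleI) (simp_all add: grp S_smult_plus S_smult_add S_smult_mult one)
qed

lemma S_smult_single_zero: "x \<in> carrier G \<Longrightarrow> Poly_Mapping.single 0 A \<odot>\<^bsub>S\<^esub> x = A \<odot>\<^bsub>W\<^esub> x"
  by (simp add: S_smult_single)

lemma S_smult_s: "x \<in> carrier G \<Longrightarrow> Poly_Mapping.single 1 1 \<odot>\<^bsub>S\<^esub> x = \<sigma> x"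
  using W.sm_one[of x] by (simp add: S_smult_single)

end


section \<open>The Leibniz rule on tensor products\<close>

text \<open>
  The tensor product over \<open>K[x]\<close> of two \<open>D\<^sub>X\<close>-modules. An endomorphism of the second factor that commutes with \<open>D\<^sub>X\<close>
  acts on it as well (\<open>right\<close>); this is how \<open>t\<close> and \<open>\<partial>\<^sub>t\<close> act on \<open>M \<otimes> B\<^bsub>Z|Y\<^esub>\<close> and \<open>s\<close> on \<open>M \<otimes> K[x,f\<^sup>-\<^sup>1,s] f\<^sup>s\<close>.
\<close>

locale leibniz_tensor = M: type_module M + N: type_module N
  for M :: "(('n::{finite,linorder}, 'k::field) weyl, 'a) module"
    and N :: "(('n, 'k) weyl, 'b) module"
begin

abbreviation "PM \<equiv> restrict_scalars weyl_of_mpoly M"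
abbreviation "PN \<equiv> restrict_scalars weyl_of_mpoly N"

sublocale tensor_pair "mpoly_ring :: ('n, 'k) mpoly ring" PM PN
  by (rule tensor_pair.intro) (simp_all add: abelian_group_restrict_scalars M.M.abelian_group_axioms N.M.abelian_group_axioms)

lemmas el_add_l = el_add_left[simplified] and el_add_r = el_add_right[simplified]

lemma el_poly:
  "m \<in> carrier M \<Longrightarrow> n \<in> carrier N \<Longrightarrow> el (weyl_of_mpoly a \<odot>\<^bsub>M\<^esub> m) n = el m (weyl_of_mpoly a \<odot>\<^bsub>N\<^esub> n)"
  using el_smult[of a m n] by simp

lemma tensor_map_pure:
  assumes "additive_map M M E" "additive_map N N F"
    and "\<And>a m. m \<in> carrier M \<Longrightarrow> E (weyl_of_mpoly a \<odot>\<^bsub>M\<^esub> m) = weyl_of_mpoly a \<odot>\<^bsub>M\<^esub> E m"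
    and "\<And>a n. n \<in> carrier N \<Longrightarrow> F (weyl_of_mpoly a \<odot>\<^bsub>N\<^esub> n) = weyl_of_mpoly a \<odot>\<^bsub>N\<^esub> F n"
  shows "additive_map T T (tensor_map mpoly_ring PM PN (\<lambda>(m, n). frag_of (E m, F n)))"
    and "\<lbrakk>m \<in> carrier M; n \<in> carrier N\<rbrakk> \<Longrightarrow>
      tensor_map mpoly_ring PM PN (\<lambda>(m, n). frag_of (E m, F n)) (el m n) = el (E m) (F n)"
proof -
  have c: "E m \<in> carrier M" "F n \<in> carrier N" if "m \<in> carrier M" "n \<in> carrier N" for m n
    using assms(1,2) that by (simp_all add: additive_map_def)
  have b: "balanced_map mpoly_ring PM PN T (\<lambda>p. cl ((\<lambda>(m, n). frag_of (E m, F n)) p))"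
    using assms by (intro balanced_mapI) (simp_all add: c cl_frag_of additive_map_plus el_add_l el_add_r el_poly)
  show "additive_map T T (tensor_map mpoly_ring PM PN (\<lambda>(m, n). frag_of (E m, F n)))"
    by (rule tensor_map_additive[OF _ b]) (simp add: c)
  show "tensor_map mpoly_ring PM PN (\<lambda>(m, n). frag_of (E m, F n)) (el m n) = el (E m) (F n)"
    if "m \<in> carrier M" "n \<in> carrier N"
    using tensor_map_el[OF _ b, of m n] that c by (simp add: cl_frag_of)
qed

abbreviation scal where
  "scal c \<equiv> tensor_map mpoly_ring PM PN (\<lambda>(m, n). frag_of (weyl_const c \<odot>\<^bsub>M\<^esub> m, n))"

abbreviation right where
  "right F \<equiv> tensor_map mpoly_ring PM PN (\<lambda>(m, n). frag_of (m, F n))"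

fun leibniz_gen where
  "leibniz_gen (Gx i) (m, n) = frag_of (weyl_elt (Gx i) \<odot>\<^bsub>M\<^esub> m, n)"
| "leibniz_gen (Gd i) (m, n) =
     frag_of (weyl_elt (Gd i) \<odot>\<^bsub>M\<^esub> m, n) + frag_of (m, weyl_elt (Gd i) \<odot>\<^bsub>N\<^esub> n)"

abbreviation op where
  "op g \<equiv> tensor_map mpoly_ring PM PN (leibniz_gen g)"

lemma scal_additive: "additive_map T T (scal c)"
  and scal_el: "\<lbrakk>m \<in> carrier M; n \<in> carrier N\<rbrakk> \<Longrightarrow> scal c (el m n) = el (weyl_const c \<odot>\<^bsub>M\<^esub> m) n"
  by (rule tensor_map_pure[where F = "\<lambda>n. n"];
      simp add: M.additive_sm additive_map_id M.sm_commute weyl_const_central)+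

lemma opx_eq: "leibniz_gen (Gx i) = (\<lambda>(m, n). frag_of (weyl_elt (Gx i) \<odot>\<^bsub>M\<^esub> m, n))"
  by (auto simp: fun_eq_iff)

lemma opx_additive: "additive_map T T (op (Gx i))"
  and opx_el: "\<lbrakk>m \<in> carrier M; n \<in> carrier N\<rbrakk> \<Longrightarrow> op (Gx i) (el m n) = el (weyl_elt (Gx i) \<odot>\<^bsub>M\<^esub> m) n"
  unfolding opx_eq
  by (rule tensor_map_pure[where F = "\<lambda>n. n"];
      simp add: M.additive_sm additive_map_id M.sm_commute weyl_of_mpoly_commute flip: weyl_of_mpoly_var)+

text \<open>
  The Leibniz rule is balanced because the terms \<open>(\<partial>\<^sub>i a) m \<otimes> n\<close> and \<open>m \<otimes> (\<partial>\<^sub>i a) n\<close>, by which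
  \<open>\<partial>\<^sub>i (a m) \<otimes> n\<close> and \<open>m \<otimes> \<partial>\<^sub>i (a n)\<close> fail to be linear in \<open>a\<close>, agree.
\<close>

lemma opd_additive: "additive_map T T (op (Gd i))"
  and opd_el: "\<lbrakk>m \<in> carrier M; n \<in> carrier N\<rbrakk> \<Longrightarrow>
    op (Gd i) (el m n) = el (weyl_elt (Gd i) \<odot>\<^bsub>M\<^esub> m) n \<oplus>\<^bsub>T\<^esub> el m (weyl_elt (Gd i) \<odot>\<^bsub>N\<^esub> n)"
proof -
  let ?D = "weyl_elt (Gd i) :: ('n, 'k) weyl"
  have cl: "cl (leibniz_gen (Gd i) (m, n)) = el (?D \<odot>\<^bsub>M\<^esub> m) n \<oplus>\<^bsub>T\<^esub> el m (?D \<odot>\<^bsub>N\<^esub> n)"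
    if "m \<in> carrier M" "n \<in> carrier N" for m n
    using that by (simp add: cl_add cl_frag_of)
  have b: "balanced_map mpoly_ring PM PN T (\<lambda>p. cl (leibniz_gen (Gd i) p))"
  proof (rule balanced_mapI)
    fix a :: "('n, 'k) mpoly" and m n
    assume "m \<in> carrier PM" "n \<in> carrier PN"
    then have mn: "m \<in> carrier M" "n \<in> carrier N" by simp_all
    let ?a = "weyl_of_mpoly a" and ?a' = "weyl_of_mpoly (mpoly_deriv i a)"
    have "?D \<odot>\<^bsub>M\<^esub> (?a \<odot>\<^bsub>M\<^esub> m) = ?a \<odot>\<^bsub>M\<^esub> (?D \<odot>\<^bsub>M\<^esub> m) \<oplus>\<^bsub>M\<^esub> ?a' \<odot>\<^bsub>M\<^esub> m"
      "?D \<odot>\<^bsub>N\<^esub> (?a \<odot>\<^bsub>N\<^esub> n) = ?a \<odot>\<^bsub>N\<^esub> (?D \<odot>\<^bsub>N\<^esub> n) \<oplus>\<^bsub>N\<^esub> ?a' \<odot>\<^bsub>N\<^esub> n"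
      using mn by (simp_all add: weyl_deriv_mpoly M.sm_add_left N.sm_add_left flip: M.sm_mult N.sm_mult)
    with mn have "el (?D \<odot>\<^bsub>M\<^esub> (?a \<odot>\<^bsub>M\<^esub> m)) n \<oplus>\<^bsub>T\<^esub> el (?a \<odot>\<^bsub>M\<^esub> m) (?D \<odot>\<^bsub>N\<^esub> n) =
        el (?D \<odot>\<^bsub>M\<^esub> m) (?a \<odot>\<^bsub>N\<^esub> n) \<oplus>\<^bsub>T\<^esub> el m (?D \<odot>\<^bsub>N\<^esub> (?a \<odot>\<^bsub>N\<^esub> n))"
      by (simp add: el_add_l el_add_r el_poly T.a_ac)
    then show "cl (leibniz_gen (Gd i) (a \<odot>\<^bsub>PM\<^esub> m, n)) = cl (leibniz_gen (Gd i) (m, a \<odot>\<^bsub>PN\<^esub> n))"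
      using mn cl by simp
  qed (simp_all add: cl el_add_l el_add_r M.sm_add_right N.sm_add_right T.a_ac del: leibniz_gen.simps)
  show "additive_map T T (op (Gd i))"
    by (rule tensor_map_additive[OF _ b]) simp
  show "op (Gd i) (el m n) = el (?D \<odot>\<^bsub>M\<^esub> m) n \<oplus>\<^bsub>T\<^esub> el m (?D \<odot>\<^bsub>N\<^esub> n)"
    if "m \<in> carrier M" "n \<in> carrier N"
    using tensor_map_el[OF _ b, of m n] that cl by simp
qed

lemma op_additive: "additive_map T T (op g)"
  by (cases g) (simp_all add: opx_additive opd_additive)

lemma T_ext:
  assumes "additive_map T T g" "additive_map T T h" "z \<in> carrier T"
    and "\<And>m n. m \<in> carrier M \<Longrightarrow> n \<in> carrier N \<Longrightarrow> g (el m n) = h (el m n)"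
  shows "g z = h z"
  by (rule additive_map_eqI[OF assms(3,1,2) abelian_group_T]) (use assms(4) in simp)

lemmas add_maps = additive_map_add[OF abelian_group_T] additive_map_id scal_additive op_additive
  additive_map_comp[OF op_additive op_additive] additive_map_comp[OF op_additive scal_additive]
  additive_map_comp[OF scal_additive op_additive] additive_map_comp[OF scal_additive scal_additive]

lemma weyl_action_T: "weyl_action T scal op"
proof
  fix x y c d g i j
  assume x: "x \<in> carrier T"
  show "scal c x \<in> carrier T" by (rule additive_map_closed[OF scal_additive x])
  show "op g x \<in> carrier T" by (rule additive_map_closed[OF op_additive x])
  show "scal (c + d) x = scal c x \<oplus>\<^bsub>T\<^esub> scal d x"
  proof (rule T_ext[OF _ _ x])
    fix m n assume mn: "m \<in> carrier M" "n \<in> carrier N"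
    have "weyl_const (c + d) \<odot>\<^bsub>M\<^esub> m = weyl_const c \<odot>\<^bsub>M\<^esub> m \<oplus>\<^bsub>M\<^esub> weyl_const d \<odot>\<^bsub>M\<^esub> m"
      using mn by (simp add: weyl_const_add M.sm_add_left)
    then show "scal (c + d) (el m n) = scal c (el m n) \<oplus>\<^bsub>T\<^esub> scal d (el m n)"
      using mn by (simp add: scal_el el_add_l)
  qed (intro add_maps)+
  show "scal (c * d) x = scal c (scal d x)"
  proof (rule T_ext[OF _ _ x])
    fix m n assume mn: "m \<in> carrier M" "n \<in> carrier N"
    have "weyl_const (c * d) \<odot>\<^bsub>M\<^esub> m = weyl_const c \<odot>\<^bsub>M\<^esub> (weyl_const d \<odot>\<^bsub>M\<^esub> m)"
      using mn by (simp add: weyl_const_mult M.sm_mult)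
    then show "scal (c * d) (el m n) = scal c (scal d (el m n))"
      using mn by (simp add: scal_el)
  qed (intro add_maps)+
  show "scal 1 x = x"
  proof (rule T_ext[OF scal_additive additive_map_id x])
    fix m n assume mn: "m \<in> carrier M" "n \<in> carrier N"
    have "weyl_const 1 \<odot>\<^bsub>M\<^esub> m = m" using mn by simp
    then show "scal 1 (el m n) = el m n" using scal_el[OF mn, of 1] by metis
  qed
  show "op g (scal c x) = scal c (op g x)"
    by (rule T_ext[OF _ _ x]; cases g)
       (auto intro!: add_maps simp: scal_el opx_el opd_el additive_map_plus[OF scal_additive]
         M.sm_commute[OF _ weyl_const_central[symmetric]])
  show "op (Gx i) (op (Gx j) x) = op (Gx j) (op (Gx i) x)"
    by (rule T_ext[OF _ _ x])
       (auto intro!: add_maps simp: opx_el M.sm_commute[OF _ weyl_elt_xx])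
  show "op (Gd i) (op (Gd j) x) = op (Gd j) (op (Gd i) x)"
    by (rule T_ext[OF _ _ x])
       (auto intro!: add_maps simp: opd_el additive_map_plus[OF opd_additive] T.a_ac
         M.sm_commute[OF _ weyl_elt_dd[of i j]] N.sm_commute[OF _ weyl_elt_dd[of i j]])
  show "op (Gd i) (op (Gx j) x) = op (Gx j) (op (Gd i) x) \<oplus>\<^bsub>T\<^esub> (if i = j then x else \<zero>\<^bsub>T\<^esub>)"
  proof (rule T_ext[OF _ _ x])
    fix m n assume mn: "m \<in> carrier M" "n \<in> carrier N"
    have "weyl_elt (Gd i) \<odot>\<^bsub>M\<^esub> (weyl_elt (Gx j) \<odot>\<^bsub>M\<^esub> m) =
        weyl_elt (Gx j) \<odot>\<^bsub>M\<^esub> (weyl_elt (Gd i) \<odot>\<^bsub>M\<^esub> m) \<oplus>\<^bsub>M\<^esub> (if i = j then m else \<zero>\<^bsub>M\<^esub>)"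
      using mn by (simp add: weyl_elt_dx M.sm_add_left flip: M.sm_mult)
    with mn show "op (Gd i) (op (Gx j) (el m n)) =
        op (Gx j) (op (Gd i) (el m n)) \<oplus>\<^bsub>T\<^esub> (if i = j then el m n else \<zero>\<^bsub>T\<^esub>)"
      using el_zero_left[of n] by (simp add: opx_el opd_el el_add_l additive_map_plus[OF opx_additive] T.a_ac)
  next
    show "additive_map T T (\<lambda>z. op (Gx j) (op (Gd i) z) \<oplus>\<^bsub>T\<^esub> (if i = j then z else \<zero>\<^bsub>T\<^esub>))"
      by (intro add_maps) (simp add: additive_map_def)
  qed (intro add_maps)
  assume y: "y \<in> carrier T"
  show "scal c (x \<oplus>\<^bsub>T\<^esub> y) = scal c x \<oplus>\<^bsub>T\<^esub> scal c y"
    by (rule additive_map_plus[OF scal_additive x y])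
  show "op g (x \<oplus>\<^bsub>T\<^esub> y) = op g x \<oplus>\<^bsub>T\<^esub> op g y"
    by (rule additive_map_plus[OF op_additive x y])
qed

sublocale leib: weyl_action T scal op by (rule weyl_action_T)

lemma right_additive:
  assumes "additive_map N N F" "\<And>P n. n \<in> carrier N \<Longrightarrow> F (P \<odot>\<^bsub>N\<^esub> n) = P \<odot>\<^bsub>N\<^esub> F n"
  shows "additive_map T T (right F)"
  by (rule tensor_map_pure[where E = "\<lambda>m. m"]; simp add: assms additive_map_id)

lemma right_el:
  assumes "additive_map N N F" "\<And>P n. n \<in> carrier N \<Longrightarrow> F (P \<odot>\<^bsub>N\<^esub> n) = P \<odot>\<^bsub>N\<^esub> F n"
    and "m \<in> carrier M" "n \<in> carrier N"
  shows "right F (el m n) = el m (F n)"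
  by (rule tensor_map_pure[where E = "\<lambda>m. m"]; simp add: assms additive_map_id)

lemma right_scal:
  assumes F: "additive_map N N F" "\<And>P n. n \<in> carrier N \<Longrightarrow> F (P \<odot>\<^bsub>N\<^esub> n) = P \<odot>\<^bsub>N\<^esub> F n"
    and z: "z \<in> carrier T"
  shows "right F (scal c z) = scal c (right F z)"
  by (rule T_ext[OF _ _ z])
     (auto intro!: additive_map_comp[OF scal_additive right_additive[OF F]]
       additive_map_comp[OF right_additive[OF F] scal_additive] simp: scal_el right_el[OF F] additive_map_closed[OF F(1)])

lemma right_op:
  assumes F: "additive_map N N F" "\<And>P n. n \<in> carrier N \<Longrightarrow> F (P \<odot>\<^bsub>N\<^esub> n) = P \<odot>\<^bsub>N\<^esub> F n"
    and z: "z \<in> carrier T"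
  shows "right F (op g z) = op g (right F z)"
  by (rule T_ext[OF _ _ z]; cases g)
     (auto intro!: additive_map_comp[OF op_additive right_additive[OF F]]
       additive_map_comp[OF right_additive[OF F] op_additive] simp: opx_el opd_el right_el[OF F] F(2)
       additive_map_closed[OF F(1)] additive_map_plus[OF right_additive[OF F]])

end

section \<open>Derivations of a field of fractions\<close>

abbreviation fr :: "'a::idom \<Rightarrow> 'a fract" where "fr a \<equiv> Fract a 1"

lemma fr_zero: "fr 0 = 0" and fr_one: "fr 1 = 1"
  by (simp_all add: Zero_fract_def One_fract_def)

lemma fr_power: "fr a ^ n = fr (a ^ n)"
  by (induction n) (simp_all add: One_fract_def)

lemma fr_eq_iff: "fr a = fr b \<longleftrightarrow> a = b"
  by (simp add: eq_fract)

lemma fr_eq_zero_iff: "fr a = 0 \<longleftrightarrow> a = 0"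
  by (simp add: Zero_fract_def eq_fract)

definition derivation :: "('a::comm_ring_1 \<Rightarrow> 'a) \<Rightarrow> bool" where
  "derivation d \<longleftrightarrow> (\<forall>a b. d (a + b) = d a + d b) \<and> (\<forall>a b. d (a * b) = d a * b + a * d b)"

lemma derivation_add: "derivation d \<Longrightarrow> d (a + b) = d a + d b"
  and derivation_mult: "derivation d \<Longrightarrow> d (a * b) = d a * b + a * d b"
  by (auto simp: derivation_def)

lemma derivation_zero: "derivation d \<Longrightarrow> d 0 = 0"
  using derivation_add[of d 0 0] by simp

lemma derivation_one: "derivation d \<Longrightarrow> d 1 = 0"
  using derivation_mult[of d 1 1] by simp

lemma derivation_commutator:
  assumes "derivation d" "derivation e" shows "derivation (\<lambda>a. d (e a) - e (d a))"
  unfolding derivation_def using assms by (simp add: derivation_add derivation_mult algebra_simps)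

lemma derivation_mpoly: "derivation (mpoly_deriv i)"
  by (simp add: derivation_def mpoly_deriv_add mpoly_deriv_mult)

lemma derivation_pderiv: "derivation (pderiv :: 'a::idom poly \<Rightarrow> 'a poly)"
  by (simp add: derivation_def pderiv_add pderiv_mult algebra_simps)

lemma coeff_map_derivation: "derivation d \<Longrightarrow> Polynomial.coeff (map_poly d p) n = d (Polynomial.coeff p n)"
  by (simp add: coeff_map_poly derivation_zero)

lemma derivation_sum: "derivation d \<Longrightarrow> d (sum g A) = (\<Sum>i\<in>A. d (g i))"
  by (induction A rule: infinite_finite_induct) (simp_all add: derivation_zero derivation_add)

lemma derivation_map_poly: "derivation d \<Longrightarrow> derivation (map_poly d)"
  unfolding derivation_def[of "map_poly d"]
  by (auto intro!: poly_eqI simp: coeff_map_derivation derivation_add coeff_mult derivation_sum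
      derivation_mult sum.distrib)

lemma map_poly_derivation_pCons: "derivation d \<Longrightarrow> map_poly d (pCons a p) = pCons (d a) (map_poly d p)"
  by (rule poly_eqI) (simp add: coeff_map_derivation coeff_pCons split: nat.split)

lemma fract_deriv_divide:
  assumes "derivation d" "b \<noteq> 0"
  shows "fract_deriv d (fr a / fr b) = (fr (d a) * fr b - fr a * fr (d b)) / fr b ^ 2"
  using fract_deriv_Fract[of d b a] assms by (simp add: derivation_mult fr_power power2_eq_square)

lemma fract_deriv_fr: "derivation d \<Longrightarrow> fract_deriv d (fr a) = fr (d a)"
  using fract_deriv_divide[of d 1 a] by (simp add: derivation_one flip: Zero_fract_def One_fract_def)

lemma derivation_fract_deriv:
  fixes d :: "'a::idom \<Rightarrow> 'a"
  assumes d: "derivation d" shows "derivation (fract_deriv d)"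
  unfolding derivation_def
proof (intro conjI allI)
  fix p q :: "'a fract"
  obtain a b where p: "p = fr a / fr b" "b \<noteq> 0" by (cases p) simp
  obtain c e where q: "q = fr c / fr e" "e \<noteq> 0" by (cases q) simp
  have nz: "fr b \<noteq> 0" "fr e \<noteq> 0" using p q by (simp_all add: fr_eq_zero_iff)
  have sum: "p + q = fr (a * e + c * b) / fr (b * e)" and prod: "p * q = fr (a * c) / fr (b * e)"
    using p q by simp_all
  have be: "b * e \<noteq> 0" using p q by simp
  have fa: "fr (x + y) = fr x + fr y" "fr (x * y) = fr x * fr y" for x y :: 'a by simp_all
  show "fract_deriv d (p + q) = fract_deriv d p + fract_deriv d q"
    unfolding sum fract_deriv_divide[OF d be] unfolding p(1) q(1) fract_deriv_divide[OF d p(2)] fract_deriv_divide[OF d q(2)]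
    unfolding derivation_mult[OF d] derivation_add[OF d] fa
    using nz by (simp add: field_simps power2_eq_square del: add_fract mult_fract divide_fract)
  show "fract_deriv d (p * q) = fract_deriv d p * q + p * fract_deriv d q"
    unfolding prod fract_deriv_divide[OF d be] unfolding p(1) q(1) fract_deriv_divide[OF d p(2)] fract_deriv_divide[OF d q(2)]
    unfolding derivation_mult[OF d] derivation_add[OF d] fa
    using nz by (simp add: field_simps power2_eq_square del: add_fract mult_fract divide_fract)
qed

text \<open>
  Two derivations of the fraction field that agree on the ring are equal: if \<open>q b = a\<close> and \<open>D a = D b = 0\<close>, then
  \<open>(D q) b = 0\<close>. Applied to a commutator of derivations this avoids iterating the quotient rule.
\<close>

lemma derivation_fract_eq_zero:
  assumes D: "derivation D" and z: "\<And>a. D (fr a) = 0" shows "D q = 0"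
proof -
  obtain a b where q: "q = fr a / fr b" "b \<noteq> 0" by (cases q) simp
  have nz: "fr b \<noteq> 0" using q by (simp add: fr_eq_zero_iff)
  have "q * fr b = fr a" unfolding q(1) using nz by (simp del: divide_fract mult_fract)
  then have "D q * fr b + q * D (fr b) = D (fr a)" by (metis D derivation_mult)
  then show ?thesis using nz by (simp add: z)
qed

lemma fract_deriv_commute:
  assumes d: "derivation d" "derivation e" and c: "\<And>a. d (e a) = e (d a)"
  shows "fract_deriv d (fract_deriv e q) = fract_deriv e (fract_deriv d q)"
  using derivation_fract_eq_zero[OF derivation_commutator[OF derivation_fract_deriv[OF d(1)] derivation_fract_deriv[OF d(2)]], of q]
  by (simp add: fract_deriv_fr d c)


section \<open>Localizations\<close>

lemma fr_in_localization: "fr a \<in> localization g"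
  unfolding localization_def by (intro CollectI exI[of _ a] exI[of _ 0]) simp

lemma localization_zero: "0 \<in> localization g" and localization_one: "1 \<in> localization g"
  using fr_in_localization[of 0 g] fr_in_localization[of 1 g] by (simp_all add: fr_zero fr_one)

lemma localization_add:
  assumes "g \<noteq> 0" "p \<in> localization g" "q \<in> localization g" shows "p + q \<in> localization g"
proof -
  obtain a k b l where "p = Fract a (g ^ k)" "q = Fract b (g ^ l)"
    using assms by (auto simp: localization_def)
  then have "p + q = Fract (a * g ^ l + b * g ^ k) (g ^ (k + l))"
    using assms(1) by (simp add: power_add)
  then show ?thesis unfolding localization_def by blast
qed

lemma localization_mult:
  assumes "p \<in> localization g" "q \<in> localization g" shows "p * q \<in> localization g"
proof -
  obtain a k b l where "p = Fract a (g ^ k)" "q = Fract b (g ^ l)"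
    using assms by (auto simp: localization_def)
  then have "p * q = Fract (a * b) (g ^ (k + l))" by (simp add: power_add)
  then show ?thesis unfolding localization_def by blast
qed

lemma localization_uminus: "p \<in> localization g \<Longrightarrow> - p \<in> localization g"
  using localization_mult[OF fr_in_localization[of "- 1" g], of p]
  by (simp add: fr_one flip: minus_fract)

lemma localization_inverse: "Fract a (g ^ k) \<in> localization g"
  by (auto simp: localization_def)

lemma localization_fract_deriv:
  assumes "g \<noteq> 0" "derivation d" "p \<in> localization g" shows "fract_deriv d p \<in> localization g"
proof -
  obtain a k where p: "p = Fract a (g ^ k)" using assms by (auto simp: localization_def)
  have "fract_deriv d p = Fract (d a * g ^ k - a * d (g ^ k)) (g ^ (k * 2))"
    unfolding p power_mult using assms by (intro fract_deriv_Fract) (simp_all add: derivation_mult)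
  then show ?thesis unfolding localization_def by blast
qed

lemma additive_group_simps [simp]:
  "carrier (additive_group S) = S" "ring.add (additive_group S) = (+)" "ring.zero (additive_group S) = 0"
  by (simp_all add: additive_group_def ring_of_type_algebra_def)

lemma abelian_group_additive_group:
  assumes "0 \<in> S" "\<And>x y. x \<in> S \<Longrightarrow> y \<in> S \<Longrightarrow> x + y \<in> S" "\<And>x. x \<in> S \<Longrightarrow> - x \<in> S"
  shows "abelian_group (additive_group S)"
  by (rule abelian_groupI) (use assms in \<open>auto simp: add_ac intro!: bexI[of _ "- _"]\<close>)


section \<open>Quotient modules\<close>

locale type_submodule = type_module M for M :: "('r::ring_1, 'm) module" +
  fixes N :: "'m set"
  assumes sub_subset: "N \<subseteq> carrier M" and sub_zero: "\<zero>\<^bsub>M\<^esub> \<in> N"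
    and sub_add: "\<And>x y. x \<in> N \<Longrightarrow> y \<in> N \<Longrightarrow> x \<oplus>\<^bsub>M\<^esub> y \<in> N"
    and sub_smult: "\<And>a x. x \<in> N \<Longrightarrow> a \<odot>\<^bsub>M\<^esub> x \<in> N"
begin

abbreviation "Q \<equiv> quotient_module M N"
abbreviation "qcl x \<equiv> N +>\<^bsub>M\<^esub> x"

lemma sub_minus: "x \<in> N \<Longrightarrow> \<ominus>\<^bsub>M\<^esub> x \<in> N"
  using sub_smult[of x "- 1"] sub_subset sm_minus_left[of x 1] by auto

lemma abelian_subgroup_sub: "abelian_subgroup N M"
proof (rule abelian_subgroupI3)
  show "additive_subgroup N M"
    by (rule additive_subgroup.intro, rule M.add.subgroupI)
      (use sub_subset sub_zero sub_add sub_minus in \<open>auto simp: a_inv_def\<close>)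
qed (rule M.abelian_group_axioms)

lemma mem_qcl: "y \<in> qcl x \<longleftrightarrow> (\<exists>n\<in>N. y = n \<oplus>\<^bsub>M\<^esub> x)"
  by (auto simp: a_r_coset_def')

lemma qcl_self: "x \<in> carrier M \<Longrightarrow> x \<in> qcl x"
  unfolding mem_qcl by (rule bexI[of _ "\<zero>\<^bsub>M\<^esub>"]) (simp_all add: sub_zero)

lemma carrier_Q: "carrier Q = {qcl x | x. x \<in> carrier M}"
  by (auto simp: quotient_module_def A_RCOSETS_def')

lemma qcl_closed [simp]: "x \<in> carrier M \<Longrightarrow> qcl x \<in> carrier Q"
  by (auto simp: carrier_Q)

lemma zero_Q: "\<zero>\<^bsub>Q\<^esub> = qcl \<zero>\<^bsub>M\<^esub>"
  using sub_subset by (auto simp: quotient_module_def mem_qcl intro!: bexI)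

lemma qcl_add: "x \<in> carrier M \<Longrightarrow> y \<in> carrier M \<Longrightarrow> qcl x \<oplus>\<^bsub>Q\<^esub> qcl y = qcl (x \<oplus>\<^bsub>M\<^esub> y)"
  using abelian_subgroup.a_rcos_sum[OF abelian_subgroup_sub, of x y] by (simp add: quotient_module_def)

lemma qcl_cong: "n \<in> N \<Longrightarrow> x \<in> carrier M \<Longrightarrow> qcl (n \<oplus>\<^bsub>M\<^esub> x) = qcl x"
proof -
  assume n: "n \<in> N" and x: "x \<in> carrier M"
  then have nx: "n \<oplus>\<^bsub>M\<^esub> x \<in> qcl x" by (auto simp: mem_qcl)
  show ?thesis
    using M.a_repr_independence'[of "n \<oplus>\<^bsub>M\<^esub> x" N x] nx x abelian_subgroup_sub
    by (simp add: abelian_subgroup_def additive_subgroup_def a_r_coset_def)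
qed

lemma qcl_eq_zero: "n \<in> N \<Longrightarrow> qcl n = \<zero>\<^bsub>Q\<^esub>"
  using qcl_cong[of n "\<zero>\<^bsub>M\<^esub>"] sub_subset by (auto simp: zero_Q)

lemma qcl_smult:
  assumes "x \<in> carrier M" shows "a \<odot>\<^bsub>Q\<^esub> qcl x = qcl (a \<odot>\<^bsub>M\<^esub> x)"
proof -
  have *: "qcl (a \<odot>\<^bsub>M\<^esub> y) = qcl (a \<odot>\<^bsub>M\<^esub> x)" if y: "y \<in> qcl x" for y
  proof -
    obtain n where n: "n \<in> N" "y = n \<oplus>\<^bsub>M\<^esub> x" using y by (auto simp: mem_qcl)
    then have "a \<odot>\<^bsub>M\<^esub> y = a \<odot>\<^bsub>M\<^esub> n \<oplus>\<^bsub>M\<^esub> a \<odot>\<^bsub>M\<^esub> x" using assms sub_subset sm_add_right by auto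
    then show ?thesis using qcl_cong[OF sub_smult[OF n(1)]] assms by simp
  qed
  have "a \<odot>\<^bsub>Q\<^esub> qcl x = (\<Union>y\<in>qcl x. qcl (a \<odot>\<^bsub>M\<^esub> y))" by (simp add: quotient_module_def)
  also have "\<dots> = (\<Union>y\<in>qcl x. qcl (a \<odot>\<^bsub>M\<^esub> x))" by (rule SUP_cong[OF refl *])
  finally show ?thesis using qcl_self[OF assms] by blast
qed

lemma Q_cases: "C \<in> carrier Q \<Longrightarrow> (\<And>x. x \<in> carrier M \<Longrightarrow> C = qcl x \<Longrightarrow> thesis) \<Longrightarrow> thesis"
  by (auto simp: carrier_Q)

lemma abelian_group_Q: "abelian_group Q"
proof (rule abelian_groupI)
  fix C assume "C \<in> carrier Q"
  then obtain x where "x \<in> carrier M" "C = qcl x" by (rule Q_cases)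
  then show "\<exists>y\<in>carrier Q. y \<oplus>\<^bsub>Q\<^esub> C = \<zero>\<^bsub>Q\<^esub>"
    by (intro bexI[of _ "qcl (\<ominus>\<^bsub>M\<^esub> x)"]) (simp_all add: qcl_add zero_Q M.l_neg)
qed (auto elim!: Q_cases simp: qcl_add zero_Q M.a_ac)

lemma type_module_Q: "type_module Q"
  by (rule type_moduleI[OF abelian_group_Q])
    (auto elim!: Q_cases simp: qcl_add qcl_smult sm_add_left sm_add_right sm_mult)

end


section \<open>The module \<open>B\<^bsub>Z|Y\<^esub>\<close>\<close>

lemma t_minus_nonzero [simp]: "t_minus f \<noteq> 0"
  by (simp add: t_minus_def)

abbreviation loc_group :: "('n::linorder, 'k::field) mpoly \<Rightarrow> ('n, 'k) mpoly_t fract ring" where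
  "loc_group f \<equiv> additive_group (localization (t_minus f))"

lemma mpoly_deriv_zero: "mpoly_deriv i 0 = 0" and mpoly_deriv_one: "mpoly_deriv i 1 = 0"
  by (simp_all add: derivation_zero[OF derivation_mpoly] derivation_one[OF derivation_mpoly])

lemmas fract_deriv_rules =
  derivation_add[OF derivation_fract_deriv] derivation_mult[OF derivation_fract_deriv] fract_deriv_fr

lemma pderiv_map_poly_commute:
  "derivation d \<Longrightarrow> pderiv (map_poly d p) = map_poly d (pderiv p :: 'a::idom poly)"
proof (rule poly_eqI)
  fix n assume d: "derivation d"
  have "d (of_nat k * a) = of_nat k * d a" for k and a :: 'a
    by (induction k) (simp_all add: derivation_zero[OF d] derivation_add[OF d] distrib_right)
  from this[of "Suc n"] show "Polynomial.coeff (pderiv (map_poly d p)) n = Polynomial.coeff (map_poly d (pderiv p)) n"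
    by (simp add: coeff_pderiv coeff_map_derivation[OF d] derivation_mult[OF d] del: of_nat_Suc)
qed

lemma map_poly_mpoly_deriv_commute:
  "map_poly (mpoly_deriv i) (map_poly (mpoly_deriv j) p) = map_poly (mpoly_deriv j) (map_poly (mpoly_deriv i) p)"
  by (rule poly_eqI) (simp add: coeff_map_derivation[OF derivation_mpoly] mpoly_deriv_commute)

lemmas derivations = derivation_pderiv derivation_map_poly[OF derivation_mpoly] derivation_mpoly

lemma map_poly_deriv_const: "map_poly (mpoly_deriv i) [:a:] = [:mpoly_deriv i a:]"
  by (simp add: map_poly_derivation_pCons[OF derivation_mpoly])

lemma BZY_op_add: "BZY_op g (p + q) = BZY_op g p + BZY_op g q"
  by (cases "(g, p)" rule: BZY_op.cases)
    (simp_all add: distrib_left fract_deriv_rules derivations)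

lemma BZY_op_closed: "q \<in> localization (t_minus f) \<Longrightarrow> BZY_op g q \<in> localization (t_minus f)"
  by (cases "(g, q)" rule: BZY_op.cases)
    (simp_all add: localization_mult fr_in_localization localization_fract_deriv derivations)

lemma fr_const_mult:
  "fr [:mpoly_const (c * d):] = fr [:mpoly_const c:] * fr [:mpoly_const d :: ('n::linorder, 'k::field) mpoly:]"
  by (simp add: mpoly_const_mult mult.commute)

lemma weyl_action_loc_Y:
  fixes f :: "('n::linorder, 'k::field) mpoly"
  shows "weyl_action (loc_group f) (\<lambda>c q. fr [:mpoly_const c:] * q) BZY_op"
proof -
  interpret G: abelian_group "loc_group f"
    by (rule abelian_group_additive_group)
      (simp_all add: localization_zero localization_add localization_uminus)
  have const: "fr [:mpoly_const c:] * (x * q) = x * (fr [:mpoly_const c:] * q)" for c and x q :: "('n, 'k) mpoly_t fract"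
    by (simp add: mult.left_commute)
  have pos: "pderiv [:a:] = 0" for a :: "('n, 'k) mpoly" by (simp add: pderiv_pCons)
  show ?thesis
  proof
    show "BZY_op g (fr [:mpoly_const c:] * x) = fr [:mpoly_const c:] * BZY_op g x" for g c and x :: "('n, 'k) mpoly_t fract"
      by (cases "(g, x)" rule: BZY_op.cases)
        (simp_all add: fract_deriv_rules derivations map_poly_deriv_const mpoly_deriv_const pos fr_zero mult.left_commute del: mult_fract)
    show "BZY_op (Gx i) (BZY_op (Gx j) x) = BZY_op (Gx j) (BZY_op (Gx i) x)" for i j and x :: "('n, 'k) mpoly_t fract"
      by (cases i; cases j) (simp_all add: mult.left_commute)
    show "BZY_op (Gd i) (BZY_op (Gd j) x) = BZY_op (Gd j) (BZY_op (Gd i) x)" for i j and x :: "('n, 'k) mpoly_t fract"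
      by (cases i; cases j)
        (simp_all add: fract_deriv_commute derivations pderiv_map_poly_commute map_poly_mpoly_deriv_commute)
    show "BZY_op (Gd i) (BZY_op (Gx j) x) = BZY_op (Gx j) (BZY_op (Gd i) x) \<oplus>\<^bsub>loc_group f\<^esub> (if i = j then x else \<zero>\<^bsub>loc_group f\<^esub>)"
      for i j and x :: "('n, 'k) mpoly_t fract"
      by (cases i; cases j)
        (simp_all add: fract_deriv_rules derivations map_poly_deriv_const map_poly_derivation_pCons[OF derivation_mpoly]
          mpoly_deriv_var mpoly_deriv_zero mpoly_deriv_one derivation_one[OF derivation_map_poly[OF derivation_mpoly]] pderiv_pCons fr_zero fr_one one_pCons[symmetric] del: mult_fract)
    show "fr [:mpoly_const (c + d):] * x = fr [:mpoly_const c:] * x \<oplus>\<^bsub>loc_group f\<^esub> fr [:mpoly_const d:] * x"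
      for c d and x :: "('n, 'k) mpoly_t fract"
      by (simp add: mpoly_const_def single_add flip: distrib_right)
    show "fr [:mpoly_const 1:] * x = x" for x :: "('n, 'k) mpoly_t fract"
      by (simp add: mpoly_const_def fr_one one_pCons[symmetric])
    show "fr [:mpoly_const (c * d):] * x = fr [:mpoly_const c:] * (fr [:mpoly_const d:] * x)"
      for c d and x :: "('n, 'k) mpoly_t fract"
      by (simp only: fr_const_mult mult.assoc)
  qed (simp_all add: localization_mult fr_in_localization distrib_left BZY_op_closed BZY_op_add)
qed

lemma derivation_inverse_power:
  fixes x :: "'a::field"
  assumes "derivation D" "x \<noteq> 0"
  shows "D (inverse x ^ n) = - of_nat n * D x * inverse x ^ Suc n"
proof -
  have "D x * inverse x + x * D (inverse x) = 0"
    using derivation_mult[OF assms(1), of x "inverse x"] derivation_one[OF assms(1)] assms(2) by simp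
  then have "x * D (inverse x) = - D x * inverse x" by (simp add: add_eq_0_iff2)
  then have i: "D (inverse x) = - D x * inverse x * inverse x" using assms(2) by (simp add: field_simps)
  show ?thesis
    by (induction n) (simp_all add: derivation_one[OF assms(1)] derivation_mult[OF assms(1)] i algebra_simps)
qed

lemma shifted_inverse_power:
  fixes x :: "'a::field"
  assumes "x \<noteq> 0"
  shows "(a + x) * inverse x ^ Suc k = a * inverse x ^ Suc k + inverse x ^ k"
  using assms by (simp add: distrib_right)

locale bzy =
  fixes f :: "('n::{finite,linorder}, 'k::field_char_0) mpoly"
begin

sublocale loc: weyl_action "loc_group f" "\<lambda>c q. fr [:mpoly_const c:] * q" BZY_op
  by (rule weyl_action_loc_Y)

lemma loc_Y_eq: "loc_Y f = weyl_module (loc_group f) (\<lambda>c q. fr [:mpoly_const c:] * q) BZY_op"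
  by (simp add: loc_Y_def)

sublocale L: type_module "loc_Y f"
  unfolding loc_Y_eq by (rule loc.type_module_weyl_module)

abbreviation "LY \<equiv> localization (t_minus f)"

lemma L_simps [simp]: "carrier (loc_Y f) = LY" "ring.add (loc_Y f) = (+)" "ring.zero (loc_Y f) = 0"
  by (simp_all add: loc_Y_eq)

lemma L_const: "q \<in> LY \<Longrightarrow> weyl_const c \<odot>\<^bsub>loc_Y f\<^esub> q = fr [:mpoly_const c:] * q"
  unfolding loc_Y_eq by (rule loc.smult_const) simp

lemma L_elt: "q \<in> LY \<Longrightarrow> weyl_elt g \<odot>\<^bsub>loc_Y f\<^esub> q = BZY_op g q"
  unfolding loc_Y_eq by (rule loc.smult_elt) simp

lemma L_closed [simp]: "q \<in> LY \<Longrightarrow> P \<odot>\<^bsub>loc_Y f\<^esub> q \<in> LY"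
  using L.sm_closed[of q P] by simp

lemma L_add: "q \<in> LY \<Longrightarrow> (A + B) \<odot>\<^bsub>loc_Y f\<^esub> q = A \<odot>\<^bsub>loc_Y f\<^esub> q + B \<odot>\<^bsub>loc_Y f\<^esub> q"
  using L.sm_add_left[of q A B] by simp

lemma L_mult: "q \<in> LY \<Longrightarrow> (A * B) \<odot>\<^bsub>loc_Y f\<^esub> q = A \<odot>\<^bsub>loc_Y f\<^esub> (B \<odot>\<^bsub>loc_Y f\<^esub> q)"
  using L.sm_mult[of q A B] by simp

lemma L_poly: "q \<in> LY \<Longrightarrow> weyl_incl (weyl_of_mpoly a) \<odot>\<^bsub>loc_Y f\<^esub> q = fr [:a:] * q"
proof (induction a arbitrary: q rule: mpoly_induct)
  case (add a b)
  then show ?case by (simp add: weyl_of_mpoly_add weyl_incl_add L_add flip: distrib_right)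
next
  case (mult a b)
  have "fr [:b:] * q \<in> LY" using mult.prems by (simp add: localization_mult fr_in_localization)
  with mult show ?case
    by (simp add: weyl_of_mpoly_mult weyl_incl_mult L_mult mult.commute[of b] flip: mult.assoc)
qed (simp_all add: weyl_of_mpoly_const weyl_of_mpoly_var weyl_incl_const weyl_incl_elt L_const L_elt)

lemma BZY_op_poly_Y: "q \<in> poly_Y \<Longrightarrow> BZY_op g q \<in> (poly_Y :: ('n, 'k) mpoly_t fract set)"
  by (cases "(g, q)" rule: BZY_op.cases) (auto simp: poly_Y_def fract_deriv_fr derivations)

lemma poly_Y_subset: "poly_Y \<subseteq> LY"
  by (auto simp: poly_Y_def fr_in_localization)

sublocale B: type_submodule "loc_Y f" poly_Y
proof
  show "poly_Y \<subseteq> carrier (loc_Y f)" by (simp add: poly_Y_subset)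
  show "\<zero>\<^bsub>loc_Y f\<^esub> \<in> poly_Y" by (auto simp: poly_Y_def Zero_fract_def)
  show "x \<oplus>\<^bsub>loc_Y f\<^esub> y \<in> poly_Y" if "x \<in> poly_Y" "y \<in> poly_Y" for x y
    using that by (auto simp: poly_Y_def)
  show "P \<odot>\<^bsub>loc_Y f\<^esub> x \<in> poly_Y" if "x \<in> poly_Y" for P x
    using that
  proof (induction P arbitrary: x rule: weyl_induct)
    case (const c)
    then show ?case using poly_Y_subset by (auto simp: L_const poly_Y_def fr_in_localization)
  next
    case (elt g)
    then show ?case using poly_Y_subset BZY_op_poly_Y[of x g] by (simp add: L_elt subset_iff)
  next
    case (add A B)
    then have "A \<odot>\<^bsub>loc_Y f\<^esub> x \<in> poly_Y" "B \<odot>\<^bsub>loc_Y f\<^esub> x \<in> poly_Y" by auto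
    then show ?case using add.prems poly_Y_subset by (auto simp: L_add subset_iff) (auto simp: poly_Y_def)
  next
    case (mult A B)
    then show ?case using poly_Y_subset by (simp add: L_mult subset_iff)
  qed
qed

lemma BZY_eq: "BZY f = B.Q"
  by (simp add: BZY_def)

sublocale BY: type_module "BZY f"
  unfolding BZY_eq by (rule B.type_module_Q)

text \<open>The basis \<open>(t - f)\<^sup>-\<^sup>1\<^sup>-\<^sup>k\<close> of \<open>B\<^bsub>Z|Y\<^esub>\<close> over \<open>K[x]\<close>.\<close>

definition ipow :: "nat \<Rightarrow> ('n, 'k) mpoly_t fract" where
  "ipow k = inverse (fr (t_minus f)) ^ Suc k"

definition basis :: "nat \<Rightarrow> ('n, 'k) mpoly_t fract set" where
  "basis k = B.qcl (ipow k)"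

lemma ipow_Fract: "ipow k = Fract 1 (t_minus f ^ Suc k)"
proof -
  have "inverse (fr b) ^ n = Fract 1 (b ^ n)" for b :: "('n, 'k) mpoly_t" and n
    by (induction n) (simp_all add: One_fract_def)
  then show ?thesis unfolding ipow_def .
qed

lemma ipow_closed [simp]: "ipow k \<in> LY"
  unfolding ipow_Fract by (rule localization_inverse)

lemma basis_closed [simp]: "basis k \<in> carrier (BZY f)"
  unfolding basis_def BZY_eq by (rule B.qcl_closed) simp

lemma delta_eq: "delta f = basis 0"
  by (simp add: delta_def basis_def ipow_Fract)

lemma fr_nz: "fr (t_minus f) \<noteq> 0"
  by (simp add: fr_eq_zero_iff)

lemma BZY_smult: "q \<in> LY \<Longrightarrow> P \<odot>\<^bsub>BZY f\<^esub> B.qcl q = B.qcl (P \<odot>\<^bsub>loc_Y f\<^esub> q)"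
  unfolding BZY_eq by (rule B.qcl_smult) simp

lemma BZY_add: "p \<in> LY \<Longrightarrow> q \<in> LY \<Longrightarrow> B.qcl p \<oplus>\<^bsub>BZY f\<^esub> B.qcl q = B.qcl (p + q)"
  unfolding BZY_eq using B.qcl_add[of p q] by simp

lemma poly_basis: "weyl_incl (weyl_of_mpoly a) \<odot>\<^bsub>BZY f\<^esub> basis k = B.qcl (fr [:a:] * ipow k)"
  by (simp add: basis_def BZY_smult L_poly)

lemma t_split: "fr [:0, 1:] = fr [:f:] + fr (t_minus f)"
  by (simp add: t_minus_def)

text \<open>
  Write \<open>t = f + (t - f)\<close>; the second summand lowers the pole order by one, and on a simple pole it vanishes in the quotient.
\<close>

lemma t_basis_Suc:
  "weyl_t \<odot>\<^bsub>BZY f\<^esub> basis (Suc k) = weyl_incl (weyl_of_mpoly f) \<odot>\<^bsub>BZY f\<^esub> basis (Suc k) \<oplus>\<^bsub>BZY f\<^esub> basis k"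
proof -
  have "fr [:0, 1:] * ipow (Suc k) = fr [:f:] * ipow (Suc k) + ipow k"
    unfolding t_split ipow_def by (rule shifted_inverse_power[OF fr_nz])
  then show ?thesis
    unfolding poly_basis using BZY_add[of "fr [:f:] * ipow (Suc k)" "ipow k"]
    by (simp add: basis_def BZY_smult weyl_t_def L_elt localization_mult fr_in_localization)
qed

lemma t_basis_0: "weyl_t \<odot>\<^bsub>BZY f\<^esub> basis 0 = weyl_incl (weyl_of_mpoly f) \<odot>\<^bsub>BZY f\<^esub> basis 0"
proof -
  have one: "fr 1 \<in> poly_Y" by (simp add: poly_Y_def)
  have "fr [:0, 1:] * ipow 0 = fr 1 + fr [:f:] * ipow 0"
    unfolding t_split ipow_def shifted_inverse_power[OF fr_nz] by (simp only: power_0 fr_one add.commute)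
  then show ?thesis
    unfolding poly_basis using B.qcl_cong[OF one, of "fr [:f:] * ipow 0"]
    by (simp add: basis_def BZY_smult weyl_t_def L_elt localization_mult fr_in_localization)
qed

lemma fr_of_nat: "fr [:of_nat n:] = of_nat n" "fr (of_nat n) = of_nat n"
  by (simp_all add: of_nat_fract flip: of_nat_poly)

lemma dt_basis:
  "weyl_dt \<odot>\<^bsub>BZY f\<^esub> basis k = weyl_incl (weyl_of_mpoly (- of_nat (Suc k))) \<odot>\<^bsub>BZY f\<^esub> basis (Suc k)"
proof -
  have "fract_deriv pderiv (ipow k) = - of_nat (Suc k) * fr (pderiv (t_minus f)) * ipow (Suc k)"
    unfolding ipow_def
    by (simp only: derivation_inverse_power[OF derivation_fract_deriv[OF derivation_pderiv] fr_nz]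
        fract_deriv_fr[OF derivation_pderiv])
  also have "pderiv (t_minus f) = 1" by (simp add: t_minus_def pderiv_pCons)
  also have "- of_nat (Suc k) * fr 1 = fr [:- of_nat (Suc k):]"
    by (simp add: fr_of_nat(1)[symmetric] fr_one del: of_nat_Suc)
  finally have "fract_deriv pderiv (ipow k) = fr [:- of_nat (Suc k):] * ipow (Suc k)" .
  then show ?thesis
    unfolding poly_basis by (simp only: basis_def BZY_smult weyl_dt_def L_elt ipow_closed BZY_op.simps)
qed

lemma d_basis:
  "weyl_elt (Gd (Some i)) \<odot>\<^bsub>BZY f\<^esub> basis k =
     weyl_incl (weyl_of_mpoly (of_nat (Suc k) * mpoly_deriv i f)) \<odot>\<^bsub>BZY f\<^esub> basis (Suc k)"
proof -
  let ?d = "map_poly (mpoly_deriv i)"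
  have d: "derivation ?d" by (rule derivation_map_poly[OF derivation_mpoly])
  have "fract_deriv ?d (ipow k) = - of_nat (Suc k) * fr (?d (t_minus f)) * ipow (Suc k)"
    unfolding ipow_def
    by (simp only: derivation_inverse_power[OF derivation_fract_deriv[OF d] fr_nz] fract_deriv_fr[OF d])
  also have "?d (t_minus f) = [:- mpoly_deriv i f:]"
    using derivation_add[OF derivation_mpoly, of i f "- f"]
    by (simp add: t_minus_def map_poly_derivation_pCons[OF derivation_mpoly] mpoly_deriv_zero mpoly_deriv_one add_eq_0_iff)
  also have "- of_nat (Suc k) * fr [:- mpoly_deriv i f:] = fr [:of_nat (Suc k) * mpoly_deriv i f:]"
    by (simp add: fr_of_nat(1)[symmetric] mult.commute del: of_nat_Suc)
  finally show ?thesis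
    unfolding poly_basis by (simp only: basis_def BZY_smult L_elt ipow_closed BZY_op.simps)
qed

text \<open>
  Division of the numerator by \<open>t - f\<close>, with remainder its value at \<open>t = f\<close>, splits off the term of highest pole order.
\<close>

lemma BZY_induct [consumes 1, case_names zero add basis]:
  assumes "b \<in> carrier (BZY f)" and zero: "P \<zero>\<^bsub>BZY f\<^esub>"
    and add: "\<And>b c. b \<in> carrier (BZY f) \<Longrightarrow> c \<in> carrier (BZY f) \<Longrightarrow> P b \<Longrightarrow> P c \<Longrightarrow> P (b \<oplus>\<^bsub>BZY f\<^esub> c)"
    and basis: "\<And>a k. P (weyl_incl (weyl_of_mpoly a) \<odot>\<^bsub>BZY f\<^esub> basis k)"
  shows "P b"
proof -
  obtain a k where b: "b = B.qcl (Fract a (t_minus f ^ k))"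
    using assms(1) unfolding BZY_eq by (auto simp: B.carrier_Q localization_def)
  have "P (B.qcl (Fract a (t_minus f ^ k)))"
  proof (induction k arbitrary: a)
    case 0
    have "B.qcl (Fract a 1) = \<zero>\<^bsub>BZY f\<^esub>"
      unfolding BZY_eq by (rule B.qcl_eq_zero) (simp add: poly_Y_def)
    then show ?case using zero by simp
  next
    case (Suc k)
    define c where "c = synthetic_div a f"
    have a: "a = [:poly a f:] + t_minus f * c"
      using synthetic_div_correct'[of f a] by (simp add: c_def t_minus_def add.commute)
    have nz: "t_minus f ^ Suc k \<noteq> 0" "t_minus f ^ k \<noteq> 0" by simp_all
    have "Fract a (t_minus f ^ Suc k) = Fract [:poly a f:] (t_minus f ^ Suc k) + Fract (t_minus f * c) (t_minus f ^ Suc k)"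
      using nz(1) by (subst a) (simp add: eq_fract algebra_simps del: power_Suc)
    also have "Fract [:poly a f:] (t_minus f ^ Suc k) = fr [:poly a f:] * ipow k"
      by (simp add: ipow_Fract)
    also have "Fract (t_minus f * c) (t_minus f ^ Suc k) = Fract c (t_minus f ^ k)"
      by (simp add: eq_fract)
    finally have "B.qcl (Fract a (t_minus f ^ Suc k)) =
        weyl_incl (weyl_of_mpoly (poly a f)) \<odot>\<^bsub>BZY f\<^esub> basis k \<oplus>\<^bsub>BZY f\<^esub> B.qcl (Fract c (t_minus f ^ k))"
      unfolding poly_basis by (simp add: BZY_add localization_mult fr_in_localization localization_inverse)
    moreover have "B.qcl (Fract c (t_minus f ^ k)) \<in> carrier (BZY f)"
      unfolding BZY_eq by (rule B.qcl_closed) (simp add: localization_inverse)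
    ultimately show ?case using add[OF _ _ basis Suc] by simp
  qed
  then show ?thesis by (simp add: b)
qed

abbreviation "BX \<equiv> restrict_scalars weyl_incl (BZY f)"

lemma type_module_BX: "type_module BX"
  by (rule type_module_restrict_scalars[OF BY.type_module_axioms])
    (simp_all add: weyl_incl_add weyl_incl_mult weyl_incl_one)

lemma mpoly_BZY_eq: "mpoly_BZY f = restrict_scalars weyl_of_mpoly BX"
  by (simp add: restrict_scalars_def)

end

section \<open>The module \<open>K[x,f\<^sup>-\<^sup>1,s] f\<^sup>s\<close>\<close>

lemma derivation_inverse:
  fixes x :: "'a::field"
  assumes "derivation D" "x \<noteq> 0" "D x = t * x" shows "D (inverse x) = - t * inverse x"
  using derivation_inverse_power[OF assms(1,2), of 1] assms(2,3) by simp

lemma smult_binom_step: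
  fixes t c n :: "'a::comm_ring_1"
  shows "Polynomial.smult (- t * c) q + Polynomial.smult c (Polynomial.smult (- n * t) q) =
    Polynomial.smult (- (1 + n) * t) (Polynomial.smult c q)"
  by (simp add: algebra_simps flip: smult_add_left)

locale fs = bzy f for f :: "('n::{finite,linorder}, 'k::field_char_0) mpoly" +
  assumes f_nz: "f \<noteq> 0"
begin

abbreviation "LS \<equiv> {g :: ('n, 'k) mpoly fract poly. \<forall>k. Polynomial.coeff g k \<in> localization f}"
abbreviation "pd i \<equiv> map_poly (fract_deriv (mpoly_deriv i)) :: ('n, 'k) mpoly fract poly \<Rightarrow> _"
abbreviation "theta i \<equiv> Fract (mpoly_deriv i f) f"

lemma fr_f_nz: "fr f \<noteq> 0"
  using f_nz by (simp add: fr_eq_zero_iff)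

lemma derivation_D: "derivation (fract_deriv (mpoly_deriv i))"
  by (rule derivation_fract_deriv[OF derivation_mpoly])

lemma derivation_pd: "derivation (pd i)"
  by (rule derivation_map_poly[OF derivation_D])

lemma theta_closed: "theta i \<in> localization f"
  using localization_inverse[of "mpoly_deriv i f" f 1] by simp

lemma theta_eq: "theta i * fr f = fr (mpoly_deriv i f)"
  using f_nz by (simp add: eq_fract)

text \<open>
  \<open>theta i\<close> is the logarithmic derivative of \<open>f\<close>. The symmetry of second logarithmic derivatives is what makes the operators
  \<open>\<partial>\<^sub>i\<close> commute on multiples of \<open>f\<^sup>s\<close>.
\<close>

lemma theta_commute:
  "fract_deriv (mpoly_deriv i) (theta j) = fract_deriv (mpoly_deriv j) (theta i)"
proof -
  have "theta i = fr (mpoly_deriv i f) / fr f" for i by simp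
  then show ?thesis
    by (simp only: fract_deriv_divide[OF derivation_mpoly f_nz] mpoly_deriv_commute[of i j]
        mult.commute[of "fr (mpoly_deriv i f)"])
qed

lemma LS_add: "g \<in> LS \<Longrightarrow> h \<in> LS \<Longrightarrow> g + h \<in> LS"
  using f_nz by (simp add: localization_add)

lemma LS_smult: "c \<in> localization f \<Longrightarrow> g \<in> LS \<Longrightarrow> Polynomial.smult c g \<in> LS"
  by (simp add: localization_mult)

lemma LS_s: "g \<in> LS \<Longrightarrow> pCons 0 g \<in> LS"
  by (simp add: coeff_pCons localization_zero split: nat.split)

lemma LS_linear: "c \<in> localization f \<Longrightarrow> g \<in> LS \<Longrightarrow> [:c, 1:] * g \<in> LS"
  using LS_add[OF LS_smult LS_s, of c g g] by simp

lemma LS_op: "g \<in> LS \<Longrightarrow> fs_op f h g \<in> LS"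
proof (cases h)
  case (Gd i)
  assume g: "g \<in> LS"
  have "pd i g \<in> LS"
    using g f_nz by (simp add: coeff_map_derivation[OF derivation_D] localization_fract_deriv derivation_mpoly)
  moreover have "[:0, theta i:] * g \<in> LS"
    using LS_s[OF LS_smult[OF theta_closed g], of i] by simp
  ultimately show ?thesis unfolding Gd fs_op.simps by (rule LS_add)
qed (use LS_smult[OF fr_in_localization] in simp)

lemma pd_pCons: "pd i (pCons a g) = pCons (fract_deriv (mpoly_deriv i) a) (pd i g)"
  by (rule map_poly_derivation_pCons[OF derivation_D])

lemma D_commute:
  "fract_deriv (mpoly_deriv i) (fract_deriv (mpoly_deriv j) q) = fract_deriv (mpoly_deriv j) (fract_deriv (mpoly_deriv i) q)"
  by (rule fract_deriv_commute[OF derivation_mpoly derivation_mpoly]) (rule mpoly_deriv_commute)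

lemma pd_commute: "pd i (pd j g) = pd j (pd i g)"
proof (rule poly_eqI)
  fix n
  show "Polynomial.coeff (pd i (pd j g)) n = Polynomial.coeff (pd j (pd i g)) n"
    unfolding coeff_map_derivation[OF derivation_D] by (rule D_commute)
qed

lemma D_fr: "fract_deriv (mpoly_deriv i) (fr a) = fr (mpoly_deriv i a)"
  by (rule fract_deriv_fr[OF derivation_mpoly])

lemma pd_smult: "pd i (Polynomial.smult c g) =
  Polynomial.smult (fract_deriv (mpoly_deriv i) c) g + Polynomial.smult c (pd i g)"
  using derivation_mult[OF derivation_pd, of i "[:c:]" g] by (simp add: pd_pCons)

lemma fs_op_Gd_smult:
  "fs_op f (Gd i) (Polynomial.smult (fr a) g) =
     Polynomial.smult (fr (mpoly_deriv i a)) g + Polynomial.smult (fr a) (fs_op f (Gd i) g)"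
  by (simp only: fs_op.simps pd_smult D_fr smult_add_right mult_smult_right add.assoc)

sublocale fsa: weyl_s_action "additive_group LS" "\<lambda>c g. Polynomial.smult (Fract (mpoly_const c) 1) g"
  "fs_op f" "\<lambda>g. [:0, 1:] * g"
proof -
  interpret G: abelian_group "additive_group LS"
    by (rule abelian_group_additive_group)
      (use f_nz in \<open>simp_all add: localization_zero localization_add localization_uminus\<close>)
  show "weyl_s_action (additive_group LS) (\<lambda>c g. Polynomial.smult (Fract (mpoly_const c) 1) g)
      (fs_op f) (\<lambda>g. [:0, 1:] * g)"
  proof
    fix x y :: "('n, 'k) mpoly fract poly" and c d :: 'k and g :: "'n weyl_gen" and i j
    show "Polynomial.smult (fr (mpoly_const (c + d))) x =
        Polynomial.smult (fr (mpoly_const c)) x \<oplus>\<^bsub>additive_group LS\<^esub> Polynomial.smult (fr (mpoly_const d)) x"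
      by (simp add: mpoly_const_def single_add flip: smult_add_left)
    show "Polynomial.smult (fr (mpoly_const (c * d))) x = Polynomial.smult (fr (mpoly_const c)) (Polynomial.smult (fr (mpoly_const d)) x)"
      by (simp add: mpoly_const_mult)
    show "Polynomial.smult (fr (mpoly_const 1)) x = x"
      by (simp add: mpoly_const_def fr_one)
    show "fs_op f g (x \<oplus>\<^bsub>additive_group LS\<^esub> y) = fs_op f g x \<oplus>\<^bsub>additive_group LS\<^esub> fs_op f g y"
      by (cases g) (simp_all add: smult_add_right derivation_add[OF derivation_pd])
    show "fs_op f g (Polynomial.smult (fr (mpoly_const c)) x) = Polynomial.smult (fr (mpoly_const c)) (fs_op f g x)"
    proof (cases g)
      case (Gd i) show ?thesis unfolding Gd fs_op_Gd_smult by (simp add: mpoly_deriv_const fr_zero)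
    qed (simp add: mult.commute)
    show "fs_op f (Gx i) (fs_op f (Gx j) x) = fs_op f (Gx j) (fs_op f (Gx i) x)"
      by (simp only: fs_op.simps smult_smult mult.commute[of "fr (mpoly_var i)"])
    have pd: "pd i (pd j x) = pd j (pd i x)" by (rule pd_commute)
    have t: "pd i [:0, theta j:] = pd j [:0, theta i:]"
      by (simp add: pd_pCons theta_commute derivation_zero[OF derivation_D])
    have "fs_op f (Gd i) (fs_op f (Gd j) x) = pd i (pd j x) + pd i [:0, theta j:] * x
        + ([:0, theta j:] * pd i x + [:0, theta i:] * pd j x) + [:0, theta i:] * [:0, theta j:] * x"
      by (simp only: fs_op.simps derivation_add[OF derivation_pd] derivation_mult[OF derivation_pd] distrib_left add_ac mult.assoc)
    also have "\<dots> = pd j (pd i x) + pd j [:0, theta i:] * x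
        + ([:0, theta i:] * pd j x + [:0, theta j:] * pd i x) + [:0, theta j:] * [:0, theta i:] * x"
      unfolding pd t by (simp only: add.commute mult.commute[of "[:0, theta i:]" "[:0, theta j:]"])
    also have "\<dots> = fs_op f (Gd j) (fs_op f (Gd i) x)"
      by (simp only: fs_op.simps derivation_add[OF derivation_pd] derivation_mult[OF derivation_pd] distrib_left add_ac mult.assoc)
    finally show "fs_op f (Gd i) (fs_op f (Gd j) x) = fs_op f (Gd j) (fs_op f (Gd i) x)" .
    show "fs_op f (Gd i) (fs_op f (Gx j) x) = fs_op f (Gx j) (fs_op f (Gd i) x)
        \<oplus>\<^bsub>additive_group LS\<^esub> (if i = j then x else \<zero>\<^bsub>additive_group LS\<^esub>)"
      unfolding fs_op.simps(1) fs_op_Gd_smult mpoly_deriv_var by (simp add: fr_zero fr_one)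
    show "[:0, 1:] * Polynomial.smult (fr (mpoly_const c)) x = Polynomial.smult (fr (mpoly_const c)) ([:0, 1:] * x)"
      by simp
    have z: "fract_deriv (mpoly_deriv i) 0 = 0" for i by (rule derivation_zero[OF derivation_D])
    show "[:0, 1:] * fs_op f g x = fs_op f g ([:0, 1:] * x)"
      by (cases g) (simp_all add: pd_pCons z)
    assume x: "x \<in> carrier (additive_group LS)"
    then have x': "x \<in> LS" by simp
    show "fs_op f g x \<in> carrier (additive_group LS)"
      using LS_op[OF x'] by simp
    show "Polynomial.smult (fr (mpoly_const c)) x \<in> carrier (additive_group LS)"
      using LS_smult[OF fr_in_localization x'] by simp
    show "[:0, 1:] * x \<in> carrier (additive_group LS)" using LS_s[OF x'] by simp
  qed (simp_all add: smult_add_right distrib_left)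
qed

lemma fs_module_eq: "fs_module f = fsa.S"
  by (simp add: fs_module_def)

sublocale FS: type_module "fs_module f"
  unfolding fs_module_eq by (rule fsa.type_module_S)

lemma FS_simps [simp]: "carrier (fs_module f) = LS" "ring.add (fs_module f) = (+)" "ring.zero (fs_module f) = 0"
  unfolding fs_module_eq fsa.S_simps by simp_all

lemma FS_s: "g \<in> LS \<Longrightarrow> Poly_Mapping.single 1 1 \<odot>\<^bsub>fs_module f\<^esub> g = [:0, 1:] * g"
  unfolding fs_module_eq by (rule fsa.S_smult_s) simp

abbreviation "LX \<equiv> restrict_scalars (\<lambda>P. Poly_Mapping.single 0 P) (fs_module f)"

lemma type_module_LX: "type_module LX"
  by (rule type_module_restrict_scalars[OF FS.type_module_axioms])
    (simp_all add: single_add Poly_Mapping.mult_single)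

lemma mpoly_fs_eq: "mpoly_fs f = restrict_scalars weyl_of_mpoly LX"
  by (simp add: restrict_scalars_def)

sublocale LX: type_module LX by (rule type_module_LX)

lemma LX_const: "g \<in> LS \<Longrightarrow> Poly_Mapping.single 0 (weyl_const c) \<odot>\<^bsub>fs_module f\<^esub> g = Polynomial.smult (fr (mpoly_const c)) g"
  unfolding fs_module_eq by (rule trans[OF fsa.S_smult_single_zero fsa.smult_const]) simp_all

lemma LX_elt: "g \<in> LS \<Longrightarrow> Poly_Mapping.single 0 (weyl_elt h) \<odot>\<^bsub>fs_module f\<^esub> g = fs_op f h g"
  unfolding fs_module_eq by (rule trans[OF fsa.S_smult_single_zero fsa.smult_elt]) simp_all

lemma LX_add: "g \<in> LS \<Longrightarrow> Poly_Mapping.single 0 (A + B) \<odot>\<^bsub>fs_module f\<^esub> g =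
    Poly_Mapping.single 0 A \<odot>\<^bsub>fs_module f\<^esub> g + Poly_Mapping.single 0 B \<odot>\<^bsub>fs_module f\<^esub> g"
  using LX.sm_add_left[of g A B] by simp

lemma LX_mult: "g \<in> LS \<Longrightarrow> Poly_Mapping.single 0 (A * B) \<odot>\<^bsub>fs_module f\<^esub> g =
    Poly_Mapping.single 0 A \<odot>\<^bsub>fs_module f\<^esub> (Poly_Mapping.single 0 B \<odot>\<^bsub>fs_module f\<^esub> g)"
  using LX.sm_mult[of g A B] by simp

lemma LX_poly: "g \<in> LS \<Longrightarrow> Poly_Mapping.single 0 (weyl_of_mpoly a) \<odot>\<^bsub>fs_module f\<^esub> g = Polynomial.smult (fr a) g"
proof (induction a arbitrary: g rule: mpoly_induct)
  case (add a b)
  then show ?case by (simp add: weyl_of_mpoly_add LX_add flip: smult_add_left)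
next
  case (mult a b)
  have "Polynomial.smult (fr b) g \<in> LS" using mult.prems by (simp add: localization_mult fr_in_localization)
  with mult show ?case by (simp add: weyl_of_mpoly_mult LX_mult)
qed (simp_all add: weyl_of_mpoly_const weyl_of_mpoly_var LX_const LX_elt)


section \<open>Comparing \<open>B\<^bsub>Z|Y\<^esub>\<close> with \<open>K[x,f\<^sup>-\<^sup>1,s] f\<^sup>s\<close>\<close>

text \<open>
  \<open>binom_fs k\<close> is \<open>binom(s,k) f\<^sup>-\<^sup>k\<close>, the factor of \<open>f\<^sup>s (t - f)\<^sup>k\<close> in the binomial expansion of \<open>t\<^sup>s\<close> around \<open>t = f\<close>.
\<close>

fun binom_fs :: "nat \<Rightarrow> ('n, 'k) mpoly fract poly" where
  "binom_fs 0 = 1"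
| "binom_fs (Suc k) = Polynomial.smult (inverse (of_nat (Suc k) * fr f)) ([:- of_nat k, 1:] * binom_fs k)"

lemma of_nat_nz: "(of_nat (Suc k) :: ('n, 'k) mpoly fract) \<noteq> 0"
  unfolding of_nat_fract by (simp add: fr_eq_zero_iff del: of_nat_Suc)

lemma binom_fs_rec:
  "Polynomial.smult (of_nat (Suc k) * fr f) (binom_fs (Suc k)) = [:- of_nat k, 1:] * binom_fs k"
proof -
  have nz: "of_nat (Suc k) * fr f \<noteq> 0"
    using of_nat_nz[of k] fr_f_nz by (simp only: mult_eq_0_iff simp_thms)
  then show ?thesis by (simp only: binom_fs.simps smult_smult right_inverse[OF nz] smult_1_left)
qed

lemma inverse_of_nat: "inverse (of_nat (Suc k)) = fr (mpoly_const (inverse (of_nat (Suc k))) :: ('n, 'k) mpoly)"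
proof -
  have c: "mpoly_const (of_nat m) = (of_nat m :: ('n, 'k) mpoly)" for m
    by (simp only: mpoly_const_def single_of_nat)
  have "(of_nat (Suc k) :: ('n, 'k) mpoly) * mpoly_const (inverse (of_nat (Suc k))) =
      mpoly_const (of_nat (Suc k) * inverse (of_nat (Suc k)))"
    by (simp only: mpoly_const_mult c)
  also have "\<dots> = 1" by (simp add: mpoly_const_def del: of_nat_Suc)
  finally have "(of_nat (Suc k) :: ('n, 'k) mpoly) * mpoly_const (inverse (of_nat (Suc k))) = 1" .
  then have "of_nat (Suc k) * fr (mpoly_const (inverse (of_nat (Suc k))) :: ('n, 'k) mpoly) = 1"
    unfolding of_nat_fract by (simp add: fr_one del: of_nat_Suc)
  then show ?thesis by (rule inverse_unique)
qed

lemma inverse_f: "inverse (fr f) \<in> localization f"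
  using localization_inverse[of 1 f 1] by simp

lemma binom_fs_closed: "binom_fs k \<in> LS"
proof (induction k)
  case 0
  then show ?case by (simp add: localization_zero localization_one coeff_1 split: if_splits)
next
  case (Suc k)
  have "inverse (of_nat (Suc k) * fr f) \<in> localization f"
    unfolding inverse_mult_distrib inverse_of_nat
    by (rule localization_mult[OF fr_in_localization inverse_f])
  moreover have "- of_nat k \<in> localization f"
    unfolding of_nat_fract by (rule localization_uminus[OF fr_in_localization])
  ultimately show ?case unfolding binom_fs.simps by (intro LS_smult LS_linear Suc)
qed

lemma pd_binom_fs: "pd i (binom_fs k) = Polynomial.smult (- of_nat k * theta i) (binom_fs k)"
proof (induction k)
  case 0
  then show ?case by (simp add: derivation_one[OF derivation_pd])
next
  case (Suc k)
  let ?D = "fract_deriv (mpoly_deriv i)" and ?c = "of_nat (Suc k) * fr f"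
  have cnz: "?c \<noteq> 0" using of_nat_nz[of k] fr_f_nz by (simp del: of_nat_Suc)
  have dn: "?D (of_nat m) = 0" for m
    by (induction m) (simp_all add: derivation_zero[OF derivation_D] derivation_one[OF derivation_D] derivation_add[OF derivation_D])
  have dmn: "?D (- of_nat m) = 0" for m
    using derivation_add[OF derivation_D, of i "of_nat m" "- of_nat m"] by (simp add: dn derivation_zero[OF derivation_D])
  have "?D ?c = theta i * ?c"
    by (simp only: derivation_mult[OF derivation_D] dn D_fr theta_eq[symmetric] mult_zero_left add_0 add_0_right mult_ac)
  then have dc: "?D (inverse ?c) = - theta i * inverse ?c"
    by (rule derivation_inverse[OF derivation_D cnz])
  have "pd i [:- of_nat k, 1:] = 0"
    by (simp add: pd_pCons dmn derivation_one[OF derivation_D])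
  then have "pd i ([:- of_nat k, 1:] * binom_fs k) = Polynomial.smult (- of_nat k * theta i) ([:- of_nat k, 1:] * binom_fs k)"
    by (simp only: derivation_mult[OF derivation_pd] Suc mult_smult_right mult_zero_left add_0)
  then show ?case
    unfolding binom_fs.simps pd_smult dc by (simp only: smult_binom_step of_nat_Suc)
qed

text \<open>
  The same formula as for the action of \<open>\<partial>\<^sub>i\<close> on \<open>basis k\<close> in \<open>d_basis\<close>.
\<close>

lemma fs_op_binom_fs:
  "fs_op f (Gd i) (binom_fs k) = Polynomial.smult (fr (of_nat (Suc k) * mpoly_deriv i f)) (binom_fs (Suc k))"
proof -
  have "fs_op f (Gd i) (binom_fs k) = Polynomial.smult (theta i) ([:- of_nat k, 1:] * binom_fs k)"
    by (simp add: pd_binom_fs smult_diff_right mult.commute[of "theta i"] del: mult_fract)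
  also have "\<dots> = Polynomial.smult (theta i * fr f * of_nat (Suc k)) (binom_fs (Suc k))"
    unfolding binom_fs_rec[symmetric] by (simp only: smult_smult mult_ac)
  also have "theta i * fr f * of_nat (Suc k) = fr (of_nat (Suc k) * mpoly_deriv i f)"
    unfolding theta_eq by (simp add: of_nat_fract mult.commute del: of_nat_Suc)
  finally show ?thesis .
qed

lemma s_binom_fs:
  "[:0, 1:] * binom_fs k = Polynomial.smult (fr (of_nat (Suc k) * f)) (binom_fs (Suc k)) + Polynomial.smult (fr (of_nat k)) (binom_fs k)"
proof -
  have "fr (of_nat (Suc k) * f) = of_nat (Suc k) * fr f" by (simp add: of_nat_fract del: of_nat_Suc)
  then show ?thesis by (simp only: binom_fs_rec) (simp add: of_nat_fract[symmetric])
qed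

text \<open>
  \<open>binom_fs k\<close> has degree exactly \<open>k\<close> in \<open>s\<close>, with leading coefficient \<open>f\<^sup>-\<^sup>k / k!\<close>. This allows the terms of a
  combination of the \<open>binom_fs k\<close> to be recovered from the top.
\<close>

lemma coeff_binom_fs_above: "k < j \<Longrightarrow> Polynomial.coeff (binom_fs k) j = 0"
proof (induction k arbitrary: j)
  case 0 then show ?case by (simp add: coeff_1)
next
  case (Suc k)
  then obtain j' where "j = Suc j'" "k < j'" by (cases j) auto
  with Suc show ?case by (simp add: coeff_pCons)
qed

lemma coeff_binom_fs_top: "\<exists>c. c \<noteq> 0 \<and> Polynomial.coeff (binom_fs k) k = fr (mpoly_const c) * inverse (fr f) ^ k"
proof (induction k)
  case 0
  then show ?case by (intro exI[of _ 1]) (simp add: mpoly_const_def fr_one)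
next
  case (Suc k)
  then obtain c where c: "c \<noteq> 0" "Polynomial.coeff (binom_fs k) k = fr (mpoly_const c) * inverse (fr f) ^ k" by blast
  have "Polynomial.coeff (binom_fs (Suc k)) (Suc k) = inverse (of_nat (Suc k)) * inverse (fr f) * Polynomial.coeff (binom_fs k) k"
    by (simp add: coeff_binom_fs_above del: of_nat_Suc)
  also have "\<dots> = fr (mpoly_const (inverse (of_nat (Suc k)) * c)) * inverse (fr f) ^ Suc k"
  proof -
    have "fr (mpoly_const (inverse (of_nat (Suc k)) * c) :: ('n, 'k) mpoly) = inverse (of_nat (Suc k)) * fr (mpoly_const c)"
      by (simp add: inverse_of_nat mpoly_const_mult del: of_nat_Suc)
    then show ?thesis by (simp only: c(2) power_Suc mult_ac)
  qed
  finally show ?case using c(1) by (intro exI[of _ "inverse (of_nat (Suc k)) * c"]) (simp del: of_nat_Suc binom_fs.simps)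
qed

end

lemma fr_add: "fr (a + b) = fr a + fr b"
  by simp

context fs
begin

text \<open>Expand \<open>a\<close> in powers of \<open>t - f\<close> and replace \<open>(t - f)\<^sup>-\<^sup>1\<^sup>-\<^sup>j\<close> in \<open>a (t - f)\<^sup>-\<^sup>k\<close> by \<open>binom_fs j\<close>.\<close>

definition polar_part :: "nat \<Rightarrow> ('n, 'k) mpoly_t \<Rightarrow> ('n, 'k) mpoly fract poly" where
  "polar_part k a = (\<Sum>j<k. Polynomial.smult (fr (Polynomial.coeff (pcompose a [:f, 1:]) (k - Suc j))) (binom_fs j))"

lemma polar_part_add: "polar_part k (a + b) = polar_part k a + polar_part k b"
  by (simp only: polar_part_def pcompose_add Polynomial.coeff_add fr_add smult_add_left sum.distrib)

lemma polar_part_smult: "polar_part k (Polynomial.smult c a) = Polynomial.smult (fr c) (polar_part k a)"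
proof -
  have "Polynomial.smult x (sum g A) = (\<Sum>j\<in>A. Polynomial.smult x (g j))" for x and g :: "nat \<Rightarrow> ('n, 'k) mpoly fract poly" and A
    by (induction A rule: infinite_finite_induct) (simp_all add: smult_add_right)
  then show ?thesis by (simp add: polar_part_def pcompose_smult)
qed

lemma polar_part_Suc: "polar_part (Suc k) (a * t_minus f) = polar_part k a"
proof -
  have "pcompose (a * t_minus f) [:f, 1:] = pCons 0 (pcompose a [:f, 1:])"
  proof -
    have "pcompose (t_minus f) [:f, 1:] = [:0, 1:]" by (simp add: t_minus_def pcompose_pCons)
    then show ?thesis by (simp add: pcompose_mult)
  qed
  then show ?thesis
    by (simp add: polar_part_def fr_zero coeff_pCons Suc_diff_Suc split: nat.split)
      (rule sum.cong, auto simp: Suc_diff_Suc diff_Suc split: nat.split)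
qed

lemma polar_part_power: "polar_part (k + m) (a * t_minus f ^ m) = polar_part k a"
proof (induction m)
  case (Suc m)
  have "polar_part (k + Suc m) (a * t_minus f ^ Suc m) = polar_part (Suc (k + m)) (a * t_minus f ^ m * t_minus f)"
    by (simp add: mult_ac)
  then show ?case unfolding polar_part_Suc Suc .
qed simp

lemma polar_part_unique:
  assumes "Fract a (t_minus f ^ k) = Fract b (t_minus f ^ l)" shows "polar_part k a = polar_part l b"
proof -
  have "a * t_minus f ^ l = b * t_minus f ^ k" using assms by (simp add: eq_fract)
  then have "polar_part (k + l) (a * t_minus f ^ l) = polar_part (l + k) (b * t_minus f ^ k)"
    by (simp add: add.commute)
  then show ?thesis unfolding polar_part_power .
qed

text \<open>
  Enlarging numerator and denominator by a factor \<open>t - f\<close> shifts the expansion by one place, so \<open>polar_part\<close> depends only on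
  the fraction.
\<close>

definition polar :: "('n, 'k) mpoly_t fract \<Rightarrow> ('n, 'k) mpoly fract poly" where
  "polar q = (THE p. \<exists>a k. q = Fract a (t_minus f ^ k) \<and> p = polar_part k a)"

lemma polar_Fract: "polar (Fract a (t_minus f ^ k)) = polar_part k a"
  unfolding polar_def
proof (rule the_equality)
  show "\<exists>b l. Fract a (t_minus f ^ k) = Fract b (t_minus f ^ l) \<and> polar_part k a = polar_part l b"
    by (intro exI conjI) (rule refl)+
next
  fix p assume "\<exists>b l. Fract a (t_minus f ^ k) = Fract b (t_minus f ^ l) \<and> p = polar_part l b"
  then obtain b l where bl: "Fract a (t_minus f ^ k) = Fract b (t_minus f ^ l)" and p: "p = polar_part l b"
    by (elim exE conjE)
  show "p = polar_part k a" unfolding p by (rule polar_part_unique[OF bl, symmetric])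
qed

lemma polar_add: "p \<in> LY \<Longrightarrow> q \<in> LY \<Longrightarrow> polar (p + q) = polar p + polar q"
proof -
  assume "p \<in> LY" "q \<in> LY"
  then obtain a k b l where pq: "p = Fract a (t_minus f ^ k)" "q = Fract b (t_minus f ^ l)"
    by (auto simp: localization_def)
  have "p + q = Fract (a * t_minus f ^ l + b * t_minus f ^ k) (t_minus f ^ (k + l))"
    unfolding pq by (simp add: power_add)
  then have "polar (p + q) = polar_part (k + l) (a * t_minus f ^ l) + polar_part (l + k) (b * t_minus f ^ k)"
    by (simp add: polar_Fract polar_part_add add.commute)
  then show ?thesis unfolding pq polar_Fract polar_part_power .
qed

lemma polar_smult: "q \<in> LY \<Longrightarrow> polar (fr [:c:] * q) = Polynomial.smult (fr c) (polar q)"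
proof -
  assume "q \<in> LY"
  then obtain a k where q: "q = Fract a (t_minus f ^ k)" by (auto simp: localization_def)
  have "fr [:c:] * q = Fract (Polynomial.smult c a) (t_minus f ^ k)" unfolding q by simp
  then show ?thesis by (simp add: q polar_Fract polar_part_smult)
qed

lemma polar_poly_Y: "q \<in> poly_Y \<Longrightarrow> polar q = 0"
proof -
  assume "q \<in> poly_Y"
  then obtain a where "q = Fract a (t_minus f ^ 0)" by (auto simp: poly_Y_def)
  then show ?thesis by (simp only: polar_Fract) (simp add: polar_part_def)
qed

lemma polar_ipow: "polar (ipow k) = binom_fs k"
  unfolding ipow_Fract polar_Fract
  by (simp add: polar_part_def pcompose_1 coeff_1 fr_one fr_zero)

lemma polar_closed: "q \<in> LY \<Longrightarrow> polar q \<in> LS"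
proof -
  assume "q \<in> LY"
  then obtain a k where q: "q = Fract a (t_minus f ^ k)" by (auto simp: localization_def)
  have zero: "(0 :: ('n, 'k) mpoly fract poly) \<in> LS" by (simp add: localization_zero)
  have sum: "sum g A \<in> LS" if "\<And>j. g j \<in> LS" for g :: "nat \<Rightarrow> _" and A
    by (induction A rule: infinite_finite_induct) (use LS_add[OF that] zero in \<open>simp_all only: sum.infinite sum.empty sum.insert not_False_eq_True\<close>)
  show ?thesis
    unfolding q polar_Fract polar_part_def
    by (intro sum LS_smult fr_in_localization binom_fs_closed)
qed

text \<open>
  The map \<open>B\<^bsub>Z|Y\<^esub> \<rightarrow> K[x,f\<^sup>-\<^sup>1,s] f\<^sup>s\<close>, an algebraic Mellin transform. Any element of a coset may be chosen, because
  polynomials have no polar part.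
\<close>

definition mellin :: "('n, 'k) mpoly_t fract set \<Rightarrow> ('n, 'k) mpoly fract poly" where
  "mellin C = polar (SOME q. q \<in> C)"

lemma mellin_qcl: "q \<in> LY \<Longrightarrow> mellin (B.qcl q) = polar q"
proof -
  assume q: "q \<in> LY"
  have "polar p = polar q" if "p \<in> B.qcl q" for p
    using that q poly_Y_subset unfolding B.mem_qcl by (auto simp: polar_add polar_poly_Y)
  moreover have "q \<in> B.qcl q" using B.qcl_self q by simp
  ultimately show ?thesis unfolding mellin_def by (metis (mono_tags, lifting) someI)
qed

lemma mellin_additive: "additive_map (BZY f) (fs_module f) mellin"
proof (rule additive_mapI)
  fix b c assume b: "b \<in> carrier (BZY f)"
  then obtain p where p: "p \<in> LY" "b = B.qcl p" unfolding BZY_eq by (auto simp: B.carrier_Q)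
  then show "mellin b \<in> carrier (fs_module f)" using polar_closed by (simp add: mellin_qcl)
  assume "c \<in> carrier (BZY f)"
  then obtain q where q: "q \<in> LY" "c = B.qcl q" unfolding BZY_eq by (auto simp: B.carrier_Q)
  have "p + q \<in> LY" using p q by (simp add: localization_add)
  then show "mellin (b \<oplus>\<^bsub>BZY f\<^esub> c) = mellin b \<oplus>\<^bsub>fs_module f\<^esub> mellin c"
    using p q by (simp add: BZY_add mellin_qcl polar_add)
qed

lemma mellin_closed: "b \<in> carrier (BZY f) \<Longrightarrow> mellin b \<in> LS"
  using additive_map_closed[OF mellin_additive, of b] by simp

lemma mellin_add: "b \<in> carrier (BZY f) \<Longrightarrow> c \<in> carrier (BZY f) \<Longrightarrow> mellin (b \<oplus>\<^bsub>BZY f\<^esub> c) = mellin b + mellin c"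
  using additive_map_plus[OF mellin_additive, of b c] by simp

lemma mellin_zero: "mellin \<zero>\<^bsub>BZY f\<^esub> = 0"
  using additive_map_zero[OF BY.M.abelian_group_axioms FS.M.abelian_group_axioms mellin_additive] by simp

lemma mellin_basis: "mellin (basis k) = binom_fs k"
  by (simp add: basis_def mellin_qcl polar_ipow)

lemma mellin_poly:
  "b \<in> carrier (BZY f) \<Longrightarrow> mellin (weyl_incl (weyl_of_mpoly a) \<odot>\<^bsub>BZY f\<^esub> b) = Polynomial.smult (fr a) (mellin b)"
proof -
  assume "b \<in> carrier (BZY f)"
  then obtain q where q: "q \<in> LY" "b = B.qcl q" unfolding BZY_eq by (auto simp: B.carrier_Q)
  then show ?thesis
    by (simp add: BZY_smult L_poly mellin_qcl polar_smult localization_mult fr_in_localization)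
qed

lemma BY_smult_add: "P \<odot>\<^bsub>BZY f\<^esub> (b \<oplus>\<^bsub>BZY f\<^esub> c) = P \<odot>\<^bsub>BZY f\<^esub> b \<oplus>\<^bsub>BZY f\<^esub> P \<odot>\<^bsub>BZY f\<^esub> c"
  if "b \<in> carrier (BZY f)" "c \<in> carrier (BZY f)"
  using BY.sm_add_right that .

lemma BY_poly_mult: "b \<in> carrier (BZY f) \<Longrightarrow>
   weyl_incl (weyl_of_mpoly p) \<odot>\<^bsub>BZY f\<^esub> (weyl_incl (weyl_of_mpoly q) \<odot>\<^bsub>BZY f\<^esub> b) =
   weyl_incl (weyl_of_mpoly (p * q)) \<odot>\<^bsub>BZY f\<^esub> b"
  by (simp add: weyl_of_mpoly_mult weyl_incl_mult BY.sm_mult)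

text \<open>
  Both sides are additive, and on a multiple \<open>a e\<^sub>k\<close> of a basis element they agree by \<open>d_basis\<close> and \<open>fs_op_binom_fs\<close>.
\<close>

lemma mellin_deriv:
  assumes "b \<in> carrier (BZY f)"
  shows "mellin (weyl_elt (Gd (Some i)) \<odot>\<^bsub>BZY f\<^esub> b) = fs_op f (Gd i) (mellin b)"
  using assms
proof (induction rule: BZY_induct)
  case zero
  have "fs_op f (Gd i) 0 = 0" by simp
  then show ?case by (simp only: BY.sm_zero_right mellin_zero)
next
  case (add b c)
  have "fs_op f (Gd i) (g + h) = fs_op f (Gd i) g + fs_op f (Gd i) h" for g h
    by (simp add: derivation_add[OF derivation_pd] smult_add_right)
  with add show ?case by (simp only: BY_smult_add mellin_add BY.sm_closed)
next
  case (basis a k)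
  let ?D = "weyl_elt (Gd (Some i)) :: ('n option, 'k) weyl" and ?i = "\<lambda>a. weyl_incl (weyl_of_mpoly a) :: ('n option, 'k) weyl"
  have "?D * ?i a = ?i a * ?D + ?i (mpoly_deriv i a)"
    using arg_cong[OF weyl_deriv_mpoly[of i a], of weyl_incl] by (simp add: weyl_incl_mult weyl_incl_add weyl_incl_elt)
  then have "?D \<odot>\<^bsub>BZY f\<^esub> (?i a \<odot>\<^bsub>BZY f\<^esub> basis k) =
      ?i a \<odot>\<^bsub>BZY f\<^esub> (?D \<odot>\<^bsub>BZY f\<^esub> basis k) \<oplus>\<^bsub>BZY f\<^esub> ?i (mpoly_deriv i a) \<odot>\<^bsub>BZY f\<^esub> basis k"
    by (simp add: BY.sm_add_left flip: BY.sm_mult)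
  then have "mellin (?D \<odot>\<^bsub>BZY f\<^esub> (?i a \<odot>\<^bsub>BZY f\<^esub> basis k)) =
      Polynomial.smult (fr a) (fs_op f (Gd i) (binom_fs k)) + Polynomial.smult (fr (mpoly_deriv i a)) (binom_fs k)"
    by (simp only: d_basis mellin_add BY.sm_closed basis_closed mellin_poly mellin_basis fs_op_binom_fs)
  then show ?case by (simp only: mellin_poly basis_closed mellin_basis fs_op_Gd_smult add.commute)
qed

lemma mellin_linear:
  "b \<in> carrier (BZY f) \<Longrightarrow> mellin (weyl_incl P \<odot>\<^bsub>BZY f\<^esub> b) = Poly_Mapping.single 0 P \<odot>\<^bsub>fs_module f\<^esub> mellin b"
proof (induction P arbitrary: b rule: weyl_induct)
  case (const c)
  then show ?case
    using mellin_poly[of b "mpoly_const c"] LX_poly[OF mellin_closed, of b "mpoly_const c"]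
    by (simp add: weyl_of_mpoly_const)
next
  case (elt g)
  show ?case
  proof (cases g)
    case (Gx i)
    then show ?thesis
      using mellin_poly[of b "mpoly_var i"] LX_poly[OF mellin_closed, of b "mpoly_var i"] elt
      by (simp add: weyl_of_mpoly_var)
  next
    case (Gd i)
    then show ?thesis using mellin_deriv[OF elt, of i] LX_elt[OF mellin_closed[OF elt], of "Gd i"] by (simp add: weyl_incl_elt)
  qed
next
  case (add A B)
  then show ?case by (simp only: weyl_incl_add BY.sm_add_left mellin_add BY.sm_closed LX_add[OF mellin_closed])
next
  case (mult A B)
  then show ?case by (simp only: weyl_incl_mult BY.sm_mult BY.sm_closed LX_mult[OF mellin_closed])
qed

text \<open>
  On the basis, \<open>-\<partial>\<^sub>t t e\<^sub>k = (k + 1) f e\<^sub>k\<^sub>+\<^sub>1 + k e\<^sub>k\<close>, while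
  \<open>s binom(s,k) = (k + 1) binom(s,k+1) + k binom(s,k)\<close>.
\<close>

lemma mellin_s:
  assumes "b \<in> carrier (BZY f)"
  shows "mellin (- (weyl_dt * weyl_t) \<odot>\<^bsub>BZY f\<^esub> b) = [:0, 1:] * mellin b"
  using assms
proof (induction rule: BZY_induct)
  case zero
  show ?case by (simp only: BY.sm_zero_right mellin_zero mult_zero_right)
next
  case (add b c)
  then show ?case by (simp only: BY_smult_add mellin_add BY.sm_closed distrib_left)
next
  case (basis a k)
  let ?i = "\<lambda>a. weyl_incl (weyl_of_mpoly a) :: ('n option, 'k) weyl"
  have m: "?i (- p) = - ?i p" for p
    using weyl_incl_add[of "weyl_of_mpoly p" "weyl_of_mpoly (- p)"]
    by (simp add: weyl_incl_zero eq_neg_iff_add_eq_0 add.commute flip: weyl_of_mpoly_add)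
  have neg: "\<ominus>\<^bsub>BZY f\<^esub> (?i p \<odot>\<^bsub>BZY f\<^esub> b) = ?i (- p) \<odot>\<^bsub>BZY f\<^esub> b" if "b \<in> carrier (BZY f)" for p b
    using that by (simp add: m BY.sm_minus_left)
  have dt: "weyl_dt \<odot>\<^bsub>BZY f\<^esub> (?i p \<odot>\<^bsub>BZY f\<^esub> basis j) = ?i (- of_nat (Suc j) * p) \<odot>\<^bsub>BZY f\<^esub> basis (Suc j)" for p j
  proof -
    have "weyl_dt \<odot>\<^bsub>BZY f\<^esub> (?i p \<odot>\<^bsub>BZY f\<^esub> basis j) = ?i p \<odot>\<^bsub>BZY f\<^esub> (weyl_dt \<odot>\<^bsub>BZY f\<^esub> basis j)"
      by (rule BY.sm_commute[OF basis_closed weyl_dt_incl])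
    then show ?thesis by (simp only: dt_basis BY_poly_mult basis_closed mult.commute)
  qed
  have s: "mellin (- (weyl_dt * weyl_t) \<odot>\<^bsub>BZY f\<^esub> basis k) = [:0, 1:] * binom_fs k"
  proof (cases k)
    case 0
    have "- (weyl_dt * weyl_t) \<odot>\<^bsub>BZY f\<^esub> basis k = ?i (of_nat (Suc k) * f) \<odot>\<^bsub>BZY f\<^esub> basis (Suc k)"
      unfolding 0 by (simp add: BY.sm_minus_left BY.sm_mult t_basis_0 dt neg del: of_nat_Suc)
    then show ?thesis
      unfolding s_binom_fs by (simp add: mellin_poly mellin_basis 0 fr_zero del: of_nat_Suc binom_fs.simps)
  next
    case (Suc j)
    have "- (weyl_dt * weyl_t) \<odot>\<^bsub>BZY f\<^esub> basis k =
        ?i (of_nat (Suc k) * f) \<odot>\<^bsub>BZY f\<^esub> basis (Suc k) \<oplus>\<^bsub>BZY f\<^esub> ?i (of_nat k) \<odot>\<^bsub>BZY f\<^esub> basis k"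
      unfolding Suc by (simp add: BY.sm_minus_left BY.sm_mult t_basis_Suc dt dt_basis BY_smult_add BY.M.minus_add neg del: of_nat_Suc)
    then show ?thesis
      unfolding s_binom_fs by (simp only: mellin_add BY.sm_closed mellin_poly mellin_basis basis_closed)
  qed
  have "- (weyl_dt * weyl_t) \<odot>\<^bsub>BZY f\<^esub> (?i a \<odot>\<^bsub>BZY f\<^esub> basis k) = ?i a \<odot>\<^bsub>BZY f\<^esub> (- (weyl_dt * weyl_t) \<odot>\<^bsub>BZY f\<^esub> basis k)"
    by (rule BY.sm_commute[OF basis_closed weyl_dt_t_incl])
  then show ?case
    by (simp only: mellin_poly BY.sm_closed basis_closed s mellin_basis mult_smult_right)
qed

end

lemma option_gen_cases [case_names t dt x d]:
  assumes "g = Gx None \<Longrightarrow> P" "g = Gd None \<Longrightarrow> P" "\<And>i. g = Gx (Some i) \<Longrightarrow> P" "\<And>i. g = Gd (Some i) \<Longrightarrow> P"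
  shows P
  using assms by (metis option.exhaust weyl_gen.exhaust)


locale bzy_tensor = fs f + M: type_module M
  for f :: "('n::{finite,linorder}, 'k::field_char_0) mpoly" and M :: "(('n, 'k) weyl, 'm) module"
begin

section \<open>The module \<open>M \<otimes> B\<^bsub>Z|Y\<^esub>\<close>\<close>

sublocale TB: leibniz_tensor M BX
  by (intro leibniz_tensor.intro M.type_module_axioms type_module_BX)

abbreviation "opY g \<equiv> tensor_map mpoly_ring (mpoly_M M) (mpoly_BZY f) (MB_gen M f g)"

lemma opY_t: "opY (Gx None) = TB.right (\<lambda>b. weyl_t \<odot>\<^bsub>BZY f\<^esub> b)"
proof -
  have "MB_gen M f (Gx None) = (\<lambda>(m, b). frag_of (m, weyl_t \<odot>\<^bsub>BZY f\<^esub> b))" by (simp add: fun_eq_iff)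
  then show ?thesis by (simp only: mpoly_BZY_eq)
qed

lemma opY_dt: "opY (Gd None) = TB.right (\<lambda>b. weyl_dt \<odot>\<^bsub>BZY f\<^esub> b)"
proof -
  have "MB_gen M f (Gd None) = (\<lambda>(m, b). frag_of (m, weyl_dt \<odot>\<^bsub>BZY f\<^esub> b))" by (simp add: fun_eq_iff)
  then show ?thesis by (simp only: mpoly_BZY_eq)
qed

lemma opY_x: "opY (Gx (Some i)) = TB.op (Gx i)"
proof -
  have "MB_gen M f (Gx (Some i)) = TB.leibniz_gen (Gx i)" by (simp add: fun_eq_iff)
  then show ?thesis by (simp only: mpoly_BZY_eq)
qed

lemma opY_d: "opY (Gd (Some i)) = TB.op (Gd i)"
proof -
  have "MB_gen M f (Gd (Some i)) = TB.leibniz_gen (Gd i)" by (simp add: fun_eq_iff weyl_incl_elt)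
  then show ?thesis by (simp only: mpoly_BZY_eq)
qed

lemma BX_additive: "additive_map BX BX (\<lambda>b. Q \<odot>\<^bsub>BZY f\<^esub> b)"
  by (rule additive_mapI) (simp_all add: BY.sm_add_right)

lemma t_BX: "b \<in> carrier BX \<Longrightarrow> weyl_t \<odot>\<^bsub>BZY f\<^esub> (P \<odot>\<^bsub>BX\<^esub> b) = P \<odot>\<^bsub>BX\<^esub> (weyl_t \<odot>\<^bsub>BZY f\<^esub> b)"
  using BY.sm_commute[OF _ weyl_t_incl] by simp

lemma dt_BX: "b \<in> carrier BX \<Longrightarrow> weyl_dt \<odot>\<^bsub>BZY f\<^esub> (P \<odot>\<^bsub>BX\<^esub> b) = P \<odot>\<^bsub>BX\<^esub> (weyl_dt \<odot>\<^bsub>BZY f\<^esub> b)"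
  using BY.sm_commute[OF _ weyl_dt_incl] by simp

lemmas right_t = TB.right_additive[OF BX_additive t_BX] TB.right_el[OF BX_additive t_BX]
  and right_dt = TB.right_additive[OF BX_additive dt_BX] TB.right_el[OF BX_additive dt_BX]

lemma opY_t_el: "m \<in> carrier M \<Longrightarrow> b \<in> carrier (BZY f) \<Longrightarrow> opY (Gx None) (TB.el m b) = TB.el m (weyl_t \<odot>\<^bsub>BZY f\<^esub> b)"
  unfolding opY_t by (rule right_t(2)) simp_all

lemma opY_dt_el: "m \<in> carrier M \<Longrightarrow> b \<in> carrier (BZY f) \<Longrightarrow> opY (Gd None) (TB.el m b) = TB.el m (weyl_dt \<odot>\<^bsub>BZY f\<^esub> b)"
  unfolding opY_dt by (rule right_dt(2)) simp_all

lemma weyl_action_MB: "weyl_action TB.T TB.scal opY"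
proof
  fix x y c d g i j
  assume x: "x \<in> carrier TB.T"
  note opY = opY_t opY_dt opY_x opY_d
  have add: "additive_map TB.T TB.T (opY g)" for g
    by (cases g rule: option_gen_cases) (simp_all only: opY right_t right_dt TB.op_additive)
  have cl: "opY g (opY h x) \<in> carrier TB.T" for g h
    by (rule additive_map_closed[OF additive_map_comp[OF add add] x])
  show "TB.scal c x \<in> carrier TB.T" by (rule additive_map_closed[OF TB.scal_additive x])
  show "opY g x \<in> carrier TB.T" by (rule additive_map_closed[OF add x])
  show "TB.scal (c + d) x = TB.scal c x \<oplus>\<^bsub>TB.T\<^esub> TB.scal d x" by (rule TB.leib.scal_plus[OF x])
  show "TB.scal (c * d) x = TB.scal c (TB.scal d x)" by (rule TB.leib.scal_times[OF x])
  show "TB.scal 1 x = x" by (rule TB.leib.scal_one[OF x])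
  show "opY g (TB.scal c x) = TB.scal c (opY g x)"
    by (cases g rule: option_gen_cases)
      (simp_all only: opY TB.leib.op_scal[OF x] TB.right_scal[OF BX_additive t_BX x] TB.right_scal[OF BX_additive dt_BX x])
  show "opY (Gx i) (opY (Gx j) x) = opY (Gx j) (opY (Gx i) x)"
    by (cases i; cases j) (simp_all only: opY TB.leib.op_xx[OF x] TB.right_op[OF BX_additive t_BX x])
  show "opY (Gd i) (opY (Gd j) x) = opY (Gd j) (opY (Gd i) x)"
    by (cases i; cases j) (simp_all only: opY TB.leib.op_dd[OF x] TB.right_op[OF BX_additive dt_BX x])
  show "opY (Gd i) (opY (Gx j) x) = opY (Gx j) (opY (Gd i) x) \<oplus>\<^bsub>TB.T\<^esub> (if i = j then x else \<zero>\<^bsub>TB.T\<^esub>)"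
  proof (cases i; cases j)
    assume ij: "i = None" "j = None"
    have "opY (Gd None) (opY (Gx None) x) = opY (Gx None) (opY (Gd None) x) \<oplus>\<^bsub>TB.T\<^esub> x"
    proof (rule TB.T_ext[OF _ _ x])
      show "additive_map TB.T TB.T (\<lambda>z. opY (Gd None) (opY (Gx None) z))"
        by (rule additive_map_comp[OF add add])
      show "additive_map TB.T TB.T (\<lambda>z. opY (Gx None) (opY (Gd None) z) \<oplus>\<^bsub>TB.T\<^esub> z)"
        by (rule additive_map_add[OF TB.abelian_group_T additive_map_comp[OF add add] additive_map_id])
      fix m b assume m: "m \<in> carrier M" and b: "b \<in> carrier BX"
      have b': "b \<in> carrier (BZY f)" using b by simp
      have "weyl_dt \<odot>\<^bsub>BZY f\<^esub> (weyl_t \<odot>\<^bsub>BZY f\<^esub> b) = weyl_t \<odot>\<^bsub>BZY f\<^esub> (weyl_dt \<odot>\<^bsub>BZY f\<^esub> b) \<oplus>\<^bsub>BZY f\<^esub> b"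
        using b' by (simp add: weyl_dt_t BY.sm_add_left flip: BY.sm_mult)
      then show "opY (Gd None) (opY (Gx None) (TB.el m b)) = opY (Gx None) (opY (Gd None) (TB.el m b)) \<oplus>\<^bsub>TB.T\<^esub> TB.el m b"
        using m b' TB.el_add_r[of m "weyl_t \<odot>\<^bsub>BZY f\<^esub> (weyl_dt \<odot>\<^bsub>BZY f\<^esub> b)" b] by (simp add: opY_t_el opY_dt_el)
    qed
    then show ?thesis by (simp add: ij)
  next
    fix b assume ij: "i = None" "j = Some b"
    have "opY (Gd None) (opY (Gx (Some b)) x) = opY (Gx (Some b)) (opY (Gd None) x)"
      by (simp only: opY TB.right_op[OF BX_additive dt_BX x])
    then show ?thesis using cl[of "Gx (Some b)" "Gd None"] by (simp add: ij)
  next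
    fix a assume ij: "i = Some a" "j = None"
    have "opY (Gd (Some a)) (opY (Gx None) x) = opY (Gx None) (opY (Gd (Some a)) x)"
      by (simp only: opY TB.right_op[OF BX_additive t_BX x])
    then show ?thesis using cl[of "Gx None" "Gd (Some a)"] by (simp add: ij)
  next
    fix a b assume ij: "i = Some a" "j = Some b"
    then show ?thesis using TB.leib.op_dx[OF x, of a b] by (simp only: opY option.inject)
  qed
  assume y: "y \<in> carrier TB.T"
  show "TB.scal c (x \<oplus>\<^bsub>TB.T\<^esub> y) = TB.scal c x \<oplus>\<^bsub>TB.T\<^esub> TB.scal c y"
    by (rule additive_map_plus[OF TB.scal_additive x y])
  show "opY g (x \<oplus>\<^bsub>TB.T\<^esub> y) = opY g x \<oplus>\<^bsub>TB.T\<^esub> opY g y"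
    by (rule additive_map_plus[OF add x y])
qed

sublocale MBa: weyl_action TB.T TB.scal opY by (rule weyl_action_MB)

lemma MB_eq: "MB M f = weyl_module TB.T TB.scal opY"
  by (simp only: MB_def mpoly_BZY_eq)

sublocale MB: type_module "MB M f"
  unfolding MB_eq by (rule MBa.type_module_weyl_module)

lemma MB_simps [simp]: "carrier (MB M f) = carrier TB.T" "ring.add (MB M f) = ring.add TB.T" "ring.zero (MB M f) = ring.zero TB.T"
  unfolding MB_eq MBa.weyl_module_simps by (rule refl)+

lemma MB_elem_eq: "MB_elem M f m b = TB.el m b"
  by (simp only: MB_elem_def mpoly_BZY_eq)

lemma MB_elt: "z \<in> carrier TB.T \<Longrightarrow> weyl_elt g \<odot>\<^bsub>MB M f\<^esub> z = opY g z"
  unfolding MB_eq by (rule MBa.smult_elt)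

lemma MB_const: "z \<in> carrier TB.T \<Longrightarrow> weyl_const c \<odot>\<^bsub>MB M f\<^esub> z = TB.scal c z"
  unfolding MB_eq by (rule MBa.smult_const)

lemma MB_closed [simp]: "z \<in> carrier TB.T \<Longrightarrow> P \<odot>\<^bsub>MB M f\<^esub> z \<in> carrier TB.T"
  using MB.sm_closed[of z P] by simp

lemma MB_t_el: "m \<in> carrier M \<Longrightarrow> b \<in> carrier (BZY f) \<Longrightarrow> weyl_t \<odot>\<^bsub>MB M f\<^esub> TB.el m b = TB.el m (weyl_t \<odot>\<^bsub>BZY f\<^esub> b)"
  unfolding weyl_t_def using MB_elt[of "TB.el m b" "Gx None"] opY_t_el[of m b] by (simp add: weyl_t_def)

lemma MB_dt_el: "m \<in> carrier M \<Longrightarrow> b \<in> carrier (BZY f) \<Longrightarrow> weyl_dt \<odot>\<^bsub>MB M f\<^esub> TB.el m b = TB.el m (weyl_dt \<odot>\<^bsub>BZY f\<^esub> b)"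
  unfolding weyl_dt_def using MB_elt[of "TB.el m b" "Gd None"] opY_dt_el[of m b] by (simp add: weyl_dt_def)

lemma MB_poly_el: "m \<in> carrier M \<Longrightarrow> b \<in> carrier (BZY f) \<Longrightarrow>
   weyl_incl (weyl_of_mpoly a) \<odot>\<^bsub>MB M f\<^esub> TB.el m b = TB.el (weyl_of_mpoly a \<odot>\<^bsub>M\<^esub> m) b"
proof (induction a arbitrary: m rule: mpoly_induct)
  case (const c)
  then show ?case by (simp add: weyl_of_mpoly_const weyl_incl_const MB_const TB.scal_el)
next
  case (var i)
  then show ?case by (simp add: weyl_of_mpoly_var weyl_incl_elt MB_elt opY_x TB.opx_el)
next
  case (add p q)
  then show ?case using MB.sm_add_left[of "TB.el m b" "weyl_incl (weyl_of_mpoly p)" "weyl_incl (weyl_of_mpoly q)"]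
    by (simp add: weyl_of_mpoly_add weyl_incl_add M.sm_add_left TB.el_add_l)
next
  case (mult p q)
  then show ?case using MB.sm_mult[of "TB.el m b" "weyl_incl (weyl_of_mpoly p)" "weyl_incl (weyl_of_mpoly q)"]
    by (simp add: weyl_of_mpoly_mult weyl_incl_mult M.sm_mult)
qed

lemma MB_poly_el': "m \<in> carrier M \<Longrightarrow> b \<in> carrier (BZY f) \<Longrightarrow>
   weyl_incl (weyl_of_mpoly a) \<odot>\<^bsub>MB M f\<^esub> TB.el m b = TB.el m (weyl_incl (weyl_of_mpoly a) \<odot>\<^bsub>BZY f\<^esub> b)"
  using TB.el_poly[of m b a] by (simp add: MB_poly_el)


section \<open>The module \<open>M \<otimes> K[x,f\<^sup>-\<^sup>1,s] f\<^sup>s\<close>\<close>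

sublocale TL: leibniz_tensor M LX
  by (intro leibniz_tensor.intro M.type_module_axioms type_module_LX)

abbreviation "multiply_s \<equiv> TL.right (\<lambda>g. Poly_Mapping.single 1 1 \<odot>\<^bsub>fs_module f\<^esub> g)"

lemma LX_additive: "additive_map LX LX (\<lambda>g. Q \<odot>\<^bsub>fs_module f\<^esub> g)"
  by (rule additive_mapI) (simp_all only: restrict_scalars_simps FS.sm_add_right FS.sm_closed)

lemma s_LX: "g \<in> carrier LX \<Longrightarrow> Poly_Mapping.single 1 1 \<odot>\<^bsub>fs_module f\<^esub> (P \<odot>\<^bsub>LX\<^esub> g) =
    P \<odot>\<^bsub>LX\<^esub> (Poly_Mapping.single 1 1 \<odot>\<^bsub>fs_module f\<^esub> g)"
  unfolding restrict_scalars_simps by (rule FS.sm_commute) (simp_all add: Poly_Mapping.mult_single)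

lemmas right_s = TL.right_additive[OF LX_additive s_LX] TL.right_el[OF LX_additive s_LX]

sublocale MFa: weyl_s_action TL.T TL.scal TL.op multiply_s
proof unfold_locales
  fix x y c g assume x: "x \<in> carrier TL.T"
  show "multiply_s x \<in> carrier TL.T" by (rule additive_map_closed[OF right_s(1) x])
  show "multiply_s (TL.scal c x) = TL.scal c (multiply_s x)" by (rule TL.right_scal[OF LX_additive s_LX x])
  show "multiply_s (TL.op g x) = TL.op g (multiply_s x)" by (rule TL.right_op[OF LX_additive s_LX x])
  assume y: "y \<in> carrier TL.T"
  show "multiply_s (x \<oplus>\<^bsub>TL.T\<^esub> y) = multiply_s x \<oplus>\<^bsub>TL.T\<^esub> multiply_s y"
    by (rule additive_map_plus[OF right_s(1) x y])
qed

lemma MFs_eq: "MFs M f = MFa.S"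
proof -
  have "MFs_gen M f h = TL.leibniz_gen h" for h
    by (cases h) (simp_all add: fun_eq_iff)
  then show ?thesis by (simp only: MFs_def mpoly_fs_eq)
qed

sublocale MF: type_module "MFs M f"
  unfolding MFs_eq by (rule MFa.type_module_S)

lemma MF_simps [simp]: "carrier (MFs M f) = carrier TL.T" "ring.add (MFs M f) = ring.add TL.T" "ring.zero (MFs M f) = ring.zero TL.T"
  unfolding MFs_eq MFa.S_simps by (rule refl)+

lemma MFs_elem_eq: "MFs_elem M f m g = TL.el m g"
  by (simp only: MFs_elem_def mpoly_fs_eq)

lemma MF_elt: "z \<in> carrier TL.T \<Longrightarrow> Poly_Mapping.single 0 (weyl_elt g) \<odot>\<^bsub>MFs M f\<^esub> z = TL.op g z"
  unfolding MFs_eq by (rule trans[OF MFa.S_smult_single_zero TL.leib.smult_elt])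

lemma MF_const: "z \<in> carrier TL.T \<Longrightarrow> Poly_Mapping.single 0 (weyl_const c) \<odot>\<^bsub>MFs M f\<^esub> z = TL.scal c z"
  unfolding MFs_eq by (rule trans[OF MFa.S_smult_single_zero TL.leib.smult_const])

lemma MF_s: "z \<in> carrier TL.T \<Longrightarrow> Poly_Mapping.single 1 1 \<odot>\<^bsub>MFs M f\<^esub> z = multiply_s z"
  unfolding MFs_eq by (rule MFa.S_smult_s)

lemma MF_closed [simp]: "z \<in> carrier TL.T \<Longrightarrow> P \<odot>\<^bsub>MFs M f\<^esub> z \<in> carrier TL.T"
  using MF.sm_closed[of z P] by simp


section \<open>The comparison map\<close>

sublocale TBL: tensor_pairs mpoly_ring TB.PM TB.PN mpoly_ring TL.PM TL.PN ..

definition phi where "phi = TBL.lift (\<lambda>(m, b). frag_of (m, mellin b))"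

lemma mellin_carrier: "b \<in> carrier (BZY f) \<Longrightarrow> mellin b \<in> carrier (fs_module f)"
  by (rule additive_map_closed[OF mellin_additive])

lemma phi_additive: "additive_map TB.T TL.T phi"
  and phi_el: "m \<in> carrier M \<Longrightarrow> b \<in> carrier (BZY f) \<Longrightarrow> phi (TB.el m b) = TL.el m (mellin b)"
proof -
  have chain: "(\<lambda>(m, b). frag_of (m, mellin b)) (m, b) \<in> TL.chains"
    if "m \<in> carrier TB.PM" "b \<in> carrier TB.PN" for m b
    using that mellin_carrier by (simp del: FS_simps)
  have bal: "balanced_map mpoly_ring TB.PM TB.PN TL.T (\<lambda>p. TL.cl ((\<lambda>(m, b). frag_of (m, mellin b)) p))"
  proof (rule balanced_mapI)
    fix a m b assume "m \<in> carrier TB.PM" "b \<in> carrier TB.PN"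
    then have mb: "m \<in> carrier M" "b \<in> carrier (BZY f)" by simp_all
    have "mellin (weyl_incl (weyl_of_mpoly a) \<odot>\<^bsub>BZY f\<^esub> b) = weyl_of_mpoly a \<odot>\<^bsub>LX\<^esub> mellin b"
      using mellin_linear[OF mb(2), of "weyl_of_mpoly a"] by simp
    then show "TL.cl ((\<lambda>(m, b). frag_of (m, mellin b)) (a \<odot>\<^bsub>TB.PM\<^esub> m, b)) =
        TL.cl ((\<lambda>(m, b). frag_of (m, mellin b)) (m, a \<odot>\<^bsub>TB.PN\<^esub> b))"
      using TL.el_poly[of m "mellin b" a] mb mellin_carrier[of b] by (simp add: TL.cl_frag_of del: FS_simps)
  next
    fix m m' b assume "m \<in> carrier TB.PM" "m' \<in> carrier TB.PM" "b \<in> carrier TB.PN"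
    then show "TL.cl ((\<lambda>(m, b). frag_of (m, mellin b)) (m \<oplus>\<^bsub>TB.PM\<^esub> m', b)) =
        TL.cl ((\<lambda>(m, b). frag_of (m, mellin b)) (m, b)) \<oplus>\<^bsub>TL.T\<^esub> TL.cl ((\<lambda>(m, b). frag_of (m, mellin b)) (m', b))"
      using mellin_carrier[of b] by (simp add: TL.cl_frag_of TL.el_add_l del: FS_simps)
  next
    fix m b b' assume "m \<in> carrier TB.PM" "b \<in> carrier TB.PN" "b' \<in> carrier TB.PN"
    then show "TL.cl ((\<lambda>(m, b). frag_of (m, mellin b)) (m, b \<oplus>\<^bsub>TB.PN\<^esub> b')) =
        TL.cl ((\<lambda>(m, b). frag_of (m, mellin b)) (m, b)) \<oplus>\<^bsub>TL.T\<^esub> TL.cl ((\<lambda>(m, b). frag_of (m, mellin b)) (m, b'))"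
      using mellin_carrier[of b] mellin_carrier[of b'] additive_map_plus[OF mellin_additive, of b b']
        TL.el_add_r[of m "mellin b" "mellin b'"]
      by (simp add: TL.cl_frag_of del: FS_simps)
  qed (use chain in \<open>auto intro!: TL.cl_closed\<close>)
  show "additive_map TB.T TL.T phi"
    unfolding phi_def by (rule TBL.lift_additive[OF chain bal])
  show "phi (TB.el m b) = TL.el m (mellin b)" if "m \<in> carrier M" "b \<in> carrier (BZY f)"
    unfolding phi_def using TBL.lift_el[OF chain bal, of m b] that by (simp add: TL.cl_frag_of)
qed

lemma phi_closed [simp]: "z \<in> carrier TB.T \<Longrightarrow> phi z \<in> carrier TL.T"
  by (rule additive_map_closed[OF phi_additive])

lemma phi_ext:
  assumes "z \<in> carrier TB.T" "additive_map TB.T TB.T A" "additive_map TL.T TL.T C"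
    and "\<And>m b. m \<in> carrier M \<Longrightarrow> b \<in> carrier (BZY f) \<Longrightarrow> phi (A (TB.el m b)) = C (TL.el m (mellin b))"
  shows "phi (A z) = C (phi z)"
  by (rule TB.additive_map_eqI[OF assms(1) additive_map_comp[OF assms(2) phi_additive]
        additive_map_comp[OF phi_additive assms(3)] TL.abelian_group_T])
    (use assms(4) in \<open>simp add: phi_el\<close>)

lemma MB_additive: "additive_map TB.T TB.T (\<lambda>z. P \<odot>\<^bsub>MB M f\<^esub> z)"
  using MB.additive_sm[of P] by (simp add: additive_map_def)

lemma MF_additive: "additive_map TL.T TL.T (\<lambda>z. P \<odot>\<^bsub>MFs M f\<^esub> z)"
  using MF.additive_sm[of P] by (simp add: additive_map_def)

lemma phi_linear: "z \<in> carrier TB.T \<Longrightarrow> phi (weyl_incl P \<odot>\<^bsub>MB M f\<^esub> z) = Poly_Mapping.single 0 P \<odot>\<^bsub>MFs M f\<^esub> phi z"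
proof (induction P arbitrary: z rule: weyl_induct)
  case (const c)
  show ?case
  proof (rule phi_ext[OF const MB_additive MF_additive])
    fix m b assume mb: "m \<in> carrier M" "b \<in> carrier (BZY f)"
    then have "TL.el m (mellin b) \<in> carrier TL.T" using mellin_carrier by simp
    with mb show "phi (weyl_incl (weyl_const c) \<odot>\<^bsub>MB M f\<^esub> TB.el m b) =
        Poly_Mapping.single 0 (weyl_const c) \<odot>\<^bsub>MFs M f\<^esub> TL.el m (mellin b)"
      using mellin_carrier[OF mb(2)]
      by (simp add: weyl_incl_const MB_const MF_const TB.scal_el TL.scal_el phi_el del: FS_simps)
  qed
next
  case (elt g)
  show ?case
  proof (rule phi_ext[OF elt MB_additive MF_additive])
    fix m b assume mb: "m \<in> carrier M" "b \<in> carrier (BZY f)"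
    have c: "mellin b \<in> carrier (fs_module f)" by (rule mellin_carrier[OF mb(2)])
    then have cl: "TL.el m (mellin b) \<in> carrier TL.T" using mb by simp
    show "phi (weyl_incl (weyl_elt g) \<odot>\<^bsub>MB M f\<^esub> TB.el m b) =
        Poly_Mapping.single 0 (weyl_elt g) \<odot>\<^bsub>MFs M f\<^esub> TL.el m (mellin b)"
    proof (cases g)
      case (Gx i)
      with mb c cl show ?thesis
        by (simp add: weyl_incl_elt MB_elt MF_elt opY_x TB.opx_el TL.opx_el phi_el del: FS_simps)
    next
      case (Gd i)
      have "mellin (weyl_elt (Gd (Some i)) \<odot>\<^bsub>BZY f\<^esub> b) = Poly_Mapping.single 0 (weyl_elt (Gd i)) \<odot>\<^bsub>fs_module f\<^esub> mellin b"
        using mellin_linear[OF mb(2), of "weyl_elt (Gd i)"] by (simp add: weyl_incl_elt)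
      with Gd mb c cl show ?thesis
        by (simp add: weyl_incl_elt MB_elt MF_elt opY_d TB.opd_el TL.opd_el phi_el additive_map_plus[OF phi_additive] del: FS_simps)
    qed
  qed
next
  case (add A B)
  have "phi (weyl_incl (A + B) \<odot>\<^bsub>MB M f\<^esub> z) = phi (weyl_incl A \<odot>\<^bsub>MB M f\<^esub> z) \<oplus>\<^bsub>TL.T\<^esub> phi (weyl_incl B \<odot>\<^bsub>MB M f\<^esub> z)"
    using add.prems MB.sm_add_left[of z "weyl_incl A" "weyl_incl B"]
    by (simp add: weyl_incl_add additive_map_plus[OF phi_additive])
  then show ?case
    using add MF.sm_add_left[of "phi z" "Poly_Mapping.single 0 A" "Poly_Mapping.single 0 B"] by (simp add: single_add)
next
  case (mult A B)
  have "phi (weyl_incl (A * B) \<odot>\<^bsub>MB M f\<^esub> z) = phi (weyl_incl A \<odot>\<^bsub>MB M f\<^esub> (weyl_incl B \<odot>\<^bsub>MB M f\<^esub> z))"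
    using mult.prems MB.sm_mult[of z "weyl_incl A" "weyl_incl B"] by (simp add: weyl_incl_mult)
  then show ?case
    using mult MF.sm_mult[of "phi z" "Poly_Mapping.single 0 A" "Poly_Mapping.single 0 B"] by (simp add: Poly_Mapping.mult_single)
qed

lemma MB_minus: "z \<in> carrier TB.T \<Longrightarrow> \<ominus>\<^bsub>MB M f\<^esub> z = \<ominus>\<^bsub>TB.T\<^esub> z"
  using additive_map_minus[OF MB.M.abelian_group_axioms TB.abelian_group_T, of "\<lambda>z. z" z]
  by (simp add: additive_map_def)

lemma MB_s_el: "m \<in> carrier M \<Longrightarrow> b \<in> carrier (BZY f) \<Longrightarrow>
   - (weyl_dt * weyl_t) \<odot>\<^bsub>MB M f\<^esub> TB.el m b = TB.el m (- (weyl_dt * weyl_t) \<odot>\<^bsub>BZY f\<^esub> b)"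
proof -
  assume mb: "m \<in> carrier M" "b \<in> carrier (BZY f)"
  show "- (weyl_dt * weyl_t) \<odot>\<^bsub>MB M f\<^esub> TB.el m b = TB.el m (- (weyl_dt * weyl_t) \<odot>\<^bsub>BZY f\<^esub> b)"
  proof -
    have e: "(weyl_dt * weyl_t) \<odot>\<^bsub>MB M f\<^esub> TB.el m b = TB.el m ((weyl_dt * weyl_t) \<odot>\<^bsub>BZY f\<^esub> b)"
      using mb MB.sm_mult[of "TB.el m b" weyl_dt weyl_t] by (simp add: MB_t_el MB_dt_el BY.sm_mult)
    have "additive_map (BZY f) TB.T (TB.el m)" using TB.el_additive_right[of m] mb by (simp add: additive_map_def)
    from additive_map_minus[OF BY.M.abelian_group_axioms TB.abelian_group_T this]
    have "TB.el m (\<ominus>\<^bsub>BZY f\<^esub> ((weyl_dt * weyl_t) \<odot>\<^bsub>BZY f\<^esub> b)) = \<ominus>\<^bsub>TB.T\<^esub> TB.el m ((weyl_dt * weyl_t) \<odot>\<^bsub>BZY f\<^esub> b)"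
      using mb by simp
    moreover have "- (weyl_dt * weyl_t) \<odot>\<^bsub>MB M f\<^esub> TB.el m b = \<ominus>\<^bsub>TB.T\<^esub> ((weyl_dt * weyl_t) \<odot>\<^bsub>MB M f\<^esub> TB.el m b)"
      using mb MB.sm_minus_left[of "TB.el m b" "weyl_dt * weyl_t"] by (simp add: MB_minus)
    ultimately show ?thesis using mb e by (simp add: BY.sm_minus_left)
  qed
qed

lemma phi_s: "z \<in> carrier TB.T \<Longrightarrow> phi (- (weyl_dt * weyl_t) \<odot>\<^bsub>MB M f\<^esub> z) = Poly_Mapping.single 1 1 \<odot>\<^bsub>MFs M f\<^esub> phi z"
proof (rule phi_ext[OF _ MB_additive MF_additive])
  fix m b assume mb: "m \<in> carrier M" "b \<in> carrier (BZY f)"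
  have c: "mellin b \<in> carrier (fs_module f)" by (rule mellin_carrier[OF mb(2)])
  have "mellin (- (weyl_dt * weyl_t) \<odot>\<^bsub>BZY f\<^esub> b) = Poly_Mapping.single 1 1 \<odot>\<^bsub>fs_module f\<^esub> mellin b"
    using mellin_s[OF mb(2)] FS_s[OF mellin_closed[OF mb(2)]] by simp
  then have "phi (- (weyl_dt * weyl_t) \<odot>\<^bsub>MB M f\<^esub> TB.el m b) = TL.el m (Poly_Mapping.single 1 1 \<odot>\<^bsub>fs_module f\<^esub> mellin b)"
    using mb by (simp add: MB_s_el phi_el)
  also have "\<dots> = Poly_Mapping.single 1 1 \<odot>\<^bsub>MFs M f\<^esub> TL.el m (mellin b)"
  proof -
    have "TL.el m (mellin b) \<in> carrier TL.T" using mb c by simp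
    then show ?thesis unfolding MF_s using right_s(2)[of m "mellin b"] mb c by (simp add: MF_s del: FS_simps One_nat_def)
  qed
  finally show "phi (- (weyl_dt * weyl_t) \<odot>\<^bsub>MB M f\<^esub> TB.el m b) = Poly_Mapping.single 1 1 \<odot>\<^bsub>MFs M f\<^esub> TL.el m (mellin b)" .
qed

end

section \<open>The kernel of the comparison map\<close>

context bzy_tensor
begin

text \<open>
  \<open>numer K q\<close> is the polynomial \<open>f\<^sup>K q\<close>, if it is one. Multiplying by a large power of \<open>f\<close> and letting the resulting
  polynomial act on \<open>M\<close> takes the place of the map \<open>M \<otimes> K[x,f\<^sup>-\<^sup>1] \<rightarrow> M[f\<^sup>-\<^sup>1]\<close>:
  what is zero in the tensor product evaluates to zero for all large exponents.
\<close>

definition numer :: "nat \<Rightarrow> ('n, 'k) mpoly fract \<Rightarrow> ('n, 'k) mpoly" where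
  "numer K q = (if \<exists>a. fr f ^ K * q = fr a then THE a. fr f ^ K * q = fr a else 0)"

lemma numer_eq: "fr f ^ K * q = fr a \<Longrightarrow> numer K q = a"
  unfolding numer_def by (auto simp: fr_eq_iff)

lemma numer_zero: "numer K 0 = 0"
  by (rule numer_eq) (simp add: fr_zero)

lemma numer_exists:
  assumes "q \<in> localization f" shows "\<exists>K0. \<forall>K\<ge>K0. fr f ^ K * q = fr (numer K q)"
proof -
  obtain a k where q: "q = Fract a (f ^ k)" using assms by (auto simp: localization_def)
  have "fr f ^ K * q = fr (numer K q)" if "k \<le> K" for K
  proof -
    have "f ^ K = f ^ (K - k) * f ^ k" using that by (simp flip: power_add)
    then have "fr f ^ K * q = fr (f ^ (K - k) * a)"
      unfolding q fr_power using f_nz by (simp add: eq_fract)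
    with numer_eq[OF this] show ?thesis by simp
  qed
  then show ?thesis by blast
qed

definition leval :: "nat \<Rightarrow> nat \<Rightarrow> 'm \<times> ('n, 'k) mpoly fract poly \<Rightarrow> 'm" where
  "leval K j = (\<lambda>(m, g). weyl_of_mpoly (numer K (Polynomial.coeff g j)) \<odot>\<^bsub>M\<^esub> m)"

lemma ex_chain_eval:
  "\<exists>h. (\<forall>c\<in>TL.chains. h c \<in> carrier M) \<and> (\<forall>c\<in>TL.chains. \<forall>d\<in>TL.chains. h (c + d) = h c \<oplus>\<^bsub>M\<^esub> h d) \<and>
    (\<forall>m\<in>carrier M. \<forall>g\<in>LS. h (frag_of (m, g)) = leval K j (m, g))"
proof -
  have "leval K j ` (carrier TL.PM \<times> carrier TL.PN) \<subseteq> carrier (add_monoid M)"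
    by (auto simp: leval_def)
  then obtain h where h: "h \<in> hom (free_Abelian_group (carrier TL.PM \<times> carrier TL.PN)) (add_monoid M)"
    and g: "\<And>x. x \<in> carrier TL.PM \<times> carrier TL.PN \<Longrightarrow> h (frag_of x) = leval K j x"
    by (rule comm_group.free_Abelian_group_universal[OF M.M.a_comm_group]) blast
  show ?thesis
  proof (intro exI[of _ h] conjI ballI)
    show "h c \<in> carrier M" if "c \<in> TL.chains" for c
      using hom_in_carrier[OF h, of c] that by (simp add: tensor_free_def)
    show "h (c + d) = h c \<oplus>\<^bsub>M\<^esub> h d" if "c \<in> TL.chains" "d \<in> TL.chains" for c d
      using hom_mult[OF h, of c d] that by (simp add: tensor_free_def)
    show "h (frag_of (m, p)) = leval K j (m, p)" if "m \<in> carrier M" "p \<in> LS" for m p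
      using g[of "(m, p)"] that by simp
  qed
qed

text \<open>
  Evaluation makes sense only on formal sums, since the relations of the tensor product are respected only for large \<open>K\<close>;
  it exists by the universal property of the free abelian group. The index \<open>j\<close> selects the coefficient of \<open>s\<^sup>j\<close>.
\<close>

definition chain_eval where
  "chain_eval K j = (SOME h. (\<forall>c\<in>TL.chains. h c \<in> carrier M) \<and>
     (\<forall>c\<in>TL.chains. \<forall>d\<in>TL.chains. h (c + d) = h c \<oplus>\<^bsub>M\<^esub> h d) \<and>
     (\<forall>m\<in>carrier M. \<forall>g\<in>LS. h (frag_of (m, g)) = leval K j (m, g)))"

lemma chain_eval_closed: "c \<in> TL.chains \<Longrightarrow> chain_eval K j c \<in> carrier M"
  and chain_eval_add: "c \<in> TL.chains \<Longrightarrow> d \<in> TL.chains \<Longrightarrow> chain_eval K j (c + d) = chain_eval K j c \<oplus>\<^bsub>M\<^esub> chain_eval K j d"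
  and chain_eval_frag: "m \<in> carrier M \<Longrightarrow> g \<in> LS \<Longrightarrow> chain_eval K j (frag_of (m, g)) = leval K j (m, g)"
  using someI_ex[OF ex_chain_eval[of K j]] unfolding chain_eval_def by blast+

lemma chain_eval_zero: "chain_eval K j 0 = \<zero>\<^bsub>M\<^esub>"
  using chain_eval_add[of 0 0 K j] chain_eval_closed[of 0 K j] by (simp add: M.M.add.l_cancel_one')

lemma chain_eval_diff:
  assumes "c \<in> TL.chains" "d \<in> TL.chains" "chain_eval K j c = chain_eval K j d"
  shows "chain_eval K j (c - d) = \<zero>\<^bsub>M\<^esub>"
  using chain_eval_add[of "c - d" d K j] assms chain_eval_closed
  by (metis TL.chains_diff M.M.add.r_cancel_one' diff_add_cancel)

definition vanishing :: "nat \<Rightarrow> ('m \<times> ('n, 'k) mpoly fract poly \<Rightarrow>\<^sub>0 int) \<Rightarrow> bool" where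
  "vanishing j c \<longleftrightarrow> (\<exists>K0. \<forall>K\<ge>K0. chain_eval K j c = \<zero>\<^bsub>M\<^esub>)"

text \<open>
  Additivity and balancedness of \<open>leval K j\<close> in its second argument hold once \<open>f\<^sup>K\<close> clears all denominators of the
  polynomials involved, which is the case for all large \<open>K\<close>.
\<close>

lemma vanishing_relation:
  assumes "c \<in> tensor_relations mpoly_ring TL.PM TL.PN" shows "vanishing j c"
proof -
  consider (l) x x' y where "c = frag_of (x \<oplus>\<^bsub>M\<^esub> x', y) - (frag_of (x, y) + frag_of (x', y))"
      "x \<in> carrier M" "x' \<in> carrier M" "y \<in> LS"
    | (r) x y y' where "c = frag_of (x, y + y') - (frag_of (x, y) + frag_of (x, y'))"
      "x \<in> carrier M" "y \<in> LS" "y' \<in> LS"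
    | (s) a x y where "c = frag_of (weyl_of_mpoly a \<odot>\<^bsub>M\<^esub> x, y) - frag_of (x, Polynomial.smult (fr a) y)"
      "x \<in> carrier M" "y \<in> LS"
    using assms unfolding tensor_relations_def by (auto simp: diff_diff_eq LX_poly)
  then show ?thesis
  proof cases
    case l
    have "chain_eval K j c = \<zero>\<^bsub>M\<^esub>" for K
      unfolding l(1) using l(2-4)
      by (intro chain_eval_diff) (auto simp: chain_eval_add chain_eval_frag leval_def M.sm_add_right)
    then show ?thesis by (simp add: vanishing_def)
  next
    case r
    have yy: "y + y' \<in> LS" by (rule LS_add[OF r(3,4)])
    obtain K0 K1 where K: "\<forall>K\<ge>K0. fr f ^ K * Polynomial.coeff y j = fr (numer K (Polynomial.coeff y j))"
      "\<forall>K\<ge>K1. fr f ^ K * Polynomial.coeff y' j = fr (numer K (Polynomial.coeff y' j))"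
      using numer_exists[of "Polynomial.coeff y j"] numer_exists[of "Polynomial.coeff y' j"] r(3,4) by auto
    have "chain_eval K j c = \<zero>\<^bsub>M\<^esub>" if "max K0 K1 \<le> K" for K
    proof -
      have "numer K (Polynomial.coeff (y + y') j) = numer K (Polynomial.coeff y j) + numer K (Polynomial.coeff y' j)"
        by (rule numer_eq) (use K that in \<open>simp only: Polynomial.coeff_add distrib_left max.bounded_iff fr_add\<close>)
      then show ?thesis
        unfolding r(1) using r(2-4) yy
        by (intro chain_eval_diff)
          (auto simp: chain_eval_add chain_eval_frag leval_def weyl_of_mpoly_add M.sm_add_left)
    qed
    then show ?thesis unfolding vanishing_def by blast
  next
    case s
    have ay: "Polynomial.smult (fr a) y \<in> LS" by (rule LS_smult[OF fr_in_localization s(3)])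
    obtain K0 where K: "\<forall>K\<ge>K0. fr f ^ K * Polynomial.coeff y j = fr (numer K (Polynomial.coeff y j))"
      using numer_exists[of "Polynomial.coeff y j"] s(3) by auto
    have "chain_eval K j c = \<zero>\<^bsub>M\<^esub>" if "K0 \<le> K" for K
    proof -
      have "fr f ^ K * Polynomial.coeff (Polynomial.smult (fr a) y) j = fr a * (fr f ^ K * Polynomial.coeff y j)"
        by (simp only: Polynomial.coeff_smult mult.left_commute)
      also have "\<dots> = fr (a * numer K (Polynomial.coeff y j))" using K that by simp
      finally have "numer K (Polynomial.coeff (Polynomial.smult (fr a) y) j) = a * numer K (Polynomial.coeff y j)"
        by (rule numer_eq)
      then show ?thesis
        unfolding s(1) using s(2,3) ay
        by (intro chain_eval_diff)
          (auto simp: chain_eval_frag leval_def weyl_of_mpoly_mult M.sm_mult M.sm_commute[OF _ weyl_of_mpoly_commute[of _ a]])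
    qed
    then show ?thesis unfolding vanishing_def by blast
  qed
qed

lemma vanishing_null: "c \<in> tensor_null mpoly_ring TL.PM TL.PN \<Longrightarrow> vanishing j c"
  unfolding tensor_null_def
proof (induction rule: generate.induct)
  case one
  then show ?case by (simp add: vanishing_def chain_eval_zero)
next
  case (incl h)
  then show ?case by (rule vanishing_relation)
next
  case (inv h)
  then have h: "h \<in> TL.chains" "vanishing j h" using TL.relations_subset vanishing_relation by auto
  then have "vanishing j (0 - h)"
    unfolding vanishing_def using chain_eval_diff[of 0 h] by (fastforce simp: chain_eval_zero)
  then show ?case using h by simp
next
  case (eng c d)
  then have "c \<in> TL.chains" "d \<in> TL.chains" using TL.null_subset by (simp_all add: tensor_null_def)
  moreover obtain K0 K1 where "\<forall>K\<ge>K0. chain_eval K j c = \<zero>\<^bsub>M\<^esub>" "\<forall>K\<ge>K1. chain_eval K j d = \<zero>\<^bsub>M\<^esub>"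
    using eng by (auto simp: vanishing_def)
  ultimately have "\<forall>K\<ge>max K0 K1. chain_eval K j (c + d) = \<zero>\<^bsub>M\<^esub>" by (simp add: chain_eval_add)
  then show ?case unfolding vanishing_def TL.free_simps by (rule exI[of _ "max K0 K1"])
qed

text \<open>
  The filtration of \<open>M \<otimes> B\<^bsub>Z|Y\<^esub>\<close> by pole order along \<open>t = f\<close>. It is given inductively because every argument splits off
  the term of highest pole order.
\<close>

inductive fil :: "nat \<Rightarrow> ('m \<times> ('n, 'k) mpoly_t fract set \<Rightarrow>\<^sub>0 int) set \<Rightarrow> bool" where
  fil_0: "fil 0 \<zero>\<^bsub>TB.T\<^esub>"
| fil_Suc: "fil n w \<Longrightarrow> m \<in> carrier M \<Longrightarrow> fil (Suc n) (w \<oplus>\<^bsub>TB.T\<^esub> TB.el m (basis n))"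

inductive_cases fil_SucE: "fil (Suc n) w"
inductive_cases fil_0E: "fil 0 w"

lemma fil_0D: "fil 0 w \<Longrightarrow> w = \<zero>\<^bsub>TB.T\<^esub>"
  by (erule fil_0E)

lemma fil_closed: "fil n w \<Longrightarrow> w \<in> carrier TB.T"
  by (induction rule: fil.induct) simp_all

lemma el_zero_basis: "TB.el \<zero>\<^bsub>M\<^esub> (basis k) = \<zero>\<^bsub>TB.T\<^esub>"
  using TB.el_zero_left[of "basis k"] by simp

lemma fil_mono_Suc: "fil n w \<Longrightarrow> fil (Suc n) w"
  using fil_Suc[of n w "\<zero>\<^bsub>M\<^esub>"] fil_closed[of n w] by (simp add: el_zero_basis)

lemma fil_mono: "n \<le> k \<Longrightarrow> fil n w \<Longrightarrow> fil k w"
  by (induction k rule: dec_induct) (simp_all add: fil_mono_Suc)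

lemma fil_add: "fil n w \<Longrightarrow> fil n z \<Longrightarrow> fil n (w \<oplus>\<^bsub>TB.T\<^esub> z)"
proof (induction arbitrary: z rule: fil.induct)
  case fil_0
  then show ?case using fil_closed by (auto elim!: fil_0E intro: fil.fil_0)
next
  case (fil_Suc n w m)
  obtain z' m' where z: "z = z' \<oplus>\<^bsub>TB.T\<^esub> TB.el m' (basis n)" "fil n z'" "m' \<in> carrier M"
    using fil_Suc.prems by (rule fil_SucE)
  have c: "w \<in> carrier TB.T" "z' \<in> carrier TB.T" using fil_Suc.hyps z fil_closed by auto
  have "w \<oplus>\<^bsub>TB.T\<^esub> TB.el m (basis n) \<oplus>\<^bsub>TB.T\<^esub> z = (w \<oplus>\<^bsub>TB.T\<^esub> z') \<oplus>\<^bsub>TB.T\<^esub> TB.el (m \<oplus>\<^bsub>M\<^esub> m') (basis n)"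
    using c fil_Suc.hyps z(3) unfolding z(1) by (simp add: TB.el_add_l TB.T.a_ac)
  then show ?case
    using fil.fil_Suc[OF fil_Suc.IH[OF z(2)], of "m \<oplus>\<^bsub>M\<^esub> m'"] fil_Suc.hyps z(3) by simp
qed

lemma fil_poly: "fil n w \<Longrightarrow> fil n (weyl_incl (weyl_of_mpoly a) \<odot>\<^bsub>MB M f\<^esub> w)"
proof (induction rule: fil.induct)
  case fil_0
  then show ?case using MB.sm_zero_right fil.fil_0 by simp
next
  case (fil_Suc n w m)
  have "weyl_incl (weyl_of_mpoly a) \<odot>\<^bsub>MB M f\<^esub> (w \<oplus>\<^bsub>TB.T\<^esub> TB.el m (basis n)) =
      weyl_incl (weyl_of_mpoly a) \<odot>\<^bsub>MB M f\<^esub> w \<oplus>\<^bsub>TB.T\<^esub> TB.el (weyl_of_mpoly a \<odot>\<^bsub>M\<^esub> m) (basis n)"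
    using fil_Suc.hyps fil_closed[of n w] by (simp add: additive_map_plus[OF MB_additive] MB_poly_el)
  then show ?case using fil.fil_Suc[OF fil_Suc.IH] fil_Suc.hyps by simp
qed

lemma fil_exhaustive: "z \<in> carrier TB.T \<Longrightarrow> \<exists>n. fil n z"
proof (induction rule: TB.tensor_induct)
  case zero
  then show ?case using fil_0 by blast
next
  case (add z w)
  then obtain n k where "fil n z" "fil k w" by blast
  then have "fil (max n k) z" "fil (max n k) w" by (auto intro: fil_mono[rotated])
  then show ?case using fil_add by blast
next
  case (el m b)
  then have m: "m \<in> carrier M" and b: "b \<in> carrier (BZY f)" by simp_all
  from b show ?case
  proof (induction rule: BZY_induct)
    case zero
    then show ?case using TB.el_zero_right[of m] m fil_0 by auto
  next
    case (add b c)
    then obtain n k where "fil n (TB.el m b)" "fil k (TB.el m c)" by blast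
    then have "fil (max n k) (TB.el m b)" "fil (max n k) (TB.el m c)" by (auto intro: fil_mono[rotated])
    from fil_add[OF this] show ?case using TB.el_add_r[of m b c] m add by auto
  next
    case (basis a k)
    have "fil k \<zero>\<^bsub>TB.T\<^esub>" using fil_mono[OF _ fil_0] by simp
    from fil_Suc[OF this, of "weyl_of_mpoly a \<odot>\<^bsub>M\<^esub> m"] m
    have "fil (Suc k) (TB.el m (weyl_incl (weyl_of_mpoly a) \<odot>\<^bsub>BZY f\<^esub> basis k))"
      using TB.el_poly[of m "basis k" a] by simp
    then show ?case by blast
  qed
qed

lemma t_minus_f_fil:
  "fil n w \<Longrightarrow> \<exists>z. fil (n - 1) z \<and> weyl_t \<odot>\<^bsub>MB M f\<^esub> w = weyl_incl (weyl_of_mpoly f) \<odot>\<^bsub>MB M f\<^esub> w \<oplus>\<^bsub>TB.T\<^esub> z"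
proof (induction rule: fil.induct)
  case fil_0
  have "P \<odot>\<^bsub>MB M f\<^esub> \<zero>\<^bsub>TB.T\<^esub> = \<zero>\<^bsub>TB.T\<^esub>" for P using MB.sm_zero_right[of P] by simp
  then show ?case using fil.fil_0 by (intro exI[of _ "\<zero>\<^bsub>TB.T\<^esub>"]) simp
next
  case (fil_Suc n w m)
  obtain z where z: "fil (n - 1) z" "weyl_t \<odot>\<^bsub>MB M f\<^esub> w = weyl_incl (weyl_of_mpoly f) \<odot>\<^bsub>MB M f\<^esub> w \<oplus>\<^bsub>TB.T\<^esub> z"
    using fil_Suc.IH by blast
  have c: "w \<in> carrier TB.T" "z \<in> carrier TB.T" using fil_closed fil_Suc.hyps z by auto
  let ?f = "weyl_incl (weyl_of_mpoly f)"
  show ?case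
  proof (cases n)
    case 0
    have "weyl_t \<odot>\<^bsub>MB M f\<^esub> TB.el m (basis n) = ?f \<odot>\<^bsub>MB M f\<^esub> TB.el m (basis n)"
      using fil_Suc.hyps by (simp add: 0 MB_t_el t_basis_0 MB_poly_el')
    then have "weyl_t \<odot>\<^bsub>MB M f\<^esub> (w \<oplus>\<^bsub>TB.T\<^esub> TB.el m (basis n)) = ?f \<odot>\<^bsub>MB M f\<^esub> (w \<oplus>\<^bsub>TB.T\<^esub> TB.el m (basis n)) \<oplus>\<^bsub>TB.T\<^esub> z"
      using c fil_Suc.hyps by (simp add: additive_map_plus[OF MB_additive] z(2) TB.T.a_ac)
    then show ?thesis using z(1) 0 by auto
  next
    case (Suc k)
    have "weyl_t \<odot>\<^bsub>MB M f\<^esub> TB.el m (basis n) = ?f \<odot>\<^bsub>MB M f\<^esub> TB.el m (basis n) \<oplus>\<^bsub>TB.T\<^esub> TB.el m (basis k)"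
      using fil_Suc.hyps TB.el_add_r[of m "?f \<odot>\<^bsub>BZY f\<^esub> basis n" "basis k"]
      by (simp add: Suc MB_t_el t_basis_Suc MB_poly_el')
    then have "weyl_t \<odot>\<^bsub>MB M f\<^esub> (w \<oplus>\<^bsub>TB.T\<^esub> TB.el m (basis n)) =
        ?f \<odot>\<^bsub>MB M f\<^esub> (w \<oplus>\<^bsub>TB.T\<^esub> TB.el m (basis n)) \<oplus>\<^bsub>TB.T\<^esub> (z \<oplus>\<^bsub>TB.T\<^esub> TB.el m (basis k))"
      using c fil_Suc.hyps by (simp add: additive_map_plus[OF MB_additive] z(2) TB.T.a_ac)
    moreover have "fil (Suc n - 1) (z \<oplus>\<^bsub>TB.T\<^esub> TB.el m (basis k))"
      using fil.fil_Suc[of k z m] z(1) Suc fil_Suc.hyps by simp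
    ultimately show ?thesis by blast
  qed
qed

text \<open>
  As \<open>binom_fs k\<close> has degree \<open>k\<close>, pole order at most \<open>n\<close> leaves no room for powers \<open>s\<^sup>j\<close> with \<open>j \<ge> n\<close>. The
  claim is about a representing formal sum because evaluation is not defined on classes.
\<close>

lemma phi_fil:
  "fil n w \<Longrightarrow> \<exists>c\<in>TL.chains. phi w = TL.cl c \<and> (\<forall>j\<ge>n. \<forall>K. chain_eval K j c = \<zero>\<^bsub>M\<^esub>)"
proof (induction rule: fil.induct)
  case fil_0
  have "phi \<zero>\<^bsub>TB.T\<^esub> = TL.cl 0"
    using additive_map_zero[OF TB.abelian_group_T TL.abelian_group_T phi_additive] by (simp add: TL.zero_T)
  then show ?case by (intro bexI[of _ 0]) (simp_all add: chain_eval_zero)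
next
  case (fil_Suc n w m)
  then obtain c where c: "c \<in> TL.chains" "phi w = TL.cl c" "\<forall>j\<ge>n. \<forall>K. chain_eval K j c = \<zero>\<^bsub>M\<^esub>" by blast
  have g: "frag_of (m, binom_fs n) \<in> TL.chains" using fil_Suc.hyps binom_fs_closed[of n] by simp
  have "phi (w \<oplus>\<^bsub>TB.T\<^esub> TB.el m (basis n)) = TL.cl (c + frag_of (m, binom_fs n))"
    using fil_Suc.hyps fil_closed[of n w] c g
    by (simp add: additive_map_plus[OF phi_additive] phi_el mellin_basis TL.cl_add TL.cl_frag_of del: TL.chains_frag_of)
  moreover have "chain_eval K j (c + frag_of (m, binom_fs n)) = \<zero>\<^bsub>M\<^esub>" if "Suc n \<le> j" for K j
    using that c g fil_Suc.hyps binom_fs_closed[of n]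
    by (simp add: chain_eval_add chain_eval_frag leval_def coeff_binom_fs_above numer_zero del: TL.chains_frag_of)
  ultimately show ?case using c(1) g by (intro bexI[of _ "c + frag_of (m, binom_fs n)"]) auto
qed

text \<open>
  The coefficient of \<open>s\<^sup>n\<close> comes from \<open>m \<otimes> e\<^sub>n\<close> alone; up to a nonzero constant it is \<open>f\<^sup>-\<^sup>n m\<close>, and it vanishes after
  multiplication by a power of \<open>f\<close>.
\<close>

lemma top_coefficient_torsion:
  assumes "fil n w" "m \<in> carrier M" "phi (w \<oplus>\<^bsub>TB.T\<^esub> TB.el m (basis n)) = \<zero>\<^bsub>TL.T\<^esub>"
  shows "\<exists>A. weyl_of_mpoly (f ^ A) \<odot>\<^bsub>M\<^esub> m = \<zero>\<^bsub>M\<^esub>"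
proof -
  obtain c where c: "c \<in> TL.chains" "phi w = TL.cl c" "\<forall>j\<ge>n. \<forall>K. chain_eval K j c = \<zero>\<^bsub>M\<^esub>"
    using phi_fil[OF assms(1)] by blast
  have g: "frag_of (m, binom_fs n) \<in> TL.chains" using assms(2) binom_fs_closed[of n] by simp
  have "TL.cl (c + frag_of (m, binom_fs n)) = TL.cl 0"
    using assms fil_closed[of n w] c g
    by (simp add: additive_map_plus[OF phi_additive] phi_el mellin_basis TL.cl_add TL.cl_frag_of TL.zero_T del: TL.chains_frag_of)
  then have "c + frag_of (m, binom_fs n) \<in> tensor_null mpoly_ring TL.PM TL.PN"
    using TL.cl_eq_iff[of "c + frag_of (m, binom_fs n)" 0] c(1) g by simp
  then obtain K0 where K0: "\<forall>K\<ge>K0. chain_eval K n (c + frag_of (m, binom_fs n)) = \<zero>\<^bsub>M\<^esub>"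
    using vanishing_null[of _ n] unfolding vanishing_def by blast
  \<comment> \<open>the summand \<open>n\<close> clears the denominator \<open>f\<^sup>n\<close> of the leading coefficient\<close>
  define K where "K = K0 + n"
  obtain d where d: "d \<noteq> 0" "Polynomial.coeff (binom_fs n) n = fr (mpoly_const d) * inverse (fr f) ^ n"
    using coeff_binom_fs_top by blast
  have "fr f ^ K * (fr (mpoly_const d) * inverse (fr f) ^ n) = fr (mpoly_const d) * fr f ^ K0 * (fr f * inverse (fr f)) ^ n"
    by (simp only: K_def power_add power_mult_distrib mult_ac)
  also have "\<dots> = fr (mpoly_const d * f ^ K0)"
    by (simp only: right_inverse[OF fr_f_nz] power_one mult_1_right fr_power mult_fract)
  finally have "numer K (Polynomial.coeff (binom_fs n) n) = mpoly_const d * f ^ K0"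
    unfolding d(2) by (rule numer_eq)
  moreover have "chain_eval K n (c + frag_of (m, binom_fs n)) = leval K n (m, binom_fs n)"
    using c g assms(2) binom_fs_closed[of n]
    by (simp add: chain_eval_add chain_eval_frag leval_def del: TL.chains_frag_of)
  ultimately have "weyl_of_mpoly (mpoly_const d * f ^ K0) \<odot>\<^bsub>M\<^esub> m = \<zero>\<^bsub>M\<^esub>"
    using K0 by (simp add: leval_def K_def)
  then have "weyl_of_mpoly (mpoly_const (inverse d)) \<odot>\<^bsub>M\<^esub> (weyl_of_mpoly (mpoly_const d * f ^ K0) \<odot>\<^bsub>M\<^esub> m) = \<zero>\<^bsub>M\<^esub>"
    by simp
  then have "weyl_of_mpoly (mpoly_const (inverse d) * (mpoly_const d * f ^ K0)) \<odot>\<^bsub>M\<^esub> m = \<zero>\<^bsub>M\<^esub>"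
    using assms(2) by (simp add: weyl_of_mpoly_mult M.sm_mult)
  moreover have "mpoly_const (inverse d) * (mpoly_const d * f ^ K0) = f ^ K0"
    using d(1) by (simp add: mpoly_const_def flip: mult.assoc) (simp add: Poly_Mapping.mult_single)
  ultimately show ?thesis by auto
qed

lemma saturated_torsion_free:
  assumes "f_saturated M f" "m \<in> carrier M" "weyl_of_mpoly (f ^ A) \<odot>\<^bsub>M\<^esub> m = \<zero>\<^bsub>M\<^esub>" shows "m = \<zero>\<^bsub>M\<^esub>"
  using assms(2,3)
proof (induction A arbitrary: m)
  case (Suc A)
  have "weyl_of_mpoly (f ^ A) \<odot>\<^bsub>M\<^esub> (weyl_of_mpoly f \<odot>\<^bsub>M\<^esub> m) = \<zero>\<^bsub>M\<^esub>"
    using Suc.prems by (simp add: weyl_of_mpoly_mult M.sm_mult M.sm_commute[OF _ weyl_of_mpoly_commute[of "f ^ A"]])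
  then have "weyl_of_mpoly f \<odot>\<^bsub>M\<^esub> m = weyl_of_mpoly f \<odot>\<^bsub>M\<^esub> \<zero>\<^bsub>M\<^esub>" using Suc.IH Suc.prems by simp
  then show ?case using assms(1) Suc.prems unfolding f_saturated_def inj_on_def by blast
qed simp

abbreviation act_f where "act_f N w \<equiv> weyl_incl (weyl_of_mpoly (f ^ N)) \<odot>\<^bsub>MB M f\<^esub> w"

lemma act_f_act_f: "w \<in> carrier TB.T \<Longrightarrow> act_f N (act_f A w) = act_f (N + A) w"
  using MB.sm_mult[of w] by (simp add: power_add weyl_of_mpoly_mult weyl_incl_mult)

lemma MB_zero_right [simp]: "P \<odot>\<^bsub>MB M f\<^esub> \<zero>\<^bsub>TB.T\<^esub> = \<zero>\<^bsub>TB.T\<^esub>"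
  using MB.sm_zero_right[of P] by simp

lemma MF_zero_right [simp]: "P \<odot>\<^bsub>MFs M f\<^esub> \<zero>\<^bsub>TL.T\<^esub> = \<zero>\<^bsub>TL.T\<^esub>"
  using MF.sm_zero_right[of P] by simp

text \<open>
  Multiplying by the power of \<open>f\<close> that kills the top term lowers the pole order. On an \<open>f\<close>-saturated module the top term
  itself is zero.
\<close>

lemma phi_kernel:
  "fil n w \<Longrightarrow> phi w = \<zero>\<^bsub>TL.T\<^esub> \<Longrightarrow> (\<exists>N. act_f N w = \<zero>\<^bsub>TB.T\<^esub>) \<and> (f_saturated M f \<longrightarrow> w = \<zero>\<^bsub>TB.T\<^esub>)"
proof (induction n arbitrary: w)
  case 0
  then show ?case by (auto elim: fil_0E)
next
  case (Suc n)
  obtain z m where w: "w = z \<oplus>\<^bsub>TB.T\<^esub> TB.el m (basis n)" and z: "fil n z" and m: "m \<in> carrier M"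
    using Suc.prems(1) by (rule fil_SucE)
  have zc: "z \<in> carrier TB.T" using fil_closed[OF z] .
  obtain A where A: "weyl_of_mpoly (f ^ A) \<odot>\<^bsub>M\<^esub> m = \<zero>\<^bsub>M\<^esub>"
    using top_coefficient_torsion[OF z m] Suc.prems(2) w by blast
  have wc: "w \<in> carrier TB.T" using zc m w by simp
  have "act_f A w = act_f A z"
    using zc m A unfolding w by (simp add: additive_map_plus[OF MB_additive] MB_poly_el el_zero_basis)
  then have f1: "fil n (act_f A w)" using fil_poly[OF z] by simp
  moreover have "phi (act_f A w) = \<zero>\<^bsub>TL.T\<^esub>" using phi_linear[OF wc] Suc.prems(2) by simp
  ultimately obtain N where "act_f N (act_f A w) = \<zero>\<^bsub>TB.T\<^esub>" using Suc.IH by blast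
  then have "act_f (N + A) w = \<zero>\<^bsub>TB.T\<^esub>" using act_f_act_f[OF wc] by simp
  moreover have "w = \<zero>\<^bsub>TB.T\<^esub>" if sat: "f_saturated M f"
  proof -
    have "m = \<zero>\<^bsub>M\<^esub>" by (rule saturated_torsion_free[OF sat m A])
    then have "w = z" using zc by (simp add: w el_zero_basis)
    then show ?thesis using Suc.IH[OF z] Suc.prems(2) sat by simp
  qed
  ultimately show ?case by blast
qed

text \<open>
  Write \<open>t w = f w + z\<close>: the first term is killed by a smaller power of \<open>f\<close>, the second has smaller pole order.
\<close>

lemma t_power_torsion:
  "fil n w \<Longrightarrow> act_f N w = \<zero>\<^bsub>TB.T\<^esub> \<Longrightarrow> weyl_t ^ (N + n) \<odot>\<^bsub>MB M f\<^esub> w = \<zero>\<^bsub>TB.T\<^esub>"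
proof (induction "N + n" arbitrary: N n w)
  case 0
  then have "fil 0 w" by simp
  from fil_0D[OF this] show ?case by simp
next
  case (Suc L)
  have wc: "w \<in> carrier TB.T" using fil_closed Suc.prems(1) .
  show ?case
  proof (cases "N = 0 \<or> n = 0")
    case True
    have "w = \<zero>\<^bsub>TB.T\<^esub>"
    proof (cases "N = 0")
      case True
      then show ?thesis using Suc.prems(2) wc MB.sm_one[of w] by (simp add: weyl_incl_one)
    next
      case False
      then have "fil 0 w" using \<open>N = 0 \<or> n = 0\<close> Suc.prems(1) by simp
      then show ?thesis by (rule fil_0D)
    qed
    then show ?thesis by simp
  next
    case False
    then obtain N' n' where Nn: "N = Suc N'" "n = Suc n'" by (cases N; cases n) simp_all
    let ?f = "weyl_incl (weyl_of_mpoly f)"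
    obtain z where z: "fil n' z" "weyl_t \<odot>\<^bsub>MB M f\<^esub> w = ?f \<odot>\<^bsub>MB M f\<^esub> w \<oplus>\<^bsub>TB.T\<^esub> z"
      using t_minus_f_fil[OF Suc.prems(1)] Nn by auto
    have zc: "z \<in> carrier TB.T" using fil_closed z(1) .
    have fw: "fil n (?f \<odot>\<^bsub>MB M f\<^esub> w)" by (rule fil_poly[OF Suc.prems(1)])
    have f1: "?f \<odot>\<^bsub>MB M f\<^esub> w = act_f 1 w" by simp
    have a1: "act_f N' (?f \<odot>\<^bsub>MB M f\<^esub> w) = \<zero>\<^bsub>TB.T\<^esub>"
      unfolding f1 act_f_act_f[OF wc] using Suc.prems(2) Nn by simp
    have a2: "act_f N (?f \<odot>\<^bsub>MB M f\<^esub> w) = \<zero>\<^bsub>TB.T\<^esub>"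
    proof -
      have "act_f N (act_f 1 w) = act_f 1 (act_f N w)" unfolding act_f_act_f[OF wc] by (simp add: add.commute)
      then show ?thesis unfolding f1 Suc.prems(2) by simp
    qed
    have "act_f N (weyl_t \<odot>\<^bsub>MB M f\<^esub> w) = weyl_t \<odot>\<^bsub>MB M f\<^esub> act_f N w"
      using wc by (intro MB.sm_commute) (simp_all add: weyl_t_incl)
    then have "act_f N (?f \<odot>\<^bsub>MB M f\<^esub> w \<oplus>\<^bsub>TB.T\<^esub> z) = \<zero>\<^bsub>TB.T\<^esub>" using Suc.prems(2) z(2) by simp
    then have a3: "act_f N z = \<zero>\<^bsub>TB.T\<^esub>"
      using wc zc a2 by (simp add: additive_map_plus[OF MB_additive])
    have "weyl_t ^ (N' + n) \<odot>\<^bsub>MB M f\<^esub> (?f \<odot>\<^bsub>MB M f\<^esub> w) = \<zero>\<^bsub>TB.T\<^esub>"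
      by (rule Suc.hyps(1)[OF _ fw a1]) (use Suc.hyps(2) Nn in simp)
    moreover have "weyl_t ^ (N + n') \<odot>\<^bsub>MB M f\<^esub> z = \<zero>\<^bsub>TB.T\<^esub>"
      by (rule Suc.hyps(1)[OF _ z(1) a3]) (use Suc.hyps(2) Nn in simp)
    ultimately have "weyl_t ^ (N' + n) \<odot>\<^bsub>MB M f\<^esub> (weyl_t \<odot>\<^bsub>MB M f\<^esub> w) = \<zero>\<^bsub>TB.T\<^esub>"
      unfolding z(2) using wc zc Nn by (simp add: additive_map_plus[OF MB_additive])
    moreover have "(weyl_t :: ('n option, 'k) weyl) ^ (N + n) = weyl_t ^ (N' + n) * weyl_t" unfolding Nn(1) add_Suc power_Suc2 by (rule refl)
    moreover have "(weyl_t ^ (N' + n) * weyl_t) \<odot>\<^bsub>MB M f\<^esub> w = weyl_t ^ (N' + n) \<odot>\<^bsub>MB M f\<^esub> (weyl_t \<odot>\<^bsub>MB M f\<^esub> w)"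
      by (rule MB.sm_mult) (simp add: wc)
    ultimately show ?thesis by (simp only:)
  qed
qed

end

section \<open>The subring \<open>D\<^sub>X[t \<partial>\<^sub>t]\<close>\<close>

lemma weyl_X_tdt_one: "1 \<in> weyl_X_tdt"
  and weyl_X_tdt_tdt: "weyl_t * weyl_dt \<in> weyl_X_tdt"
  and weyl_X_tdt_add: "P \<in> weyl_X_tdt \<Longrightarrow> Q \<in> weyl_X_tdt \<Longrightarrow> P + Q \<in> weyl_X_tdt"
  and weyl_X_tdt_mult: "P \<in> weyl_X_tdt \<Longrightarrow> Q \<in> weyl_X_tdt \<Longrightarrow> P * Q \<in> weyl_X_tdt"
  unfolding weyl_X_tdt_def
  using generate_ring.one[of ring_of_type_algebra] generate_ring.eng_add[of _ ring_of_type_algebra]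
    generate_ring.eng_mult[of _ ring_of_type_algebra] by (auto intro: generate_ring.incl)

lemma weyl_X_tdt_incl: "weyl_incl A \<in> weyl_X_tdt"
  unfolding weyl_X_tdt_def by (rule generate_ring.incl) simp

lemma ring_of_type_uminus: "\<ominus>\<^bsub>ring_of_type_algebra\<^esub> (x :: 'a::ring_1) = - x"
proof -
  interpret R: ring "ring_of_type_algebra :: 'a ring" by (rule ring_of_type_ring)
  show ?thesis by (rule R.minus_equality) simp_all
qed

lemma weyl_incl_minus_one: "weyl_incl (- 1) = - 1"
  by (metis weyl_incl_const weyl_const_minus weyl_const_one)

lemma weyl_X_tdt_const: "(weyl_const c :: ('n option, 'k::field) weyl) \<in> weyl_X_tdt"
  using weyl_X_tdt_incl[of "weyl_const c :: ('n, 'k) weyl"] by (simp add: weyl_incl_const)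

lemma weyl_X_tdt_uminus: "P \<in> weyl_X_tdt \<Longrightarrow> - P \<in> weyl_X_tdt"
  using weyl_X_tdt_mult[OF weyl_X_tdt_const[of "- 1"], of P] by (simp add: weyl_const_minus)

lemma weyl_X_tdt_zero: "0 \<in> weyl_X_tdt"
  using weyl_X_tdt_const[of 0] by simp

lemma weyl_X_tdt_induct [consumes 1, case_names incl tdt add mult]:
  assumes "P \<in> weyl_X_tdt" and incl: "\<And>A. R (weyl_incl A)" and tdt: "R (weyl_t * weyl_dt)"
    and add: "\<And>A B. R A \<Longrightarrow> R B \<Longrightarrow> R (A + B)" and mult: "\<And>A B. R A \<Longrightarrow> R B \<Longrightarrow> R (A * B)"
  shows "R P"
  using assms(1) unfolding weyl_X_tdt_def
proof (induction rule: generate_ring.induct)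
  case one
  then show ?case using incl[of 1] by (simp add: weyl_incl_one)
next
  case (a_inv h)
  then show ?case using mult[OF incl[of "- 1"], of h]
    by (simp add: ring_of_type_uminus weyl_incl_minus_one)
qed (use incl tdt add mult in auto)

abbreviation weyl_s :: "('n option, 'k::field) weyl" where
  "weyl_s \<equiv> - (weyl_dt * weyl_t)"

lemma weyl_s_eq: "weyl_s = - (weyl_t * weyl_dt) - 1"
  by (simp add: weyl_dt_t)

lemma weyl_X_tdt_s: "weyl_s \<in> weyl_X_tdt"
  using weyl_X_tdt_add[OF weyl_X_tdt_uminus[OF weyl_X_tdt_tdt] weyl_X_tdt_uminus[OF weyl_X_tdt_one]]
  by (simp add: weyl_s_eq)

lemma weyl_X_tdt_power: "P \<in> weyl_X_tdt \<Longrightarrow> P ^ k \<in> weyl_X_tdt"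
  by (induction k) (simp_all add: weyl_X_tdt_one weyl_X_tdt_mult)

lemma weyl_X_tdt_poly_eval: "P \<in> weyl_X_tdt \<Longrightarrow> weyl_poly_eval b P \<in> weyl_X_tdt"
  by (induction b rule: pCons_induct)
    (simp_all add: weyl_poly_eval_pCons weyl_X_tdt_zero weyl_X_tdt_add weyl_X_tdt_mult weyl_X_tdt_const)

text \<open>
  \<open>t\<close> commutes with \<open>D\<^sub>X\<close> and can be moved past \<open>t \<partial>\<^sub>t\<close> at the cost of a constant, in either direction.
\<close>

lemma t_weyl_X_tdt:
  assumes "P \<in> weyl_X_tdt" shows "\<exists>Q\<in>weyl_X_tdt. weyl_t * P = Q * weyl_t"
  using assms
proof (induction rule: weyl_X_tdt_induct)
  case (incl A)
  then show ?case using weyl_t_incl weyl_X_tdt_incl by blast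
next
  case tdt
  have "weyl_t * (weyl_t * weyl_dt) = (weyl_t * weyl_dt - 1) * weyl_t"
    by (simp add: left_diff_distrib mult.assoc weyl_dt_t distrib_left)
  moreover have "weyl_t * weyl_dt - 1 \<in> weyl_X_tdt"
    using weyl_X_tdt_add[OF weyl_X_tdt_tdt weyl_X_tdt_uminus[OF weyl_X_tdt_one]] by simp
  ultimately show ?case by blast
next
  case (add A B)
  then obtain A' B' where AB: "A' \<in> weyl_X_tdt" "weyl_t * A = A' * weyl_t" "B' \<in> weyl_X_tdt" "weyl_t * B = B' * weyl_t" by blast
  have "weyl_t * (A + B) = (A' + B') * weyl_t" by (simp only: distrib_left distrib_right AB(2,4))
  then show ?case using weyl_X_tdt_add[OF AB(1,3)] by blast
next
  case (mult A B)
  then obtain A' B' where AB: "A' \<in> weyl_X_tdt" "weyl_t * A = A' * weyl_t" "B' \<in> weyl_X_tdt" "weyl_t * B = B' * weyl_t" by blast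
  have "weyl_t * (A * B) = A' * (weyl_t * B)" by (simp only: AB(2) flip: mult.assoc)
  then have "weyl_t * (A * B) = (A' * B') * weyl_t" by (simp only: AB(4) mult.assoc)
  then show ?case using weyl_X_tdt_mult[OF AB(1,3)] by blast
qed

lemma weyl_X_tdt_t:
  assumes "P \<in> weyl_X_tdt" shows "\<exists>Q\<in>weyl_X_tdt. P * weyl_t = weyl_t * Q"
  using assms
proof (induction rule: weyl_X_tdt_induct)
  case (incl A)
  then show ?case using weyl_t_incl[symmetric] weyl_X_tdt_incl by blast
next
  case tdt
  have "weyl_t * weyl_dt * weyl_t = weyl_t * (weyl_t * weyl_dt + 1)"
    by (simp add: mult.assoc weyl_dt_t)
  then show ?case using weyl_X_tdt_add[OF weyl_X_tdt_tdt weyl_X_tdt_one] by blast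
next
  case (add A B)
  then obtain A' B' where AB: "A' \<in> weyl_X_tdt" "A * weyl_t = weyl_t * A'" "B' \<in> weyl_X_tdt" "B * weyl_t = weyl_t * B'" by blast
  have "(A + B) * weyl_t = weyl_t * (A' + B')" by (simp only: distrib_left distrib_right AB(2,4))
  then show ?case using weyl_X_tdt_add[OF AB(1,3)] by blast
next
  case (mult A B)
  then obtain A' B' where AB: "A' \<in> weyl_X_tdt" "A * weyl_t = weyl_t * A'" "B' \<in> weyl_X_tdt" "B * weyl_t = weyl_t * B'" by blast
  have "A * B * weyl_t = (A * weyl_t) * B'" by (simp only: AB(4) mult.assoc)
  then have "A * B * weyl_t = weyl_t * (A' * B')" by (simp only: AB(2) mult.assoc)
  then show ?case using weyl_X_tdt_mult[OF AB(1,3)] by blast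
qed

text \<open>
  \<open>rising N\<close> is \<open>(-s)(1 - s) \<cdots> (N - 1 - s)\<close>, whose value at \<open>s = -\<partial>\<^sub>t t\<close> is the rising factorial of \<open>\<partial>\<^sub>t t\<close>.
\<close>

fun rising :: "nat \<Rightarrow> 'k::field poly" where
  "rising 0 = 1"
| "rising (Suc N) = rising N * [:of_nat N, - 1:]"

lemma rising_nonzero: "rising N \<noteq> 0"
proof (induction N)
  case (Suc N)
  show ?case unfolding rising.simps by (rule no_zero_divisors[OF Suc]) simp
qed simp

lemma dt_t_power: "weyl_dt * weyl_t * weyl_t ^ N = weyl_t ^ N * (of_nat N + weyl_dt * weyl_t)"
proof (induction N)
  case (Suc N)
  have c: "weyl_t * (of_nat N :: ('a option, 'b) weyl) = of_nat N * weyl_t" by (rule mult_of_nat_commute[symmetric])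
  have d: "weyl_dt * weyl_t * weyl_t = weyl_t * (1 + weyl_dt * (weyl_t :: ('a option, 'b) weyl))"
    by (simp add: weyl_dt_t distrib_right distrib_left mult.assoc)
  have "weyl_dt * weyl_t * weyl_t ^ Suc N = (weyl_dt * weyl_t * weyl_t ^ N) * (weyl_t :: ('a option, 'b) weyl)"
    by (simp only: power_Suc2 mult.assoc)
  also have "\<dots> = weyl_t ^ N * (of_nat N * weyl_t + weyl_dt * weyl_t * weyl_t)"
    unfolding Suc by (simp only: distrib_right mult.assoc)
  also have "\<dots> = weyl_t ^ N * (weyl_t * (of_nat N + (1 + weyl_dt * weyl_t)))"
    unfolding d by (simp only: c distrib_left)
  also have "\<dots> = weyl_t ^ Suc N * (of_nat (Suc N) + weyl_dt * weyl_t)"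
    by (simp only: power_Suc2 mult.assoc of_nat_Suc add_ac)
  finally show ?case .
qed simp

text \<open>
  The innermost factor \<open>\<partial>\<^sub>t t\<close> of \<open>\<partial>\<^sub>t\<^sup>N\<^sup>+\<^sup>1 t\<^sup>N\<^sup>+\<^sup>1\<close> picks up the constant \<open>N\<close> on its way to the right past \<open>t\<^sup>N\<close>.
\<close>

lemma dt_power_t_power: "weyl_dt ^ N * weyl_t ^ N = weyl_poly_eval (rising N) weyl_s"
proof (induction N)
  case 0
  have "weyl_poly_eval 1 P = 1" for P :: "('a option, 'b) weyl" by (simp add: weyl_poly_eval_def)
  then show ?case by simp
next
  case (Suc N)
  have e: "weyl_poly_eval [:of_nat N, - 1:] weyl_s = of_nat N + weyl_dt * (weyl_t :: ('a option, 'b) weyl)"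
    by (simp add: weyl_poly_eval_pCons weyl_const_of_nat weyl_const_minus)
  have "weyl_dt ^ Suc N * weyl_t ^ Suc N = weyl_dt ^ N * (weyl_dt * weyl_t * (weyl_t :: ('a option, 'b) weyl) ^ N)"
    by (simp only: power_Suc2[of weyl_dt] power_Suc[of weyl_t] mult.assoc)
  also have "\<dots> = weyl_dt ^ N * weyl_t ^ N * (of_nat N + weyl_dt * weyl_t)"
    unfolding dt_t_power by (simp only: mult.assoc)
  finally show ?case unfolding Suc rising.simps weyl_poly_eval_mult e .
qed


section \<open>Comparing the two kinds of functional equation\<close>

context bzy_tensor
begin

lemma phi_weyl_s_power:
  assumes z: "z \<in> carrier TB.T"
  shows "phi (weyl_s ^ k \<odot>\<^bsub>MB M f\<^esub> z) = Poly_Mapping.single k 1 \<odot>\<^bsub>MFs M f\<^esub> phi z"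
proof (induction k)
  case 0
  have "1 \<odot>\<^bsub>MB M f\<^esub> z = z" "1 \<odot>\<^bsub>MFs M f\<^esub> phi z = phi z"
    using z by (simp_all add: MB.sm_one MF.sm_one)
  then show ?case by (simp only: power_0 single_one)
next
  case (Suc k)
  have c: "z \<in> carrier (MB M f)" "phi z \<in> carrier (MFs M f)" using z by simp_all
  have "phi (weyl_s ^ Suc k \<odot>\<^bsub>MB M f\<^esub> z) = phi (weyl_s \<odot>\<^bsub>MB M f\<^esub> (weyl_s ^ k \<odot>\<^bsub>MB M f\<^esub> z))"
    by (simp only: power_Suc MB.sm_mult[OF c(1)])
  also have "\<dots> = Poly_Mapping.single 1 1 \<odot>\<^bsub>MFs M f\<^esub> phi (weyl_s ^ k \<odot>\<^bsub>MB M f\<^esub> z)"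
    by (rule phi_s) (simp only: MB_closed z)
  also have "\<dots> = (Poly_Mapping.single 1 1 * Poly_Mapping.single k 1) \<odot>\<^bsub>MFs M f\<^esub> phi z"
    by (simp only: Suc MF.sm_mult[OF c(2)])
  also have "Poly_Mapping.single 1 1 * Poly_Mapping.single k 1 = Poly_Mapping.single (Suc k) (1 :: ('n, 'k) weyl)"
    by (simp only: Poly_Mapping.mult_single) simp
  finally show ?case .
qed

lemma phi_single:
  assumes z: "z \<in> carrier TB.T"
  shows "phi ((weyl_incl A * weyl_s ^ k) \<odot>\<^bsub>MB M f\<^esub> z) = Poly_Mapping.single k A \<odot>\<^bsub>MFs M f\<^esub> phi z"
proof -
  have c: "z \<in> carrier (MB M f)" "phi z \<in> carrier (MFs M f)" using z by simp_all
  have "phi ((weyl_incl A * weyl_s ^ k) \<odot>\<^bsub>MB M f\<^esub> z) = phi (weyl_incl A \<odot>\<^bsub>MB M f\<^esub> (weyl_s ^ k \<odot>\<^bsub>MB M f\<^esub> z))"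
    by (simp only: MB.sm_mult[OF c(1)])
  also have "\<dots> = Poly_Mapping.single 0 A \<odot>\<^bsub>MFs M f\<^esub> phi (weyl_s ^ k \<odot>\<^bsub>MB M f\<^esub> z)"
    by (rule phi_linear) (simp only: MB_closed z)
  also have "\<dots> = (Poly_Mapping.single 0 A * Poly_Mapping.single k 1) \<odot>\<^bsub>MFs M f\<^esub> phi z"
    by (simp only: phi_weyl_s_power[OF z] MF.sm_mult[OF c(2)])
  also have "Poly_Mapping.single 0 A * Poly_Mapping.single k 1 = Poly_Mapping.single k A"
    by (simp only: Poly_Mapping.mult_single) simp
  finally show ?thesis .
qed

definition transports :: "('n option, 'k) weyl \<Rightarrow> (nat \<Rightarrow>\<^sub>0 ('n, 'k) weyl) \<Rightarrow> bool" where
  "transports P Q \<longleftrightarrow> (\<forall>z\<in>carrier TB.T. phi (P \<odot>\<^bsub>MB M f\<^esub> z) = Q \<odot>\<^bsub>MFs M f\<^esub> phi z)"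

lemma transportsD: "transports P Q \<Longrightarrow> z \<in> carrier TB.T \<Longrightarrow> phi (P \<odot>\<^bsub>MB M f\<^esub> z) = Q \<odot>\<^bsub>MFs M f\<^esub> phi z"
  by (simp add: transports_def)

lemma transports_add: "transports P Q \<Longrightarrow> transports P' Q' \<Longrightarrow> transports (P + P') (Q + Q')"
  using MB.sm_add_left MF.sm_add_left by (simp add: transports_def additive_map_plus[OF phi_additive])

lemma transports_mult: "transports P Q \<Longrightarrow> transports P' Q' \<Longrightarrow> transports (P * P') (Q * Q')"
  using MB.sm_mult MF.sm_mult by (simp add: transports_def)

lemma transports_zero: "transports 0 0"
  using MB.sm_zero_left MF.sm_zero_left additive_map_zero[OF TB.abelian_group_T TL.abelian_group_T phi_additive]
  by (simp add: transports_def)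

lemma transports_single: "transports (weyl_incl A * weyl_s ^ k) (Poly_Mapping.single k A)"
  by (simp add: transports_def phi_single)

lemma transports_incl: "transports (weyl_incl A) (Poly_Mapping.single 0 A)"
  using transports_single[of A 0] by simp

lemma transports_sum: "(\<And>i. i \<in> A \<Longrightarrow> transports (g i) (h i)) \<Longrightarrow> transports (sum g A) (sum h A)"
  by (induction A rule: infinite_finite_induct) (simp_all add: transports_zero transports_add)

lemma transports_poly_eval: "transports (weyl_poly_eval b weyl_s) (weyl_s_of_poly b)"
  unfolding weyl_poly_eval_def weyl_s_of_poly_def
  using transports_single[of "weyl_const _"] by (intro transports_sum) (simp add: weyl_incl_const)

text \<open>
  \<open>D\<^sub>X[t \<partial>\<^sub>t]\<close> corresponds to \<open>D\<^sub>X[s]\<close>, as \<open>t \<partial>\<^sub>t = -s - 1\<close> for \<open>s = -\<partial>\<^sub>t t\<close>.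
\<close>

lemma transports_from: "P \<in> weyl_X_tdt \<Longrightarrow> \<exists>Q. transports P Q"
proof (induction rule: weyl_X_tdt_induct)
  case (incl A)
  then show ?case using transports_incl by blast
next
  case tdt
  have "transports (weyl_incl (- 1) * weyl_s ^ 1 + weyl_incl (- 1)) (Poly_Mapping.single 1 (- 1) + Poly_Mapping.single 0 (- 1))"
    by (intro transports_add transports_single transports_incl)
  moreover have "weyl_incl (- 1) * weyl_s ^ 1 + weyl_incl (- 1) = (weyl_t * weyl_dt :: ('n option, 'k) weyl)"
    by (simp add: weyl_dt_t weyl_incl_minus_one)
  ultimately show ?case by metis
qed (use transports_add transports_mult in blast)+

lemma transports_onto: "\<exists>P\<in>weyl_X_tdt. transports P Q"
proof (induction Q rule: poly_mapping_add_induct)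
  case zero
  then show ?case using transports_zero weyl_X_tdt_zero by blast
next
  case (single k A)
  then show ?case
    using transports_single[of A k] weyl_X_tdt_mult[OF weyl_X_tdt_incl[of A] weyl_X_tdt_power[OF weyl_X_tdt_s]] by blast
next
  case (add P Q)
  then show ?case using transports_add weyl_X_tdt_add by blast
qed

context
  fixes u :: 'm
  assumes u: "u \<in> carrier M"
begin

abbreviation "v \<equiv> MB_elem M f u (delta f)"
abbreviation "fv \<equiv> weyl_incl (weyl_of_mpoly f) \<odot>\<^bsub>MB M f\<^esub> v"

lemma v_eq: "v = TB.el u (basis 0)"
  by (simp add: MB_elem_eq delta_eq)

lemma v_closed: "v \<in> carrier TB.T"
  using u by (simp add: v_eq)

lemma fv_closed: "fv \<in> carrier TB.T"
  by (rule MB_closed[OF v_closed])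

lemma t_v: "weyl_t \<odot>\<^bsub>MB M f\<^esub> v = fv"
  using u by (simp add: v_eq MB_t_el t_basis_0 MB_poly_el')

lemma phi_v: "phi v = MFs_elem M f u (fs_power f 0)"
proof -
  have "fs_power f 0 = mellin (basis 0)" by (simp add: fs_power_def mellin_basis one_pCons)
  then show ?thesis using u by (simp add: v_eq phi_el MFs_elem_eq)
qed

lemma phi_fv: "phi fv = MFs_elem M f u (fs_power f 1)"
proof -
  have "fs_power f 1 = mellin (weyl_incl (weyl_of_mpoly f) \<odot>\<^bsub>BZY f\<^esub> basis 0)"
    by (simp add: fs_power_def mellin_poly mellin_basis)
  then show ?thesis using u by (simp add: v_eq MB_poly_el' phi_el MFs_elem_eq)
qed

definition Dfv where "Dfv = {P \<odot>\<^bsub>MB M f\<^esub> fv | P. P \<in> weyl_X_tdt}"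

definition delta_polys where "delta_polys = {b. weyl_poly_eval b weyl_s \<odot>\<^bsub>MB M f\<^esub> v \<in> Dfv}"

lemma tDv_eq: "{weyl_t \<odot>\<^bsub>MB M f\<^esub> (P \<odot>\<^bsub>MB M f\<^esub> v) | P. P \<in> weyl_X_tdt} =
  {P \<odot>\<^bsub>MB M f\<^esub> (weyl_t \<odot>\<^bsub>MB M f\<^esub> v) | P. P \<in> weyl_X_tdt}"
proof -
  have m: "P \<odot>\<^bsub>MB M f\<^esub> (Q \<odot>\<^bsub>MB M f\<^esub> v) = (P * Q) \<odot>\<^bsub>MB M f\<^esub> v" for P Q
    using MB.sm_mult[of v P Q] v_closed by simp
  show ?thesis
    unfolding m using t_weyl_X_tdt weyl_X_tdt_t by (auto; metis)
qed

text \<open>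
  Apply \<open>phi\<close> to the functional equation of \<open>v\<close>.
\<close>

lemma delta_polys_subset: "delta_polys \<subseteq> bernstein_polys M u f"
proof
  fix b assume "b \<in> delta_polys"
  then obtain P where P: "P \<in> weyl_X_tdt" "weyl_poly_eval b weyl_s \<odot>\<^bsub>MB M f\<^esub> v = P \<odot>\<^bsub>MB M f\<^esub> fv"
    by (auto simp: delta_polys_def Dfv_def)
  obtain Q where Q: "transports P Q" using transports_from[OF P(1)] by blast
  have "weyl_s_of_poly b \<odot>\<^bsub>MFs M f\<^esub> phi v = phi (weyl_poly_eval b weyl_s \<odot>\<^bsub>MB M f\<^esub> v)"
    by (rule transportsD[OF transports_poly_eval v_closed, symmetric])
  also have "\<dots> = Q \<odot>\<^bsub>MFs M f\<^esub> phi fv"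
    unfolding P(2) by (rule transportsD[OF Q fv_closed])
  finally have "weyl_s_of_poly b \<odot>\<^bsub>MFs M f\<^esub> phi v = Q \<odot>\<^bsub>MFs M f\<^esub> phi fv" .
  then show "b \<in> bernstein_polys M u f"
    unfolding bernstein_polys_def phi_v phi_fv by blast
qed

text \<open>
  Every operator in \<open>D\<^sub>X[s]\<close> comes from one in \<open>D\<^sub>X[t \<partial>\<^sub>t]\<close>, so the two sides of a lifted equation have the same image
  under \<open>phi\<close>.
\<close>

lemma bernstein_kernel:
  assumes "b \<in> bernstein_polys M u f"
  obtains P w where "P \<in> weyl_X_tdt" "w \<in> carrier TB.T" "phi w = \<zero>\<^bsub>TL.T\<^esub>"
    "weyl_poly_eval b weyl_s \<odot>\<^bsub>MB M f\<^esub> v = P \<odot>\<^bsub>MB M f\<^esub> fv \<oplus>\<^bsub>TB.T\<^esub> w"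
proof -
  obtain Q where Q: "weyl_s_of_poly b \<odot>\<^bsub>MFs M f\<^esub> phi v = Q \<odot>\<^bsub>MFs M f\<^esub> phi fv"
    using assms unfolding bernstein_polys_def phi_v phi_fv by blast
  obtain P where P: "P \<in> weyl_X_tdt" "transports P Q" using transports_onto by blast
  define x where "x = weyl_poly_eval b weyl_s \<odot>\<^bsub>MB M f\<^esub> v"
  define y where "y = P \<odot>\<^bsub>MB M f\<^esub> fv"
  have c: "x \<in> carrier TB.T" "y \<in> carrier TB.T" using v_closed by (simp_all add: x_def y_def)
  have "phi x = phi y"
    unfolding x_def y_def transportsD[OF transports_poly_eval v_closed] transportsD[OF P(2) fv_closed] by (rule Q)
  then have "phi (x \<ominus>\<^bsub>TB.T\<^esub> y) = \<zero>\<^bsub>TL.T\<^esub>"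
    using c unfolding a_minus_def
    by (simp add: additive_map_plus[OF phi_additive] additive_map_minus[OF TB.abelian_group_T TL.abelian_group_T phi_additive] TL.T.r_neg)
  moreover have "x = y \<oplus>\<^bsub>TB.T\<^esub> (x \<ominus>\<^bsub>TB.T\<^esub> y)"
    using c unfolding a_minus_def by (simp add: TB.T.a_ac TB.T.r_neg1 TB.T.r_neg2 TB.T.r_neg)
  ultimately show ?thesis
    using that[of P "x \<ominus>\<^bsub>TB.T\<^esub> y"] P(1) c unfolding x_def y_def by simp
qed

text \<open>
  The error term \<open>w\<close> satisfies \<open>t\<^sup>N w = 0\<close>; applying \<open>\<partial>\<^sub>t\<^sup>N\<close> to the equation multiplied by \<open>t\<^sup>N\<close> removes it and keeps an
  operator of the form \<open>c(-\<partial>\<^sub>t t)\<close> in front.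
\<close>

lemma bernstein_multiple:
  assumes "b \<in> bernstein_polys M u f" shows "\<exists>N. rising N * b \<in> delta_polys"
proof -
  obtain P w where P: "P \<in> weyl_X_tdt" "w \<in> carrier TB.T" "phi w = \<zero>\<^bsub>TL.T\<^esub>"
    "weyl_poly_eval b weyl_s \<odot>\<^bsub>MB M f\<^esub> v = P \<odot>\<^bsub>MB M f\<^esub> fv \<oplus>\<^bsub>TB.T\<^esub> w"
    using bernstein_kernel[OF assms] .
  obtain n where n: "fil n w" using fil_exhaustive[OF P(2)] by blast
  obtain A where "act_f A w = \<zero>\<^bsub>TB.T\<^esub>" using phi_kernel[OF n P(3)] by blast
  then have "weyl_t ^ (A + n) \<odot>\<^bsub>MB M f\<^esub> w = \<zero>\<^bsub>TB.T\<^esub>" by (rule t_power_torsion[OF n])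
  then obtain N where N: "weyl_t ^ N \<odot>\<^bsub>MB M f\<^esub> w = \<zero>\<^bsub>TB.T\<^esub>" by blast
  let ?R = "weyl_poly_eval (rising N) weyl_s :: ('n option, 'k) weyl"
  have "?R \<odot>\<^bsub>MB M f\<^esub> w = weyl_dt ^ N \<odot>\<^bsub>MB M f\<^esub> (weyl_t ^ N \<odot>\<^bsub>MB M f\<^esub> w)"
    using MB.sm_mult[of w "weyl_dt ^ N" "weyl_t ^ N"] P(2) by (simp add: dt_power_t_power)
  then have R: "?R \<odot>\<^bsub>MB M f\<^esub> w = \<zero>\<^bsub>TB.T\<^esub>" by (simp add: N)
  have "weyl_poly_eval (rising N * b) weyl_s \<odot>\<^bsub>MB M f\<^esub> v = ?R \<odot>\<^bsub>MB M f\<^esub> (P \<odot>\<^bsub>MB M f\<^esub> fv \<oplus>\<^bsub>TB.T\<^esub> w)"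
    using MB.sm_mult[of v ?R "weyl_poly_eval b weyl_s"] v_closed by (simp add: weyl_poly_eval_mult P(4))
  also have "\<dots> = (?R * P) \<odot>\<^bsub>MB M f\<^esub> fv"
    using MB.sm_mult[of fv ?R P] v_closed P(2) by (simp add: additive_map_plus[OF MB_additive] R)
  finally show ?thesis
    using weyl_X_tdt_mult[OF weyl_X_tdt_poly_eval[OF weyl_X_tdt_s] P(1)]
    unfolding delta_polys_def Dfv_def by blast
qed

lemma bernstein_saturated: "f_saturated M f \<Longrightarrow> bernstein_polys M u f = delta_polys"
proof (rule equalityI[OF _ delta_polys_subset], rule subsetI)
  fix b assume sat: "f_saturated M f" and b: "b \<in> bernstein_polys M u f"
  obtain P w where P: "P \<in> weyl_X_tdt" "w \<in> carrier TB.T" "phi w = \<zero>\<^bsub>TL.T\<^esub>"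
    "weyl_poly_eval b weyl_s \<odot>\<^bsub>MB M f\<^esub> v = P \<odot>\<^bsub>MB M f\<^esub> fv \<oplus>\<^bsub>TB.T\<^esub> w"
    using bernstein_kernel[OF b] .
  obtain n where n: "fil n w" using fil_exhaustive[OF P(2)] by blast
  have "w = \<zero>\<^bsub>TB.T\<^esub>" using phi_kernel[OF n P(3)] sat by blast
  then show "b \<in> delta_polys"
    using P v_closed unfolding delta_polys_def Dfv_def by auto
qed

lemma delta_polys_add: "b \<in> delta_polys \<Longrightarrow> c \<in> delta_polys \<Longrightarrow> b + c \<in> delta_polys"
proof -
  assume "b \<in> delta_polys" "c \<in> delta_polys"
  then obtain P Q where PQ: "P \<in> weyl_X_tdt" "weyl_poly_eval b weyl_s \<odot>\<^bsub>MB M f\<^esub> v = P \<odot>\<^bsub>MB M f\<^esub> fv"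
    "Q \<in> weyl_X_tdt" "weyl_poly_eval c weyl_s \<odot>\<^bsub>MB M f\<^esub> v = Q \<odot>\<^bsub>MB M f\<^esub> fv"
    by (auto simp: delta_polys_def Dfv_def)
  have "weyl_poly_eval (b + c) weyl_s \<odot>\<^bsub>MB M f\<^esub> v = (P + Q) \<odot>\<^bsub>MB M f\<^esub> fv"
    using MB.sm_add_left v_closed PQ by (simp add: weyl_poly_eval_add)
  then show ?thesis using weyl_X_tdt_add[OF PQ(1,3)] unfolding delta_polys_def Dfv_def by blast
qed

lemma delta_polys_smult: "b \<in> delta_polys \<Longrightarrow> Polynomial.smult a b \<in> delta_polys"
proof -
  assume "b \<in> delta_polys"
  then obtain P where P: "P \<in> weyl_X_tdt" "weyl_poly_eval b weyl_s \<odot>\<^bsub>MB M f\<^esub> v = P \<odot>\<^bsub>MB M f\<^esub> fv"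
    by (auto simp: delta_polys_def Dfv_def)
  have "weyl_poly_eval (Polynomial.smult a b) weyl_s \<odot>\<^bsub>MB M f\<^esub> v = (weyl_const a * P) \<odot>\<^bsub>MB M f\<^esub> fv"
    using MB.sm_mult[of v "weyl_const a" "weyl_poly_eval b weyl_s"] MB.sm_mult[of fv "weyl_const a" P] v_closed P
    by (simp add: weyl_poly_eval_smult)
  then show ?thesis
    using weyl_X_tdt_mult[OF weyl_X_tdt_const P(1)] unfolding delta_polys_def Dfv_def by blast
qed

end

end

text \<open>
  The difference of two monic elements of the same least degree has smaller degree and lies in \<open>S\<close>, so it is zero.
\<close>

lemma least_monic_unique:
  fixes S :: "'k::field poly set"
  assumes add: "\<And>b c. b \<in> S \<Longrightarrow> c \<in> S \<Longrightarrow> b + c \<in> S" and smult: "\<And>a b. b \<in> S \<Longrightarrow> Polynomial.smult a b \<in> S"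
    and ex: "\<exists>b\<in>S. b \<noteq> 0"
  shows "\<exists>!b. is_least_monic S b"
proof -
  obtain b where b: "b \<in> S" "b \<noteq> 0" "\<And>c. c \<in> S \<Longrightarrow> c \<noteq> 0 \<Longrightarrow> Polynomial.degree b \<le> Polynomial.degree c"
    using ex_has_least_nat[of "\<lambda>b. b \<in> S \<and> b \<noteq> 0" _ Polynomial.degree] ex by blast
  have "is_least_monic S (Polynomial.smult (inverse (Polynomial.lead_coeff b)) b)"
    unfolding is_least_monic_def using b smult by simp
  moreover have "p = q" if pq: "is_least_monic S p" "is_least_monic S q" for p q
  proof (rule ccontr)
    assume "p \<noteq> q"
    have "p \<in> S" "q \<in> S" using pq by (auto simp: is_least_monic_def)
    then have "p + Polynomial.smult (- 1) q \<in> S" by (intro add smult)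
    then have d: "p - q \<in> S" "p - q \<noteq> 0" using \<open>p \<noteq> q\<close> by simp_all
    have nz: "p \<noteq> 0" "q \<noteq> 0" using pq by (auto simp: is_least_monic_def)
    then have deg: "Polynomial.degree p = Polynomial.degree q"
      using pq unfolding is_least_monic_def by (meson le_antisym)
    have "Polynomial.degree p \<le> Polynomial.degree (p - q)"
      using pq(1) d unfolding is_least_monic_def by simp
    moreover have "Polynomial.coeff (p - q) (Polynomial.degree p) = 0"
      using pq deg by (simp add: is_least_monic_def)
    moreover have "Polynomial.degree (p - q) \<le> Polynomial.degree p"
      using deg by (intro Polynomial.degree_diff_le) simp_all
    ultimately have "p - q = 0" by (metis le_antisym leading_coeff_0_iff)
    then show False using \<open>p \<noteq> q\<close> by simp
  qed
  ultimately show ?thesis by blast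
qed

theorem proposition3p7:
  fixes M :: "(('n::{finite,linorder}, 'k::field_char_0) weyl, 'm) module"
    and u :: 'm
    and f :: "('n, 'k) mpoly"
  assumes "left_module ring_of_type_algebra M"
    and "u \<in> carrier M"
    and "carrier M = {P \<odot>\<^bsub>M\<^esub> u | P. True}"
    and "\<forall>c. f \<noteq> mpoly_const c"
  shows
    "let v = MB_elem M f u (delta f);
         tDv = {weyl_t \<odot>\<^bsub>MB M f\<^esub> (P \<odot>\<^bsub>MB M f\<^esub> v) | P. P \<in> weyl_X_tdt};
         Dtv = {P \<odot>\<^bsub>MB M f\<^esub> (weyl_t \<odot>\<^bsub>MB M f\<^esub> v) | P. P \<in> weyl_X_tdt};
         Dfv = {P \<odot>\<^bsub>MB M f\<^esub> (weyl_incl (weyl_of_mpoly f) \<odot>\<^bsub>MB M f\<^esub> v) | P. P \<in> weyl_X_tdt};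
         S = {b. weyl_poly_eval b (- (weyl_dt * weyl_t)) \<odot>\<^bsub>MB M f\<^esub> v \<in> tDv}
     in tDv = Dtv \<and> Dtv = Dfv \<and>
        (b_function_exists M u f \<longleftrightarrow> (\<exists>b\<in>S. b \<noteq> 0)) \<and>
        (f_saturated M f \<and> (\<exists>b\<in>S. b \<noteq> 0) \<longrightarrow>
           (\<forall>b. is_least_monic S b \<longleftrightarrow> b = b_function M u f))"
proof -
  have "f \<noteq> 0" using assms(4) by (metis mpoly_const_def single_zero)
  then interpret bzy_tensor f M
    by (intro bzy_tensor.intro fs.intro type_module.intro assms(1))
  note u = assms(2)
  let ?S = "delta_polys u"
  have tD: "{weyl_t \<odot>\<^bsub>MB M f\<^esub> (P \<odot>\<^bsub>MB M f\<^esub> MB_elem M f u (delta f)) | P. P \<in> weyl_X_tdt} = Dfv u"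
    unfolding tDv_eq[OF u] t_v[OF u] Dfv_def[OF u] ..
  have ex: "b_function_exists M u f \<longleftrightarrow> (\<exists>b\<in>?S. b \<noteq> 0)"
    unfolding b_function_exists_def
    using delta_polys_subset[OF u] bernstein_multiple[OF u] rising_nonzero by (metis mult_eq_0_iff subsetD)
  have least: "is_least_monic ?S b \<longleftrightarrow> b = b_function M u f" if "f_saturated M f" "\<exists>b\<in>?S. b \<noteq> 0" for b
  proof -
    have "\<exists>!b. is_least_monic ?S b"
      by (rule least_monic_unique[OF delta_polys_add[OF u] delta_polys_smult[OF u] that(2)])
    then show ?thesis
      unfolding b_function_def bernstein_saturated[OF u that(1)] by (metis the_equality)
  qed
  show ?thesis
    unfolding Let_def tD t_v[OF u] using ex least
    unfolding delta_polys_def[OF u] Dfv_def[OF u] by blast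
qed

end
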